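(* Let $(X,d,\mathfrak m)$ be a complete $\mathrm{PI}_p$ space with doubling dimension $Q>1$, Poincaré exponent $p\ge 1$ and Poincaré constants $C_P>0$ and $\lambda\ge 1$. Assume that $p<Q$ and that there exist $o\in X$, $\eta\in(p,Q]$ and $C_o>0$ such that $$\frac{\mathfrak m(B_R(o))}{\mathfrak m(B_r(o))}\ge C_o\left(\frac{R}{r}\right)^{\eta}\qquad \text{for all } 0<r\le R<+\infty .$$ Set $r_o(\cdot):=d(o,\cdot)$. Then for any $s\in[p,\eta)$ there exists $C=C(Q,C_o,\eta,s)>0$ such that for any $f\in H^{1,s}(X,d,\mathfrak m)$, $$\int_X |f|^s\,r_o^{-s}\,d\mathfrak m\le C\,\mathsf{Ch}_s(f).$$
   Context: A metric measure space is a triple $(X,d,\mathfrak m)$ where $(X,d)$ is a separable metric space and $\mathfrak m$ is a non-negative Borel regular measure on $X$ which is finite and non-zero on balls with finite and non-zero radius. $B_r(x)$ is the open ball of center $x$ and radius $r$. If $0<\mathfrak m(A)<\infty$ and $f$ is integrable on $A$, $f_A=⨍_A f\,d\mathfrak m:=\mathfrak m(A)^{-1}\int_A f\,d\mathfrak m$ (the symbol $⨍$ denotes the mean value). Upper gradients: a Borel function $g:X\to[0,+\infty]$ is an upper gradient of $f:X\to[-\infty,+\infty]$ if $|f(\gamma(L))-f(\gamma(0))|\le\int_0^L g(\gamma(\tau))\,d\tau$ for any rectifiable curve $\gamma:[0,L]\to X$ parametrized by arc-length. $\mathrm{UG}^p(f)$ is the set of $p$-integrable upper gradients of $f$. Cheeger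 energy: for $s\in[1,\infty)$ and $f\in L^s(X,\mathfrak m)$, $\mathsf{Ch}_s(f):=\inf\{\liminf_{i\to\infty}\|g_i\|_{L^s}^s\}\in[0,+\infty]$, the infimum being over all sequences $\{f_i\}\subset L^s(X,\mathfrak m)$ and non-negative measurable $\{g_i\}$ such that $g_i$ is an upper gradient of $f_i$ and $\|f_i-f\|_{L^s}\to0$. $H^{1,s}(X,d,\mathfrak m):=\{f\in L^s(X,\mathfrak m):\mathsf{Ch}_s(f)<+\infty\}$. $\mathrm{PI}_p$ space (with Poincaré exponent $p\ge 1$ and Poincaré constants $C_P>0$, $\lambda\ge1$): a metric measure space such that (i) there exists $C_D\ge1$ with $\mathfrak m(B_{2r}(x))\le C_D\,\mathfrak m(B_r(x))$ for all $x\in X$, $r>0$ (doubling); (ii) for all $f\in L^1_{loc}(X,\mathfrak m)$, all $g\in\mathrm{UG}^p(f)$ and every ball $B_r$ of radius $r>0$ (with $B_{\lambda r}$ the concentric ball of radius $\lambda r$), $\left(⨍_{B_r}|f-f_{B_r}|^p\,d\mathfrak m\right)^{1/p}\le C_P\,r\left(⨍_{B_{\lambda r}}g^p\,d\mathfrak m\right)^{1/p}$. The doubling dimension is $Q:=\log_2 C_D$, where $C_D$ is the lowest constant for which (i) holds. The notation $C=C(a_1,\dots,a_k)$ means that $C$ depends only on the parameters $a_1,\dots,a_k$.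
   Formalization: The constant C may depend on the Poincaré constants C_P and λ besides Q, C_o, η, s; with C=C(Q,C_o,η,s) alone the claim is false (R³ with a thin spherical wall and a small hole). Spaces are carried by subsets of one type; the reals suffice up to isometry. *)

theory Defs
  imports "HOL-Analysis.Analysis"
begin

text \<open>Powers of extended non-negative reals; only used with a positive exponent.\<close>

definition enn_powr :: "ennreal \<Rightarrow> real \<Rightarrow> ennreal" where
  "enn_powr x a = (if x = \<infinity> then \<infinity> else ennreal (enn2real x powr a))"

text \<open>
  Spaces are explicit carriers \<open>X\<close>, not type-class instances, so that a statement can quantify over
  all of them (for instance to say that a constant does not depend on the space). Every separable
  metric space has at most the cardinality of the continuum, hence is isometric to one carried by a
  subset of \<^typ>\<open>real\<close>; a fixed carrier type therefore loses no spaces.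

  The \<open>\<sigma>\<close>-algebra of \<open>m\<close> may be larger than the Borel one (for example its completion, i.e. the
  sets measurable for a Borel regular outer measure).
\<close>

locale metric_measure_space = Metric_space X d
  for X :: "'a set" and d :: "'a \<Rightarrow> 'a \<Rightarrow> real" +
  fixes m :: "'a measure"
  assumes separable: "separable_space mtopology"
    and space_m: "space m = X"
    and borel_sets: "\<And>U. openin mtopology U \<Longrightarrow> U \<in> sets m"
    and borel_regular: "\<And>A. A \<in> sets m \<Longrightarrow>
      \<exists>B \<in> sigma_sets X {U. openin mtopology U}. A \<subseteq> B \<and> emeasure m B = emeasure m A"
    and ball_pos: "\<And>x r. x \<in> X \<Longrightarrow> 0 < r \<Longrightarrow> 0 < emeasure m (mball x r)"
    and ball_finite: "\<And>x r. x \<in> X \<Longrightarrow> 0 < r \<Longrightarrow> emeasure m (mball x r) < \<infinity>"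
begin

definition borel_X :: "'a measure" where
  "borel_X = sigma X {U. openin mtopology U}"

definition curve_length :: "(real \<Rightarrow> 'a) \<Rightarrow> real \<Rightarrow> real \<Rightarrow> ennreal" where
  "curve_length \<gamma> a b =
     (SUP (n, t) \<in> {(n, t :: nat \<Rightarrow> real). mono_on {..n} t \<and> t ` {..n} \<subseteq> {a..b}}.
        \<Sum>i<n. ennreal (d (\<gamma> (t i)) (\<gamma> (t (Suc i)))))"

text \<open>This forces \<open>\<gamma>\<close> to be 1-Lipschitz, hence continuous, and rectifiable on \<open>[0,L]\<close>.\<close>

definition arc_length_curve :: "(real \<Rightarrow> 'a) \<Rightarrow> real \<Rightarrow> bool" where
  "arc_length_curve \<gamma> L \<longleftrightarrow> 0 \<le> L \<and> \<gamma> ` {0..L} \<subseteq> X \<and>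
     (\<forall>a b. 0 \<le> a \<and> a \<le> b \<and> b \<le> L \<longrightarrow> curve_length \<gamma> a b = ennreal (b - a))"

text \<open>In \<^typ>\<open>ereal\<close>, \<open>\<infinity> - \<infinity>\<close> and \<open>(-\<infinity>) - (-\<infinity>)\<close> both equal \<open>\<infinity>\<close>, which is the usual convention
  for the left-hand side when both endpoint values are infinite.\<close>

definition upper_gradient :: "('a \<Rightarrow> ereal) \<Rightarrow> ('a \<Rightarrow> ennreal) \<Rightarrow> bool" where
  "upper_gradient f g \<longleftrightarrow> g \<in> borel_measurable borel_X \<and>
     (\<forall>\<gamma> L. arc_length_curve \<gamma> L \<longrightarrow>
        e2ennreal \<bar>f (\<gamma> L) - f (\<gamma> 0)\<bar> \<le> (\<integral>\<^sup>+ \<tau> \<in> {0..L}. g (\<gamma> \<tau>) \<partial>lborel))"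

definition UG :: "real \<Rightarrow> ('a \<Rightarrow> ereal) \<Rightarrow> ('a \<Rightarrow> ennreal) set" where
  "UG p f = {g. upper_gradient f g \<and> (\<integral>\<^sup>+ x. enn_powr (g x) p \<partial>m) < \<infinity>}"

definition Lnorm :: "real \<Rightarrow> ('a \<Rightarrow> ennreal) \<Rightarrow> ennreal" where
  "Lnorm s h = enn_powr (\<integral>\<^sup>+ x. enn_powr (h x) s \<partial>m) (1 / s)"

text \<open>Elements of the Lebesgue spaces are treated as functions, not classes; the Cheeger energy below
  is invariant under changing \<open>f\<close> on a null set, since only its distance to the \<open>fs i\<close> enters.\<close>

definition Lspace :: "real \<Rightarrow> ('a \<Rightarrow> real) set" where
  "Lspace s = {f \<in> borel_measurable m. Lnorm s (\<lambda>x. ennreal \<bar>f x\<bar>) < \<infinity>}"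

definition cheeger :: "real \<Rightarrow> ('a \<Rightarrow> real) \<Rightarrow> ennreal" where
  "cheeger s f = Inf {liminf (\<lambda>i. enn_powr (Lnorm s (gs i)) s) | fs gs.
     (\<forall>i. fs i \<in> Lspace s \<and> upper_gradient (\<lambda>x. ereal (fs i x)) (gs i)) \<and>
     (\<lambda>i. Lnorm s (\<lambda>x. ennreal \<bar>fs i x - f x\<bar>)) \<longlonglongrightarrow> 0}"

definition H1 :: "real \<Rightarrow> ('a \<Rightarrow> real) set" where
  "H1 s = {f \<in> Lspace s. cheeger s f < \<infinity>}"

text \<open>In a complete doubling space closed balls are compact, so this agrees with integrability near
  every point.\<close>

definition L1_loc :: "('a \<Rightarrow> real) set" where
  "L1_loc = {f \<in> borel_measurable m. \<forall>x\<in>X. \<forall>r>0. set_integrable m (mball x r) f}"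

definition mean :: "'a set \<Rightarrow> ('a \<Rightarrow> real) \<Rightarrow> real" where
  "mean A f = (LINT x:A|m. f x) / measure m A"

definition nn_mean :: "'a set \<Rightarrow> ('a \<Rightarrow> ennreal) \<Rightarrow> ennreal" where
  "nn_mean A h = (\<integral>\<^sup>+ x \<in> A. h x \<partial>m) / emeasure m A"

definition doubling_with :: "real \<Rightarrow> bool" where
  "doubling_with C \<longleftrightarrow> 1 \<le> C \<and>
     (\<forall>x\<in>X. \<forall>r>0. measure m (mball x (2 * r)) \<le> C * measure m (mball x r))"

text \<open>If some doubling constant exists, the infimum below is attained.\<close>

definition doubling_dim :: real where
  "doubling_dim = log 2 (Inf {C. doubling_with C})"

definition poincare :: "real \<Rightarrow> real \<Rightarrow> real \<Rightarrow> bool" where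
  "poincare p C_P lam \<longleftrightarrow>
     (\<forall>f \<in> L1_loc. \<forall>g \<in> UG p (\<lambda>x. ereal (f x)). \<forall>x\<in>X. \<forall>r>0.
        enn_powr (nn_mean (mball x r) (\<lambda>y. ennreal (\<bar>f y - mean (mball x r) f\<bar> powr p))) (1 / p)
        \<le> ennreal (C_P * r) * enn_powr (nn_mean (mball x (lam * r)) (\<lambda>y. enn_powr (g y) p)) (1 / p))"

definition PI_space :: "real \<Rightarrow> real \<Rightarrow> real \<Rightarrow> bool" where
  "PI_space p C_P lam \<longleftrightarrow> 1 \<le> p \<and> 0 < C_P \<and> 1 \<le> lam \<and>
     (\<exists>C. doubling_with C) \<and> poincare p C_P lam"

end

end

theory Submission
  imports Defs
begin

text \<open>
  Write \<open>r\<close> for the distance to the point \<open>z\<close> and \<open>B_R\<close> for the ball of radius \<open>R\<close> around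
  \<open>z\<close>. The proof rests on the \<open>(p, p)\<close>-Poincare inequality, doubling, and the fact that volumes
  of balls around \<open>z\<close> grow at least with exponent \<open>\<eta> > s \<ge> p\<close>.

  Comparing the mean values of a function on successive balls \<open>B_R\<close> is not enough: the energy near
  \<open>z\<close> enters at every scale, and when \<open>p = s\<close> the sum over the scales diverges logarithmically.
  The energy has to be localized to annuli. This is \<open>annular_gap\<close>: if \<open>u \<ge> \<beta>\<close> and
  \<open>u \<le> \<alpha>\<close> both hold on a fixed proportion of \<open>B_R\<close>, then \<open>(\<beta> - \<alpha>) powr p\<close> times the volume
  of \<open>B_R\<close> is controlled by \<open>R powr p\<close> times the energy of \<open>u\<close> on
  \<open>\<sigma> * R < r < lam * R\<close>. To see this, truncate \<open>u\<close> at the levels \<open>\<alpha>\<close> and \<open>\<beta>\<close> and cut it off on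
  the small ball of radius \<open>\<sigma> * R\<close>. Since \<open>\<eta> > p\<close>, that ball is so small that the cut-off costs
  only a small part of what the Poincare inequality on \<open>B_R\<close> demands.

  For a dyadic shell of radius \<open>r\<close>, the Poincare inequality on small balls in the shell, and
  \<open>annular_gap\<close> on the much larger ball of radius \<open>T * r\<close>, give \<open>single_scale\<close>: the integral of
  \<open>u powr p\<close> over the shell is at most \<open>r powr p\<close> times the energy on an annulus plus
  \<open>T powr - \<eta>\<close> times the integral of \<open>u powr p\<close> over the large ball, up to constants of which the
  second does not depend on \<open>T\<close>. Multiplying by \<open>r powr - s\<close> and summing over all dyadic scales, the
  annuli overlap boundedly, and the second term adds up to at most \<open>T powr (s - \<eta>)\<close> times the
  integral of \<open>u powr p * r powr - s\<close>. It is absorbed for large \<open>T\<close>, which gives a weighted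
  inequality for the exponent \<open>p\<close>, \<open>weighted_hardy\<close>.

  The exponent \<open>s\<close> is reached by applying this to \<open>F powr (s / p)\<close> for bounded \<open>F\<close>, with the chain
  rule for upper gradients and Young's inequality (\<open>hardy_bounded\<close>). In this way the constants stay
  bounded as \<open>p\<close> varies in \<open>[1, s]\<close>, also when \<open>p\<close> approaches \<open>s\<close>, where arguments via maximal
  functions would break down. Truncation removes the boundedness, and the inequality is
  stable under the relaxation in the definition of the Cheeger energy (\<open>hardy_relaxed\<close>).
\<close>


section \<open>Powers of extended non-negative reals\<close>

lemma enn_powr_ennreal [simp]: "0 \<le> x \<Longrightarrow> enn_powr (ennreal x) a = ennreal (x powr a)"
  by (simp add: enn_powr_def)

lemma enn_powr_top [simp]: "enn_powr top a = top"
  by (simp add: enn_powr_def)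

lemma enn_powr_0 [simp]: "enn_powr 0 a = 0"
  by (simp add: enn_powr_def)

lemma enn_powr_1 [simp]: "enn_powr 1 a = 1"
  by (simp add: enn_powr_def)

lemma enn_powr_mono: "x \<le> y \<Longrightarrow> 0 \<le> a \<Longrightarrow> enn_powr x a \<le> enn_powr y a"
  by (cases x; cases y) (auto intro!: ennreal_leI powr_mono2 simp: top_unique)

lemma enn_powr_inverse: "0 < a \<Longrightarrow> enn_powr (enn_powr x (1 / a)) a = x"
  by (cases x) (auto simp: powr_powr)

lemma enn_powr_mult:
  "0 \<le> c \<Longrightarrow> enn_powr (ennreal c * x) a = ennreal (c powr a) * enn_powr x a"
  by (cases "c = 0"; cases x)
    (auto simp: ennreal_mult_top ennreal_mult[symmetric] powr_mult simp del: ennreal_0)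

lemma powr_add_le_real:
  assumes "0 \<le> (x::real)" "0 \<le> y" "0 \<le> a"
  shows "(x + y) powr a \<le> 2 powr a * (x powr a + y powr a)"
proof -
  have "(x + y) powr a \<le> (2 * max x y) powr a"
    using assms by (intro powr_mono2) auto
  also have "\<dots> = 2 powr a * (max x y) powr a" using assms by (simp add: powr_mult)
  also have "\<dots> \<le> 2 powr a * (x powr a + y powr a)"
    by (intro mult_left_mono) (auto simp: max_def)
  finally show ?thesis .
qed

lemma enn_powr_add_le:
  assumes "0 \<le> a"
  shows "enn_powr (x + y) a \<le> ennreal (2 powr a) * (enn_powr x a + enn_powr y a)"
proof (cases "x = top \<or> y = top")
  case True
  then show ?thesis by (auto simp: ennreal_mult_top)
next
  case False
  then show ?thesis using powr_add_le_real[OF _ _ assms]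
    by (cases x; cases y) (auto simp flip: ennreal_plus ennreal_mult)
qed

lemma enn_powr_measurable [measurable]: "(\<lambda>x. enn_powr x a) \<in> borel_measurable borel"
  unfolding enn_powr_def infinity_ennreal_def by measurable

section \<open>Borel sets and balls\<close>

context metric_measure_space
begin

lemma openin_subset_Pow: "{U. openin mtopology U} \<subseteq> Pow X"
  using openin_subset[of mtopology] by auto

lemma space_borel_X [simp]: "space borel_X = X"
  using openin_subset_Pow by (simp add: borel_X_def space_measure_of)

lemma sets_borel_X: "sets borel_X = sigma_sets X {U. openin mtopology U}"
  unfolding borel_X_def using openin_subset_Pow by (simp add: sets_measure_of)

lemma sets_borel_X_subset: "sets borel_X \<subseteq> sets m"
proof -
  have "sigma_sets (space m) {U. openin mtopology U} \<subseteq> sets m"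
    by (rule sets.sigma_sets_subset) (use borel_sets in auto)
  then show ?thesis by (simp add: sets_borel_X space_m)
qed

lemma measurable_borel_X_imp: "g \<in> measurable borel_X N \<Longrightarrow> g \<in> measurable m N"
  using sets_borel_X_subset by (auto simp: measurable_def space_m)

lemma openin_sets_borel_X: "openin mtopology U \<Longrightarrow> U \<in> sets borel_X"
  by (simp add: sets_borel_X)

lemma closedin_sets_borel_X: "closedin mtopology Z \<Longrightarrow> Z \<in> sets borel_X"
  by (metis closedin_def openin_sets_borel_X sets.compl_sets space_borel_X topspace_mtopology
      double_diff order_refl)

lemma borel_measurable_borel_X_if_less:
  fixes f :: "'a \<Rightarrow> real"
  assumes "\<And>c. openin mtopology {x \<in> X. f x < c}"
  shows "f \<in> borel_measurable borel_X"
  by (subst borel_measurable_iff_less) (use assms openin_sets_borel_X in auto)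

lemma dist_measurable_borel_X:
  assumes "z \<in> X" shows "d z \<in> borel_measurable borel_X"
proof (rule borel_measurable_borel_X_if_less)
  fix c
  have "{x \<in> X. d z x < c} = mball z c" using assms by (auto simp: in_mball)
  then show "openin mtopology {x \<in> X. d z x < c}" by simp
qed

lemma dist_measurable [measurable]:
  assumes "z \<in> X" shows "d z \<in> borel_measurable m"
  by (intro measurable_borel_X_imp dist_measurable_borel_X assms)

lemma mball_sets [measurable, simp]: "mball x r \<in> sets m"
  by (intro borel_sets) auto

lemma emeasure_mball: "emeasure m (mball x r) = ennreal (measure m (mball x r))"
proof (cases "x \<in> X \<and> 0 < r")
  case True
  then show ?thesis using ball_finite[of x r] by (intro emeasure_eq_ennreal_measure) auto
next
  case False
  then have "mball x r = {}" by (auto simp: in_mball) (smt (verit) nonneg)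
  then show ?thesis by simp
qed

lemma measure_mball_pos: "x \<in> X \<Longrightarrow> 0 < r \<Longrightarrow> 0 < measure m (mball x r)"
  using ball_pos[of x r] by (simp add: emeasure_mball)

lemma fmeasurable_subset_mball: "A \<in> sets m \<Longrightarrow> A \<subseteq> mball x r \<Longrightarrow> A \<in> fmeasurable m"
  by (rule fmeasurableI2[of "mball x r"]) (simp_all add: fmeasurable_def emeasure_mball)

lemma measure_mono_mball: "A \<in> sets m \<Longrightarrow> A \<subseteq> mball x r \<Longrightarrow> measure m A \<le> measure m (mball x r)"
  by (intro measure_mono_fmeasurable) (auto simp: fmeasurable_def emeasure_mball)

section \<open>Curves\<close>

lemma dist_le_curve_length:
  assumes "a \<le> b"
  shows "ennreal (d (\<gamma> a) (\<gamma> b)) \<le> curve_length \<gamma> a b"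
proof -
  let ?t = "\<lambda>i::nat. if i = 0 then a else b"
  have "mono_on {..1} ?t" "?t ` {..1} \<subseteq> {a..b}" using assms by (auto intro!: mono_onI)
  then show ?thesis unfolding curve_length_def
    by (intro SUP_upper2[of "(1, ?t)"]) auto
qed

lemma arc_length_curve_lipschitz:
  assumes "arc_length_curve \<gamma> L" "0 \<le> a" "a \<le> b" "b \<le> L"
  shows "d (\<gamma> a) (\<gamma> b) \<le> b - a"
proof -
  have "ennreal (d (\<gamma> a) (\<gamma> b)) \<le> ennreal (b - a)"
    using dist_le_curve_length[of a b \<gamma>] assms by (simp add: arc_length_curve_def)
  then show ?thesis using assms by simp
qed

lemma arc_length_curve_lipschitz_abs:
  assumes "arc_length_curve \<gamma> L" "a \<in> {0..L}" "b \<in> {0..L}"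
  shows "d (\<gamma> a) (\<gamma> b) \<le> \<bar>b - a\<bar>"
  using arc_length_curve_lipschitz[OF assms(1), of a b] arc_length_curve_lipschitz[OF assms(1), of b a]
    assms(2,3) commute[of "\<gamma> a" "\<gamma> b"] by (cases "a \<le> b") auto

lemma arc_length_curve_in: "arc_length_curve \<gamma> L \<Longrightarrow> t \<in> {0..L} \<Longrightarrow> \<gamma> t \<in> X"
  by (auto simp: arc_length_curve_def)

lemma curve_length_shift:
  "curve_length (\<lambda>t. \<gamma> (c + t)) a b = curve_length \<gamma> (c + a) (c + b)" for c :: real
proof (rule antisym)
  show "curve_length (\<lambda>t. \<gamma> (c + t)) a b \<le> curve_length \<gamma> (c + a) (c + b)"
    unfolding curve_length_def
  proof (rule SUP_least, clarify)
    fix n :: nat and t :: "nat \<Rightarrow> real"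
    assume t: "mono_on {..n} t" "t ` {..n} \<subseteq> {a..b}"
    have "mono_on {..n} (\<lambda>i. c + t i)" "(\<lambda>i. c + t i) ` {..n} \<subseteq> {c + a..c + b}"
      using t by (auto simp: mono_on_def)
    then show "(\<Sum>i<n. ennreal (d (\<gamma> (c + t i)) (\<gamma> (c + t (Suc i)))))
      \<le> (SUP (n, t) \<in> {(n, t :: nat \<Rightarrow> real). mono_on {..n} t \<and> t ` {..n} \<subseteq> {c + a..c + b}}.
        \<Sum>i<n. ennreal (d (\<gamma> (t i)) (\<gamma> (t (Suc i)))))"
      by (intro SUP_upper2[of "(n, \<lambda>i. c + t i)"]) auto
  qed
  show "curve_length \<gamma> (c + a) (c + b) \<le> curve_length (\<lambda>t. \<gamma> (c + t)) a b"
    unfolding curve_length_def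
  proof (rule SUP_least, clarify)
    fix n :: nat and t :: "nat \<Rightarrow> real"
    assume t: "mono_on {..n} t" "t ` {..n} \<subseteq> {c + a..c + b}"
    have "mono_on {..n} (\<lambda>i. t i - c)" "(\<lambda>i. t i - c) ` {..n} \<subseteq> {a..b}"
      using t by (force simp: mono_on_def)+
    then show "(\<Sum>i<n. ennreal (d (\<gamma> (t i)) (\<gamma> (t (Suc i)))))
      \<le> (SUP (n, t) \<in> {(n, t :: nat \<Rightarrow> real). mono_on {..n} t \<and> t ` {..n} \<subseteq> {a..b}}.
        \<Sum>i<n. ennreal (d (\<gamma> (c + t i)) (\<gamma> (c + t (Suc i)))))"
      by (intro SUP_upper2[of "(n, \<lambda>i. t i - c)"]) auto
  qed
qed

lemma arc_length_subcurve:
  assumes "arc_length_curve \<gamma> L" "0 \<le> a" "a \<le> b" "b \<le> L"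
  shows "arc_length_curve (\<lambda>t. \<gamma> (a + t)) (b - a)"
  using assms unfolding arc_length_curve_def curve_length_shift by auto

text \<open>
  Curves parametrized by arc length are 1-Lipschitz; this gives first and last hitting times of
  closed sets and the measurability of upper gradients along curves.
\<close>

lemma curve_preimage_closed:
  assumes \<gamma>: "arc_length_curve \<gamma> L" and Z: "closedin mtopology Z"
  shows "closed {t \<in> {0..L}. \<gamma> t \<in> Z}"
proof (rule closed_sequential_limits[THEN iffD2], intro allI impI, elim conjE)
  fix x l assume x: "\<forall>n. x n \<in> {t \<in> {0..L}. \<gamma> t \<in> Z}" and lim: "x \<longlonglongrightarrow> l"
  have l: "l \<in> {0..L}" using closed_sequentially[OF closed_atLeastAtMost _ lim] x by auto
  have "limitin mtopology (\<lambda>n. \<gamma> (x n)) (\<gamma> l) sequentially"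
    unfolding limitin_metric
  proof (intro conjI allI impI)
    show "\<gamma> l \<in> X" using arc_length_curve_in[OF \<gamma> l] .
    fix e :: real assume "0 < e"
    then have "eventually (\<lambda>n. dist (x n) l < e) sequentially" using lim by (auto dest: tendstoD)
    then show "\<forall>\<^sub>F n in sequentially. \<gamma> (x n) \<in> X \<and> d (\<gamma> (x n)) (\<gamma> l) < e"
    proof eventually_elim
      case (elim n)
      have "x n \<in> {0..L}" using x by auto
      then show ?case using arc_length_curve_lipschitz_abs[OF \<gamma> _ l, of "x n"] elim
        arc_length_curve_in[OF \<gamma>] by (auto simp: dist_real_def)
    qed
  qed
  moreover have "\<gamma> (x n) \<in> Z" for n using x by auto
  ultimately have "\<gamma> l \<in> Z"
    using limitin_closedin[OF _ Z, of "\<lambda>n. \<gamma> (x n)" "\<gamma> l" sequentially] by auto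
  with l show "l \<in> {t \<in> {0..L}. \<gamma> t \<in> Z}" by auto
qed

lemma curve_measurable:
  assumes \<gamma>: "arc_length_curve \<gamma> L"
  shows "\<gamma> \<in> measurable (restrict_space lborel {0..L}) borel_X"
  unfolding borel_X_def
proof (rule measurable_measure_of[OF openin_subset_Pow])
  show "\<gamma> \<in> space (restrict_space lborel {0..L}) \<rightarrow> X"
    using arc_length_curve_in[OF \<gamma>] by (auto simp: space_restrict_space)
  fix U assume "U \<in> {U. openin mtopology U}"
  then have U: "closedin mtopology (X - U)" by (metis mem_Collect_eq openin_closedin_eq topspace_mtopology)
  have "\<gamma> -` U \<inter> {0..L} = {0..L} - {t \<in> {0..L}. \<gamma> t \<in> X - U}"
    using arc_length_curve_in[OF \<gamma>] by auto
  also have "\<dots> \<in> sets borel" using curve_preimage_closed[OF \<gamma> U] by auto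
  finally show "\<gamma> -` U \<inter> space (restrict_space lborel {0..L}) \<in> sets (restrict_space lborel {0..L})"
    by (subst sets_restrict_space_iff) (auto simp: space_restrict_space)
qed

lemma comp_curve_measurable:
  assumes "arc_length_curve \<gamma> L" "g \<in> borel_measurable borel_X"
  shows "(\<lambda>t. g (\<gamma> t) * indicator {0..L} t :: ennreal) \<in> borel_measurable lborel"
  using measurable_compose[OF curve_measurable[OF assms(1)] assms(2)]
  by (subst borel_measurable_restrict_space_iff_ennreal[symmetric]) auto

lemma comp_curve_measurable_sub:
  assumes "arc_length_curve \<gamma> L" "g \<in> borel_measurable borel_X" "{a..b} \<subseteq> {0..L}"
  shows "(\<lambda>t. g (\<gamma> t) * indicator {a..b} t :: ennreal) \<in> borel_measurable lborel"
proof -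
  have "(\<lambda>t. (g (\<gamma> t) * indicator {0..L} t) * indicator {a..b} t) \<in> borel_measurable lborel"
    using comp_curve_measurable[OF assms(1,2)] by measurable
  moreover have "(\<lambda>t. (g (\<gamma> t) * indicator {0..L} t) * indicator {a..b} t)
      = (\<lambda>t. g (\<gamma> t) * indicator {a..b} t)"
    using assms(3) by (auto simp: indicator_def fun_eq_iff)
  ultimately show ?thesis by simp
qed

section \<open>Upper gradients\<close>

lemma upper_gradient_real:
  "upper_gradient (\<lambda>x. ereal (u x)) g \<longleftrightarrow> g \<in> borel_measurable borel_X \<and>
     (\<forall>\<gamma> L. arc_length_curve \<gamma> L \<longrightarrow>
        ennreal \<bar>u (\<gamma> L) - u (\<gamma> 0)\<bar> \<le> (\<integral>\<^sup>+ \<tau> \<in> {0..L}. g (\<gamma> \<tau>) \<partial>lborel))"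
  by (simp add: upper_gradient_def)

text \<open>
  Restricting and shifting the parameter of a curve keeps it parametrized by arc length, so the
  defining inequality of an upper gradient is available between any two parameters.
\<close>

lemma upper_gradient_sub:
  assumes u: "upper_gradient (\<lambda>x. ereal (u x)) g" and \<gamma>: "arc_length_curve \<gamma> L"
    and ab: "0 \<le> a" "a \<le> b" "b \<le> L"
  shows "ennreal \<bar>u (\<gamma> b) - u (\<gamma> a)\<bar> \<le> (\<integral>\<^sup>+ \<tau> \<in> {a..b}. g (\<gamma> \<tau>) \<partial>lborel)"
proof -
  have meas: "(\<lambda>t. g (\<gamma> t) * indicator {a..b} t) \<in> borel_measurable lborel"
    using u ab by (intro comp_curve_measurable_sub[OF \<gamma>]) (auto simp: upper_gradient_real)
  have "ennreal \<bar>u (\<gamma> b) - u (\<gamma> a)\<bar> \<le> (\<integral>\<^sup>+ \<tau> \<in> {0..b - a}. g (\<gamma> (a + \<tau>)) \<partial>lborel)"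
    using u arc_length_subcurve[OF \<gamma> ab] unfolding upper_gradient_real by fastforce
  also have "\<dots> = (\<integral>\<^sup>+ \<tau>. g (\<gamma> (a + 1 * \<tau>)) * indicator {a..b} (a + 1 * \<tau>) \<partial>lborel)"
    by (intro nn_integral_cong) (auto simp: indicator_def)
  also have "\<dots> = (\<integral>\<^sup>+ \<tau> \<in> {a..b}. g (\<gamma> \<tau>) \<partial>lborel)"
    using nn_integral_real_affine[of "\<lambda>t. g (\<gamma> t) * indicator {a..b} t" 1 a] meas by simp
  finally show ?thesis .
qed

end

lemma powr_diff_le:
  fixes x y a :: real
  assumes "0 \<le> x" "x \<le> y" "1 \<le> a"
  shows "y powr a - x powr a \<le> a * y powr (a - 1) * (y - x)"
proof (cases "x = 0 \<or> x = y")
  case True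
  show ?thesis
  proof (cases "x = y")
    case False
    with True assms have "x = 0" "0 < y" by auto
    then have "y powr (a - 1) * y = y powr a" by (simp add: powr_diff)
    moreover have "1 * y powr a \<le> a * y powr a" using assms by (intro mult_right_mono) auto
    ultimately show ?thesis using \<open>x = 0\<close> by (simp add: mult.assoc)
  qed simp
next
  case False
  with assms have "0 < x" "x < y" by auto
  moreover have "((\<lambda>t. t powr a) has_real_derivative a * t powr (a - 1)) (at t)" if "x \<le> t" for t
    using that \<open>0 < x\<close> by (intro has_real_derivative_powr) auto
  ultimately obtain \<xi> where \<xi>: "x < \<xi>" "\<xi> < y" "y powr a - x powr a = (y - x) * (a * \<xi> powr (a - 1))"
    using MVT2[of x y "\<lambda>t. t powr a" "\<lambda>t. a * t powr (a - 1)"] by auto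
  have "\<xi> powr (a - 1) \<le> y powr (a - 1)" using \<xi> \<open>0 < x\<close> assms by (intro powr_mono2) auto
  then have "(y - x) * (a * \<xi> powr (a - 1)) \<le> (y - x) * (a * y powr (a - 1))"
    using \<open>x < y\<close> assms by (intro mult_left_mono) auto
  then show ?thesis using \<xi>(3) by (simp add: algebra_simps)
qed

lemma abs_powr_diff_le:
  fixes x y a M :: real
  assumes "0 \<le> x" "0 \<le> y" "x \<le> M" "y \<le> M" "1 \<le> a"
  shows "\<bar>y powr a - x powr a\<bar> \<le> a * M powr (a - 1) * \<bar>y - x\<bar>"
proof -
  have *: "\<bar>y powr a - x powr a\<bar> \<le> a * M powr (a - 1) * \<bar>y - x\<bar>"
    if "0 \<le> x" "x \<le> y" "y \<le> M" for x y
  proof -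
    have "x powr a \<le> y powr a" using that assms by (intro powr_mono2) auto
    moreover have "a * y powr (a - 1) * (y - x) \<le> a * M powr (a - 1) * (y - x)"
      using that assms by (intro mult_right_mono mult_left_mono powr_mono2) auto
    ultimately show ?thesis using powr_diff_le[OF that(1,2) assms(5)] that by auto
  qed
  show ?thesis using *[of x y] *[of y x] assms by (cases "x \<le> y") (auto simp: abs_minus_commute)
qed

context metric_measure_space
begin

lemma upper_gradient_measurable:
  "upper_gradient (\<lambda>x. ereal (u x)) g \<Longrightarrow> g \<in> borel_measurable borel_X"
  by (simp add: upper_gradient_real)

lemma upper_gradientD:
  "upper_gradient (\<lambda>x. ereal (u x)) g \<Longrightarrow> arc_length_curve \<gamma> L \<Longrightarrow>
     ennreal \<bar>u (\<gamma> L) - u (\<gamma> 0)\<bar> \<le> (\<integral>\<^sup>+ \<tau> \<in> {0..L}. g (\<gamma> \<tau>) \<partial>lborel)"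
  by (simp add: upper_gradient_real)

lemma curve_endpoints: "arc_length_curve \<gamma> L \<Longrightarrow> 0 \<le> L \<and> \<gamma> 0 \<in> X \<and> \<gamma> L \<in> X"
  by (auto simp: arc_length_curve_def)

lemma upper_gradient_comp_lipschitz:
  assumes "upper_gradient (\<lambda>x. ereal (u x)) g" "0 \<le> c"
    "\<And>x y. x \<in> X \<Longrightarrow> y \<in> X \<Longrightarrow> \<bar>v x - v y\<bar> \<le> c * \<bar>u x - u y\<bar>"
  shows "upper_gradient (\<lambda>x. ereal (v x)) (\<lambda>x. ennreal c * g x)"
  unfolding upper_gradient_real
proof (intro conjI allI impI)
  have g[measurable]: "g \<in> borel_measurable borel_X" using upper_gradient_measurable[OF assms(1)] .
  show "(\<lambda>x. ennreal c * g x) \<in> borel_measurable borel_X" by measurable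
  fix \<gamma> L assume \<gamma>: "arc_length_curve \<gamma> L"
  have "ennreal \<bar>v (\<gamma> L) - v (\<gamma> 0)\<bar> \<le> ennreal (c * \<bar>u (\<gamma> L) - u (\<gamma> 0)\<bar>)"
    using curve_endpoints[OF \<gamma>] assms(3) by (intro ennreal_leI) auto
  also have "\<dots> = ennreal c * ennreal \<bar>u (\<gamma> L) - u (\<gamma> 0)\<bar>" using assms(2) by (simp add: ennreal_mult)
  also have "\<dots> \<le> ennreal c * (\<integral>\<^sup>+ \<tau> \<in> {0..L}. g (\<gamma> \<tau>) \<partial>lborel)"
    by (intro mult_left_mono upper_gradientD[OF assms(1) \<gamma>]) auto
  also have "\<dots> = (\<integral>\<^sup>+ \<tau> \<in> {0..L}. ennreal c * g (\<gamma> \<tau>) \<partial>lborel)"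
    using comp_curve_measurable[OF \<gamma> g] by (simp add: nn_integral_cmult[symmetric] mult.assoc)
  finally show "ennreal \<bar>v (\<gamma> L) - v (\<gamma> 0)\<bar> \<le> (\<integral>\<^sup>+ \<tau> \<in> {0..L}. ennreal c * g (\<gamma> \<tau>) \<partial>lborel)" .
qed

lemma upper_gradient_lipschitz:
  assumes "0 \<le> l" "\<And>x y. x \<in> X \<Longrightarrow> y \<in> X \<Longrightarrow> \<bar>u x - u y\<bar> \<le> l * d x y"
  shows "upper_gradient (\<lambda>x. ereal (u x)) (\<lambda>_. ennreal l)"
  unfolding upper_gradient_real
proof (intro conjI allI impI)
  fix \<gamma> L assume \<gamma>: "arc_length_curve \<gamma> L"
  then have L: "0 \<le> L" using curve_endpoints by auto
  have "\<bar>u (\<gamma> L) - u (\<gamma> 0)\<bar> \<le> l * d (\<gamma> L) (\<gamma> 0)" using assms(2) curve_endpoints[OF \<gamma>] by auto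
  also have "\<dots> \<le> l * L"
    using arc_length_curve_lipschitz[OF \<gamma>, of 0 L] L assms(1)
    by (intro mult_left_mono) (auto simp: commute)
  finally have "ennreal \<bar>u (\<gamma> L) - u (\<gamma> 0)\<bar> \<le> ennreal (l * L)" by (rule ennreal_leI)
  then show "ennreal \<bar>u (\<gamma> L) - u (\<gamma> 0)\<bar> \<le> (\<integral>\<^sup>+ \<tau> \<in> {0..L}. ennreal l \<partial>lborel)"
    using L assms(1) by (simp add: nn_integral_cmult ennreal_mult)
qed simp

lemma upper_gradient_min:
  assumes "upper_gradient (\<lambda>x. ereal (u x)) g" "upper_gradient (\<lambda>x. ereal (v x)) h"
  shows "upper_gradient (\<lambda>x. ereal (min (u x) (v x))) (\<lambda>x. g x + h x)"
  unfolding upper_gradient_real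
proof (intro conjI allI impI)
  have g[measurable]: "g \<in> borel_measurable borel_X" and h[measurable]: "h \<in> borel_measurable borel_X"
    using assms upper_gradient_measurable by auto
  show "(\<lambda>x. g x + h x) \<in> borel_measurable borel_X" by measurable
  fix \<gamma> L assume \<gamma>: "arc_length_curve \<gamma> L"
  have "ennreal \<bar>min (u (\<gamma> L)) (v (\<gamma> L)) - min (u (\<gamma> 0)) (v (\<gamma> 0))\<bar>
      \<le> ennreal (\<bar>u (\<gamma> L) - u (\<gamma> 0)\<bar> + \<bar>v (\<gamma> L) - v (\<gamma> 0)\<bar>)"
    by (intro ennreal_leI) (auto simp: min_def)
  also have "\<dots> = ennreal \<bar>u (\<gamma> L) - u (\<gamma> 0)\<bar> + ennreal \<bar>v (\<gamma> L) - v (\<gamma> 0)\<bar>" by simp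
  also have "\<dots> \<le> (\<integral>\<^sup>+ \<tau> \<in> {0..L}. g (\<gamma> \<tau>) \<partial>lborel) + (\<integral>\<^sup>+ \<tau> \<in> {0..L}. h (\<gamma> \<tau>) \<partial>lborel)"
    by (intro add_mono upper_gradientD[OF assms(1) \<gamma>] upper_gradientD[OF assms(2) \<gamma>])
  also have "\<dots> = (\<integral>\<^sup>+ \<tau> \<in> {0..L}. (g (\<gamma> \<tau>) + h (\<gamma> \<tau>)) \<partial>lborel)"
    using comp_curve_measurable[OF \<gamma> g] comp_curve_measurable[OF \<gamma> h]
    by (simp add: nn_integral_add[symmetric] distrib_right)
  finally show "ennreal \<bar>min (u (\<gamma> L)) (v (\<gamma> L)) - min (u (\<gamma> 0)) (v (\<gamma> 0))\<bar>
      \<le> (\<integral>\<^sup>+ \<tau> \<in> {0..L}. (g (\<gamma> \<tau>) + h (\<gamma> \<tau>)) \<partial>lborel)" .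
qed

text \<open>
  An upper gradient can be replaced by \<open>0\<close> on a closed set where the function is constant. A
  curve that meets the set is only charged for the parts before its first and after its last visit,
  because both visits see the same value of the function. This is what turns cut-offs into energy
  estimates on annuli: the gradient of a cut-off function lives only where it is neither \<open>0\<close>
  nor \<open>1\<close>.
\<close>

lemma upper_gradient_localize:
  assumes u: "upper_gradient (\<lambda>x. ereal (u x)) h" and Z: "closedin mtopology Z"
    and c: "\<And>x. x \<in> Z \<Longrightarrow> u x = c"
  shows "upper_gradient (\<lambda>x. ereal (u x)) (\<lambda>x. h x * indicator (X - Z) x)"
  unfolding upper_gradient_real
proof (intro conjI allI impI)
  let ?k = "\<lambda>x. h x * indicator (X - Z) x"
  have h[measurable]: "h \<in> borel_measurable borel_X" using upper_gradient_measurable[OF u] .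
  have [measurable]: "Z \<in> sets borel_X" using closedin_sets_borel_X[OF Z] .
  have "X - Z \<in> sets borel_X" using sets.compl_sets[of Z borel_X] by simp
  then show k: "?k \<in> borel_measurable borel_X" by measurable
  fix \<gamma> L assume \<gamma>: "arc_length_curve \<gamma> L"
  then have L: "0 \<le> L" using curve_endpoints by auto
  define T where "T = {t \<in> {0..L}. \<gamma> t \<in> Z}"
  show "ennreal \<bar>u (\<gamma> L) - u (\<gamma> 0)\<bar> \<le> (\<integral>\<^sup>+ \<tau> \<in> {0..L}. ?k (\<gamma> \<tau>) \<partial>lborel)"
  proof (cases "T = {}")
    case True
    then have "(\<integral>\<^sup>+ \<tau> \<in> {0..L}. h (\<gamma> \<tau>) \<partial>lborel) = (\<integral>\<^sup>+ \<tau> \<in> {0..L}. ?k (\<gamma> \<tau>) \<partial>lborel)"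
      using arc_length_curve_in[OF \<gamma>]
      by (intro nn_integral_cong) (auto simp: indicator_def T_def)
    then show ?thesis using upper_gradientD[OF u \<gamma>] by simp
  next
    case False
    have "closed T" unfolding T_def by (rule curve_preimage_closed[OF \<gamma> Z])
    have bdd: "bdd_below T" "bdd_above T" by (auto simp: T_def intro!: bdd_belowI[of _ 0] bdd_aboveI[of _ L])
    define a b where "a = Inf T" and "b = Sup T"
    have ab: "a \<in> T" "b \<in> T" unfolding a_def b_def
      using closed_contains_Inf closed_contains_Sup \<open>closed T\<close> bdd False by auto
    have le: "a \<le> t" "t \<le> b" if "t \<in> T" for t
      using that bdd by (auto simp: a_def b_def intro: cInf_lower cSup_upper)
    have uab: "u (\<gamma> a) = c" "u (\<gamma> b) = c" using ab c by (auto simp: T_def)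
    have abL: "0 \<le> a" "a \<le> b" "b \<le> L" using ab le by (auto simp: T_def)
    have "ennreal \<bar>u (\<gamma> L) - u (\<gamma> 0)\<bar> \<le> ennreal (\<bar>u (\<gamma> a) - u (\<gamma> 0)\<bar> + \<bar>u (\<gamma> L) - u (\<gamma> b)\<bar>)"
      using uab by (intro ennreal_leI) auto
    also have "\<dots> = ennreal \<bar>u (\<gamma> a) - u (\<gamma> 0)\<bar> + ennreal \<bar>u (\<gamma> L) - u (\<gamma> b)\<bar>" by simp
    also have "\<dots> \<le> (\<integral>\<^sup>+ \<tau> \<in> {0..a}. h (\<gamma> \<tau>) \<partial>lborel) + (\<integral>\<^sup>+ \<tau> \<in> {b..L}. h (\<gamma> \<tau>) \<partial>lborel)"
      using abL by (intro add_mono upper_gradient_sub[OF u \<gamma>]) auto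
    also have "\<dots> = (\<integral>\<^sup>+ \<tau>. h (\<gamma> \<tau>) * indicator {0..a} \<tau> + h (\<gamma> \<tau>) * indicator {b..L} \<tau> \<partial>lborel)"
      using abL by (intro nn_integral_add[symmetric] comp_curve_measurable_sub[OF \<gamma> h]) auto
    also have "\<dots> \<le> (\<integral>\<^sup>+ \<tau> \<in> {0..L}. ?k (\<gamma> \<tau>) \<partial>lborel)"
    proof (rule nn_integral_mono_AE)
      have "AE \<tau> in lborel. \<tau> \<noteq> a" "AE \<tau> in lborel. \<tau> \<noteq> b" by (auto intro: AE_lborel_singleton)
      then show "AE \<tau> in lborel. h (\<gamma> \<tau>) * indicator {0..a} \<tau> + h (\<gamma> \<tau>) * indicator {b..L} \<tau>
          \<le> ?k (\<gamma> \<tau>) * indicator {0..L} \<tau>"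
      proof eventually_elim
        case (elim \<tau>)
        have "\<gamma> \<tau> \<in> X - Z" if "0 \<le> \<tau>" "\<tau> \<le> L" "\<tau> < a \<or> b < \<tau>"
          using le[of \<tau>] that arc_length_curve_in[OF \<gamma>, of \<tau>] by (auto simp: T_def)
        then show ?case using elim abL by (auto simp: indicator_def)
      qed
    qed
    finally show ?thesis .
  qed
qed

text \<open>
  Absolute continuity of the integral along a curve, in the form needed for a bisection argument.
\<close>

lemma curve_small_integral:
  assumes \<gamma>: "arc_length_curve \<gamma> L" and g: "g \<in> borel_measurable borel_X"
    and fin: "(\<integral>\<^sup>+ \<tau> \<in> {0..L}. g (\<gamma> \<tau>) \<partial>lborel) < \<infinity>" and "0 < c"
  shows "\<exists>\<delta>>0. \<forall>s t. 0 \<le> s \<and> s \<le> x \<and> x \<le> t \<and> t \<le> L \<and> t - s < \<delta> \<longrightarrow>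
     (\<integral>\<^sup>+ \<tau> \<in> {s..t}. g (\<gamma> \<tau>) \<partial>lborel) < ennreal c"
proof -
  define G where "G = (\<lambda>\<tau>. g (\<gamma> \<tau>) * indicator {0..L} \<tau>)"
  have G[measurable]: "G \<in> borel_measurable lborel"
    unfolding G_def by (rule comp_curve_measurable[OF \<gamma> g])
  define A where "A = (\<lambda>n::nat. {x - 1 / real (Suc n)..x + 1 / real (Suc n)})"
  have "A n \<subseteq> A k" if "k \<le> n" for k n
  proof -
    have "1 / real (Suc n) \<le> 1 / real (Suc k)" using that by (intro divide_left_mono) auto
    then show ?thesis by (auto simp: A_def)
  qed
  then have "decseq A" by (simp add: decseq_def)
  have "(\<lambda>n. emeasure (density lborel G) (A n)) \<longlonglongrightarrow> emeasure (density lborel G) (\<Inter>n. A n)"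
  proof (rule Lim_emeasure_decseq)
    show "decseq A" by fact
    show "emeasure (density lborel G) (A n) \<noteq> \<infinity>" for n
    proof -
      have "emeasure (density lborel G) (A n) \<le> (\<integral>\<^sup>+ \<tau>. G \<tau> \<partial>lborel)"
        by (subst emeasure_density) (auto simp: A_def intro!: nn_integral_mono simp: indicator_def)
      then show ?thesis using fin by (auto simp: G_def top_unique)
    qed
  qed (auto simp: A_def)
  moreover have "(\<Inter>n. A n) \<subseteq> {x}"
  proof
    fix y assume y: "y \<in> (\<Inter>n. A n)"
    have "\<bar>y - x\<bar> \<le> 1 / real (Suc n)" for n
    proof -
      have "y \<in> A n" using y by blast
      then show ?thesis by (auto simp: A_def)
    qed
    then have "\<bar>y - x\<bar> \<le> 0"
      by (intro LIMSEQ_le_const[OF LIMSEQ_inverse_real_of_nat]) (auto simp: inverse_eq_divide)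
    then show "y \<in> {x}" by simp
  qed
  then have "emeasure (density lborel G) (\<Inter>n. A n) \<le> emeasure (density lborel G) {x}"
    by (intro emeasure_mono) auto
  moreover have "emeasure (density lborel G) {x} = 0"
    by (subst emeasure_density) (auto simp: nn_integral_0_iff_AE intro!: AE_mp[OF AE_lborel_singleton[of x]])
  ultimately have "(\<lambda>n. emeasure (density lborel G) (A n)) \<longlonglongrightarrow> 0" by simp
  then have "eventually (\<lambda>n. emeasure (density lborel G) (A n) < ennreal c) sequentially"
    using \<open>0 < c\<close> by (intro order_tendstoD) auto
  then obtain n where n: "emeasure (density lborel G) (A n) < ennreal c"
    by (auto simp: eventually_sequentially)
  show ?thesis
  proof (intro exI[of _ "1 / real (Suc n)"] conjI allI impI)
    fix s t assume st: "0 \<le> s \<and> s \<le> x \<and> x \<le> t \<and> t \<le> L \<and> t - s < 1 / real (Suc n)"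
    have "(\<integral>\<^sup>+ \<tau> \<in> {s..t}. g (\<gamma> \<tau>) \<partial>lborel) \<le> (\<integral>\<^sup>+ \<tau> \<in> A n. G \<tau> \<partial>lborel)"
      using st by (intro nn_integral_mono) (auto simp: indicator_def G_def A_def)
    also have "\<dots> = emeasure (density lborel G) (A n)"
      by (subst emeasure_density) (auto simp: A_def)
    finally show "(\<integral>\<^sup>+ \<tau> \<in> {s..t}. g (\<gamma> \<tau>) \<partial>lborel) < ennreal c" using n by order
  qed simp
qed

text \<open>
  The chain rule for \<open>t\<mapsto> t powr a\<close>, with \<open>F\<close> in the derivative replaced by a Borel
  function \<open>K\<close> that exceeds \<open>F\<close> by a positive amount on every curve. The excess has two
  uses. If \<open>g\<close> is integrable along the curve, then \<open>F\<close> oscillates by less than the excess on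
  short pieces, so that the mean value theorem applies to each of them. If it is not, then
  \<open>K\<close> is bounded below and the right-hand side is infinite as well; this fails for
  \<open>K = F\<close>, since \<open>F\<close> may vanish exactly where the integral of \<open>g\<close> diverges.
\<close>

lemma upper_gradient_powr:
  fixes a :: real and K :: "'a \<Rightarrow> real"
  assumes F: "upper_gradient (\<lambda>x. ereal (F x)) g" and F0: "\<And>x. x \<in> X \<Longrightarrow> 0 \<le> F x"
    and a: "1 \<le> a" and K: "K \<in> borel_measurable borel_X"
    and Kc: "\<And>\<gamma> L. arc_length_curve \<gamma> L \<Longrightarrow> \<exists>c>0. \<forall>t\<in>{0..L}. F (\<gamma> t) + c \<le> K (\<gamma> t)"
  shows "upper_gradient (\<lambda>x. ereal (F x powr a)) (\<lambda>x. ennreal (a * K x powr (a - 1)) * g x)"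
  unfolding upper_gradient_real
proof (intro conjI allI impI)
  let ?k = "\<lambda>x. ennreal (a * K x powr (a - 1)) * g x"
  have g[measurable]: "g \<in> borel_measurable borel_X" using upper_gradient_measurable[OF F] .
  have [measurable]: "K \<in> borel_measurable borel_X" by fact
  show k: "?k \<in> borel_measurable borel_X" by measurable
  fix \<gamma> L assume \<gamma>: "arc_length_curve \<gamma> L"
  then have L: "0 \<le> L" using curve_endpoints by auto
  obtain c where c: "0 < c" "\<And>t. t \<in> {0..L} \<Longrightarrow> F (\<gamma> t) + c \<le> K (\<gamma> t)" using Kc[OF \<gamma>] by auto
  note inX = arc_length_curve_in[OF \<gamma>]
  have lower: "ennreal (a * M powr (a - 1)) * (\<integral>\<^sup>+ \<tau> \<in> {s..t}. g (\<gamma> \<tau>) \<partial>lborel)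
      \<le> (\<integral>\<^sup>+ \<tau> \<in> {s..t}. ?k (\<gamma> \<tau>) \<partial>lborel)"
    if "{s..t} \<subseteq> {0..L}" "0 \<le> M" "\<And>\<tau>. \<tau> \<in> {s..t} \<Longrightarrow> M \<le> K (\<gamma> \<tau>)" for M s t
  proof -
    have "ennreal (a * M powr (a - 1)) * (\<integral>\<^sup>+ \<tau> \<in> {s..t}. g (\<gamma> \<tau>) \<partial>lborel)
      = (\<integral>\<^sup>+ \<tau>. ennreal (a * M powr (a - 1)) * (g (\<gamma> \<tau>) * indicator {s..t} \<tau>) \<partial>lborel)"
      using comp_curve_measurable_sub[OF \<gamma> g that(1)] by (simp add: nn_integral_cmult)
    also have "\<dots> \<le> (\<integral>\<^sup>+ \<tau> \<in> {s..t}. ?k (\<gamma> \<tau>) \<partial>lborel)"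
      using that a
      by (intro nn_integral_mono) (auto simp: indicator_def intro!: mult_right_mono ennreal_leI
        mult_left_mono powr_mono2)
    finally show ?thesis .
  qed
  show "ennreal \<bar>F (\<gamma> L) powr a - F (\<gamma> 0) powr a\<bar> \<le> (\<integral>\<^sup>+ \<tau> \<in> {0..L}. ?k (\<gamma> \<tau>) \<partial>lborel)"
  proof (cases "(\<integral>\<^sup>+ \<tau> \<in> {0..L}. g (\<gamma> \<tau>) \<partial>lborel) < \<infinity>")
    case False
    have "ennreal (a * c powr (a - 1)) * (\<integral>\<^sup>+ \<tau> \<in> {0..L}. g (\<gamma> \<tau>) \<partial>lborel)
        \<le> (\<integral>\<^sup>+ \<tau> \<in> {0..L}. ?k (\<gamma> \<tau>) \<partial>lborel)"
    proof (rule lower)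
      fix \<tau> assume "\<tau> \<in> {0..L}"
      then show "c \<le> K (\<gamma> \<tau>)" using c(2)[of \<tau>] F0[OF inX[of \<tau>]] by linarith
    qed (use c in auto)
    moreover have "ennreal (a * c powr (a - 1)) \<noteq> 0" using a c by auto
    moreover have "(\<integral>\<^sup>+ \<tau> \<in> {0..L}. g (\<gamma> \<tau>) \<partial>lborel) = top" using False by (simp add: not_less top_unique)
    moreover have "I = top" if "c * J \<le> I" "c \<noteq> 0" "J = top" for c I J :: ennreal
      using that by (simp add: ennreal_mult_top top_unique)
    ultimately have "(\<integral>\<^sup>+ \<tau> \<in> {0..L}. ?k (\<gamma> \<tau>) \<partial>lborel) = top" by blast
    then show ?thesis by (simp only: top_greatest)
  next
    case True
    define P where "P = (\<lambda>s t. 0 \<le> s \<and> t \<le> L \<longrightarrow>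
      ennreal \<bar>F (\<gamma> t) powr a - F (\<gamma> s) powr a\<bar> \<le> (\<integral>\<^sup>+ \<tau> \<in> {s..t}. ?k (\<gamma> \<tau>) \<partial>lborel))"
    have "P 0 L"
    proof (rule Bolzano)
      show "0 \<le> L" by fact
    next
      fix r s t :: real assume P: "P r s" "P s t" and le: "r \<le> s" "s \<le> t"
      show "P r t" unfolding P_def
      proof (intro impI, elim conjE)
        assume rt: "0 \<le> r" "t \<le> L"
        have "ennreal \<bar>F (\<gamma> t) powr a - F (\<gamma> r) powr a\<bar>
          \<le> ennreal (\<bar>F (\<gamma> s) powr a - F (\<gamma> r) powr a\<bar> + \<bar>F (\<gamma> t) powr a - F (\<gamma> s) powr a\<bar>)"
          by (intro ennreal_leI) auto
        also have "\<dots> = ennreal \<bar>F (\<gamma> s) powr a - F (\<gamma> r) powr a\<bar> + ennreal \<bar>F (\<gamma> t) powr a - F (\<gamma> s) powr a\<bar>"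
          by simp
        also have "\<dots> \<le> (\<integral>\<^sup>+ \<tau> \<in> {r..s}. ?k (\<gamma> \<tau>) \<partial>lborel) + (\<integral>\<^sup>+ \<tau> \<in> {s..t}. ?k (\<gamma> \<tau>) \<partial>lborel)"
          using P rt le by (intro add_mono) (auto simp: P_def)
        also have "\<dots> = (\<integral>\<^sup>+ \<tau>. ?k (\<gamma> \<tau>) * indicator {r..s} \<tau> + ?k (\<gamma> \<tau>) * indicator {s..t} \<tau> \<partial>lborel)"
          using rt le by (intro nn_integral_add[symmetric] comp_curve_measurable_sub[OF \<gamma> k]) auto
        also have "\<dots> \<le> (\<integral>\<^sup>+ \<tau> \<in> {r..t}. ?k (\<gamma> \<tau>) \<partial>lborel)"
        proof (rule nn_integral_mono_AE)
          show "AE \<tau> in lborel. ?k (\<gamma> \<tau>) * indicator {r..s} \<tau> + ?k (\<gamma> \<tau>) * indicator {s..t} \<tau>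
              \<le> ?k (\<gamma> \<tau>) * indicator {r..t} \<tau>"
            using AE_lborel_singleton[of s] by eventually_elim (use le in \<open>auto simp: indicator_def\<close>)
        qed
        finally show "ennreal \<bar>F (\<gamma> t) powr a - F (\<gamma> r) powr a\<bar> \<le> (\<integral>\<^sup>+ \<tau> \<in> {r..t}. ?k (\<gamma> \<tau>) \<partial>lborel)" .
      qed
    next
      fix x :: real
      obtain \<delta> where \<delta>: "0 < \<delta>" "\<And>s t. \<lbrakk>0 \<le> s; s \<le> x; x \<le> t; t \<le> L; t - s < \<delta>\<rbrakk> \<Longrightarrow>
          (\<integral>\<^sup>+ \<tau> \<in> {s..t}. g (\<gamma> \<tau>) \<partial>lborel) < ennreal c"
        using curve_small_integral[OF \<gamma> g True c(1), of x] by metis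
      show "\<exists>\<delta>>0. \<forall>s t. s \<le> x \<and> x \<le> t \<and> t - s < \<delta> \<longrightarrow> P s t"
      proof (intro exI[of _ \<delta>] conjI allI impI \<delta>(1), elim conjE)
        fix s t assume st: "s \<le> x" "x \<le> t" "t - s < \<delta>"
        show "P s t" unfolding P_def
        proof (intro impI, elim conjE)
          assume bd: "0 \<le> s" "t \<le> L"
          have osc: "\<bar>F (\<gamma> \<tau>') - F (\<gamma> \<tau>)\<bar> \<le> c" if "s \<le> \<tau>" "\<tau> \<le> \<tau>'" "\<tau>' \<le> t" for \<tau> \<tau>'
          proof -
            have "ennreal \<bar>F (\<gamma> \<tau>') - F (\<gamma> \<tau>)\<bar> \<le> (\<integral>\<^sup>+ \<sigma> \<in> {\<tau>..\<tau>'}. g (\<gamma> \<sigma>) \<partial>lborel)"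
              using that bd by (intro upper_gradient_sub[OF F \<gamma>]) auto
            also have "\<dots> \<le> (\<integral>\<^sup>+ \<sigma> \<in> {s..t}. g (\<gamma> \<sigma>) \<partial>lborel)"
              using that by (intro nn_integral_mono) (auto simp: indicator_def)
            also have "\<dots> < ennreal c" using \<delta>(2) bd st by auto
            finally show ?thesis using c(1) by (simp add: ennreal_less_iff)
          qed
          define M where "M = max (F (\<gamma> s)) (F (\<gamma> t))"
          have X: "\<gamma> s \<in> X" "\<gamma> t \<in> X" using inX st bd by auto
          have M: "M \<le> K (\<gamma> \<tau>)" if "\<tau> \<in> {s..t}" for \<tau>
            using c(2)[of \<tau>] osc[of s \<tau>] osc[of \<tau> t] that st bd unfolding M_def by (auto simp: abs_le_iff)
          have M0: "0 \<le> M" using F0 X by (auto simp: M_def le_max_iff_disj)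
          have "ennreal \<bar>F (\<gamma> t) powr a - F (\<gamma> s) powr a\<bar>
              \<le> ennreal (a * M powr (a - 1) * \<bar>F (\<gamma> t) - F (\<gamma> s)\<bar>)"
            using F0 X a by (intro ennreal_leI abs_powr_diff_le) (auto simp: M_def)
          also have "\<dots> = ennreal (a * M powr (a - 1)) * ennreal \<bar>F (\<gamma> t) - F (\<gamma> s)\<bar>"
            using a by (simp add: ennreal_mult)
          also have "\<dots> \<le> ennreal (a * M powr (a - 1)) * (\<integral>\<^sup>+ \<tau> \<in> {s..t}. g (\<gamma> \<tau>) \<partial>lborel)"
            using st bd by (intro mult_left_mono upper_gradient_sub[OF F \<gamma>]) auto
          also have "\<dots> \<le> (\<integral>\<^sup>+ \<tau> \<in> {s..t}. ?k (\<gamma> \<tau>) \<partial>lborel)"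
            using M M0 bd by (intro lower) auto
          finally show "ennreal \<bar>F (\<gamma> t) powr a - F (\<gamma> s) powr a\<bar> \<le> (\<integral>\<^sup>+ \<tau> \<in> {s..t}. ?k (\<gamma> \<tau>) \<partial>lborel)" .
        qed
      qed
    qed
    then show ?thesis using L by (simp add: P_def)
  qed
qed

end

section \<open>The Poincare inequality for bounded functions\<close>

context metric_measure_space
begin

lemma set_integrable_bounded:
  fixes u :: "'a \<Rightarrow> real"
  assumes "u \<in> borel_measurable m" "\<And>y. y \<in> X \<Longrightarrow> \<bar>u y\<bar> \<le> N"
  shows "set_integrable m (mball x r) u"
  unfolding set_integrable_def
proof (rule integrableI_bounded_set[where A = "mball x r" and B = N])
  show "(\<lambda>x'. indicator (mball x r) x' *\<^sub>R u x') \<in> borel_measurable m"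
    using assms(1) by measurable
  show "AE x' in m. x' \<in> mball x r \<longrightarrow> norm (indicator (mball x r) x' *\<^sub>R u x') \<le> N"
    using assms(2) by (auto simp: space_m[symmetric])
qed (auto simp: emeasure_mball indicator_def)

lemma upper_gradient_dist_comp:
  assumes x: "x \<in> X" and l: "0 \<le> l" and f: "\<And>s t. \<bar>f s - f t\<bar> \<le> l * \<bar>s - t\<bar>"
  shows "upper_gradient (\<lambda>y. ereal (f (d x y))) (\<lambda>_. ennreal l)"
proof (rule upper_gradient_lipschitz[OF l])
  fix y y' assume y: "y \<in> X" "y' \<in> X"
  have "\<bar>d x y - d x y'\<bar> \<le> d y y'"
    using triangle[of x y y'] triangle[of x y' y] commute[of y y'] x y by auto
  then have "l * \<bar>d x y - d x y'\<bar> \<le> l * d y y'" using l by (intro mult_left_mono) auto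
  then show "\<bar>f (d x y) - f (d x y')\<bar> \<le> l * d y y'" using f[of "d x y" "d x y'"] by linarith
qed

text \<open>
  The Poincare inequality asks for an upper gradient that is \<open>p\<close>-integrable on the whole space.
  A non-negative bounded function can be cut off outside \<open>mball x (lam * r)\<close> without changing
  either side of the inequality, at the price of a bounded gradient between that ball and its double;
  hence local integrability suffices. The number \<open>c\<close> is the mean value over the ball.
\<close>

lemma poincare_local:
  assumes PI: "poincare p C_P lam" and p: "1 \<le> p" and CP: "0 < C_P" and lam: "1 \<le> lam"
    and x: "x \<in> X" and r: "0 < r"
    and u[measurable]: "u \<in> borel_measurable m" and uN: "\<And>y. y \<in> X \<Longrightarrow> 0 \<le> u y \<and> u y \<le> N"
    and ug: "upper_gradient (\<lambda>y. ereal (u y)) h"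
    and fin: "(\<integral>\<^sup>+ y \<in> mball x (2 * (lam * r)). enn_powr (h y) p \<partial>m) < \<infinity>"
  shows "\<exists>c. (\<integral>\<^sup>+ y \<in> mball x r. ennreal (\<bar>u y - c\<bar> powr p) \<partial>m)
    \<le> ennreal ((C_P * r) powr p) * (\<integral>\<^sup>+ y \<in> mball x (lam * r). enn_powr (h y) p \<partial>m)"
proof -
  define \<rho> where "\<rho> = lam * r"
  have \<rho>: "0 < \<rho>" "r \<le> \<rho>" using lam r by (auto simp: \<rho>_def)
  define N' where "N' = max N 1"
  have N': "0 < N'" by (auto simp: N'_def)
  define l where "l = N' / \<rho>"
  have l: "0 < l" using N' \<rho> by (simp add: l_def)
  define \<phi> where "\<phi> = (\<lambda>y. min N' (max 0 (l * (2 * \<rho> - d x y))))"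
  define w where "w = (\<lambda>y. min (u y) (\<phi> y))"
  have \<phi>_inner: "\<phi> y = N'" if "d x y \<le> \<rho>" for y
  proof -
    have "N' = l * \<rho>" using \<rho> by (simp add: l_def)
    also have "\<dots> \<le> l * (2 * \<rho> - d x y)" using that l by (intro mult_left_mono) auto
    finally show ?thesis by (simp add: \<phi>_def)
  qed
  have \<phi>_outer: "\<phi> y = 0" if "2 * \<rho> \<le> d x y" for y
  proof -
    have "l * (2 * \<rho> - d x y) \<le> 0" using that l by (simp add: mult_nonneg_nonpos)
    then show ?thesis using N' by (simp add: \<phi>_def)
  qed
  have \<phi>0: "0 \<le> \<phi> y" for y using N' by (simp add: \<phi>_def)
  have w_in: "w y = u y" if "y \<in> mball x \<rho>" for y
    using that uN[of y] \<phi>_inner[of y] by (auto simp: w_def in_mball N'_def)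
  have h[measurable]: "h \<in> borel_measurable borel_X" "h \<in> borel_measurable m"
    using upper_gradient_measurable[OF ug] measurable_borel_X_imp by auto
  let ?B = "mball x (2 * \<rho>)" and ?Z = "X - mball x (2 * \<rho>)" and ?K = "mcball x \<rho>"
  have Z: "closedin mtopology ?Z" using closedin_diff[OF closedin_topspace[of mtopology] openin_mball[of x "2 * \<rho>"]] by simp
  define g where "g = (\<lambda>y. (h y + ennreal l * indicator (X - ?K) y) * indicator (X - ?Z) y)"
  have "upper_gradient (\<lambda>y. ereal (\<phi> y)) (\<lambda>_. ennreal l)"
    unfolding \<phi>_def
  proof (rule upper_gradient_dist_comp[OF x])
    fix s t
    have "\<bar>min N' (max 0 (l * (2 * \<rho> - s))) - min N' (max 0 (l * (2 * \<rho> - t)))\<bar> \<le> \<bar>l * (s - t)\<bar>"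
      by (auto simp: min_def max_def algebra_simps abs_le_iff)
    then show "\<bar>min N' (max 0 (l * (2 * \<rho> - s))) - min N' (max 0 (l * (2 * \<rho> - t)))\<bar> \<le> l * \<bar>s - t\<bar>"
      using l by (simp add: abs_mult)
  qed (use l in auto)
  then have "upper_gradient (\<lambda>y. ereal (\<phi> y)) (\<lambda>y. ennreal l * indicator (X - ?K) y)"
    by (rule upper_gradient_localize[where c = N']) (auto simp: in_mcball \<phi>_inner)
  then have "upper_gradient (\<lambda>y. ereal (w y)) (\<lambda>y. h y + ennreal l * indicator (X - ?K) y)"
    unfolding w_def by (rule upper_gradient_min[OF ug])
  then have ugw: "upper_gradient (\<lambda>y. ereal (w y)) g"
    unfolding g_def
  proof (rule upper_gradient_localize[OF _ Z, where c = 0])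
    fix y assume "y \<in> ?Z"
    then show "w y = 0" using uN[of y] \<phi>_outer[of y] x by (auto simp: w_def in_mball)
  qed
  have [measurable]: "g \<in> borel_measurable m"
    using upper_gradient_measurable[OF ugw] by (rule measurable_borel_X_imp)
  have XZ: "X - ?Z = ?B" by (auto simp: in_mball)
  have "(\<integral>\<^sup>+ y. enn_powr (g y) p \<partial>m)
      \<le> (\<integral>\<^sup>+ y. ennreal (2 powr p) * (enn_powr (h y) p * indicator ?B y + ennreal (l powr p) * indicator ?B y) \<partial>m)"
  proof (rule nn_integral_mono)
    fix y assume "y \<in> space m"
    have "enn_powr (h y + ennreal l * indicator (X - ?K) y) p \<le> enn_powr (h y + ennreal l) p"
      using p by (intro enn_powr_mono add_left_mono) (auto simp: indicator_def)
    also have "\<dots> \<le> ennreal (2 powr p) * (enn_powr (h y) p + enn_powr (ennreal l) p)"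
      using p by (intro enn_powr_add_le) auto
    finally show "enn_powr (g y) p \<le> ennreal (2 powr p) * (enn_powr (h y) p * indicator ?B y + ennreal (l powr p) * indicator ?B y)"
      using l unfolding g_def XZ by (auto simp: indicator_def)
  qed
  also have "\<dots> = ennreal (2 powr p) * ((\<integral>\<^sup>+ y \<in> ?B. enn_powr (h y) p \<partial>m) + ennreal (l powr p) * emeasure m ?B)"
    by (simp add: nn_integral_cmult nn_integral_add)
  also have "\<dots> < \<infinity>"
    using fin by (simp add: emeasure_mball ennreal_mult_less_top \<rho>_def)
  finally have "g \<in> UG p (\<lambda>y. ereal (w y))" using ugw by (simp add: UG_def)
  moreover have wm[measurable]: "w \<in> borel_measurable m"
    unfolding w_def \<phi>_def using x by measurable
  have wb: "\<bar>w y\<bar> \<le> N'" if "y \<in> X" for y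
    using uN[OF that] \<phi>0[of y] by (auto simp: w_def N'_def)
  have "w \<in> L1_loc" unfolding L1_loc_def using set_integrable_bounded[OF wm wb] by auto
  ultimately have P: "enn_powr (nn_mean (mball x r) (\<lambda>y. ennreal (\<bar>w y - mean (mball x r) w\<bar> powr p))) (1 / p)
        \<le> ennreal (C_P * r) * enn_powr (nn_mean (mball x \<rho>) (\<lambda>y. enn_powr (g y) p)) (1 / p)"
    using PI x r unfolding poincare_def \<rho>_def by blast
  let ?c = "mean (mball x r) w"
  have "enn_powr (enn_powr (nn_mean (mball x r) (\<lambda>y. ennreal (\<bar>w y - ?c\<bar> powr p))) (1 / p)) p
     \<le> enn_powr (ennreal (C_P * r) * enn_powr (nn_mean (mball x \<rho>) (\<lambda>y. enn_powr (g y) p)) (1 / p)) p"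
    using p by (intro enn_powr_mono P) auto
  then have P': "nn_mean (mball x r) (\<lambda>y. ennreal (\<bar>w y - ?c\<bar> powr p))
     \<le> ennreal ((C_P * r) powr p) * nn_mean (mball x \<rho>) (\<lambda>y. enn_powr (g y) p)"
    using p CP r by (simp add: enn_powr_mult enn_powr_inverse)
  have m: "emeasure m (mball x r) \<noteq> 0" "emeasure m (mball x r) < top"
    "emeasure m (mball x \<rho>) \<noteq> 0" "emeasure m (mball x \<rho>) < top"
    using ball_pos[OF x r] ball_pos[OF x \<rho>(1)] by (auto simp: emeasure_mball)
  have mono: "emeasure m (mball x r) \<le> emeasure m (mball x \<rho>)"
    using \<rho> by (intro emeasure_mono mball_subset_concentric) auto
  have "(\<integral>\<^sup>+ y \<in> mball x r. ennreal (\<bar>u y - ?c\<bar> powr p) \<partial>m)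
      = (\<integral>\<^sup>+ y \<in> mball x r. ennreal (\<bar>w y - ?c\<bar> powr p) \<partial>m)"
    using w_in mball_subset_concentric[OF \<rho>(2), of x]
    by (intro nn_integral_cong) (auto simp: indicator_def)
  also have "\<dots> = nn_mean (mball x r) (\<lambda>y. ennreal (\<bar>w y - ?c\<bar> powr p)) * emeasure m (mball x r)"
    unfolding nn_mean_def using m by (simp add: ennreal_divide_times)
  also have "\<dots> \<le> (ennreal ((C_P * r) powr p) * nn_mean (mball x \<rho>) (\<lambda>y. enn_powr (g y) p)) * emeasure m (mball x \<rho>)"
    by (intro mult_mono P' mono) auto
  also have "\<dots> = ennreal ((C_P * r) powr p) * (\<integral>\<^sup>+ y \<in> mball x \<rho>. enn_powr (g y) p \<partial>m)"
    unfolding nn_mean_def using m by (simp add: ennreal_divide_times mult.assoc)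
  also have "(\<integral>\<^sup>+ y \<in> mball x \<rho>. enn_powr (g y) p \<partial>m) = (\<integral>\<^sup>+ y \<in> mball x \<rho>. enn_powr (h y) p \<partial>m)"
  proof (intro nn_integral_cong)
    fix y
    show "enn_powr (g y) p * indicator (mball x \<rho>) y = enn_powr (h y) p * indicator (mball x \<rho>) y"
      using \<rho> unfolding g_def XZ by (auto simp: indicator_def in_mball in_mcball)
  qed
  finally show ?thesis unfolding \<rho>_def by blast
qed

text \<open>
  Markov's inequality, phrased so that the degenerate threshold \<open>c = 0\<close> is covered: then
  \<open>f\<close> vanishes almost everywhere on \<open>A\<close>.
\<close>

lemma markov_half:
  assumes [measurable]: "A \<in> sets m" "f \<in> borel_measurable m" and fin: "emeasure m A < \<infinity>"
    and p: "0 < p" and c: "0 \<le> c" and f0: "\<And>x. x \<in> X \<Longrightarrow> 0 \<le> f x"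
    and int: "2 * (\<integral>\<^sup>+ x \<in> A. ennreal (f x powr p) \<partial>m) \<le> ennreal (c powr p) * emeasure m A"
  shows "measure m A / 2 \<le> measure m {x \<in> A. f x \<le> c}"
proof -
  have AX: "A \<subseteq> X" using sets.sets_into_space[of A m] by (simp add: space_m)
  have A: "emeasure m A = ennreal (measure m A)" using fin by (simp add: emeasure_eq_ennreal_measure)
  have fm: "A \<in> fmeasurable m" using fin by (simp add: fmeasurable_def)
  define G where "G = {x \<in> A. f x \<le> c}"
  define H where "H = {x \<in> A. c < f x}"
  have GX: "G = {x \<in> space m. x \<in> A \<and> f x \<le> c}" "H = {x \<in> space m. x \<in> A \<and> c < f x}"
    using AX by (auto simp: G_def H_def space_m)
  have [measurable]: "G \<in> sets m" "H \<in> sets m" unfolding GX by measurable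
  have GHf: "G \<in> fmeasurable m" "H \<in> fmeasurable m"
    by (auto intro!: fmeasurableI2[OF fm] simp: G_def H_def)
  have split: "measure m A = measure m G + measure m H"
  proof -
    have "A = G \<union> H" "G \<inter> H = {}" by (auto simp: G_def H_def)
    then show ?thesis using measure_Union[of m G H] GHf by (auto simp: fmeasurable_def)
  qed
  have "measure m H \<le> measure m A / 2"
  proof (rule ccontr)
    assume "\<not> ?thesis"
    then have big: "measure m A < 2 * measure m H" by simp
    then have Hpos: "0 < measure m H" using split measure_nonneg[of m G] measure_nonneg[of m A] by linarith
    have Hem: "emeasure m H = ennreal (measure m H)" using GHf by (simp add: emeasure_eq_measure2)
    show False
    proof (cases "c = 0")
      case True
      then have "(\<integral>\<^sup>+ x \<in> A. ennreal (f x powr p) \<partial>m) = 0" using int p by simp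
      then have "AE x in m. ennreal (f x powr p) * indicator A x = 0"
        by (subst (asm) nn_integral_0_iff_AE) auto
      then have "AE x in m. x \<notin> H"
        by eventually_elim (use True p in \<open>auto simp: H_def indicator_def split: if_splits\<close>)
      then have "emeasure m H = 0" by (subst (asm) AE_iff_measurable[of H]) (auto simp: GX)
      then show False using Hpos by (simp add: Hem)
    next
      case False
      with c have "0 < c" by simp
      have "ennreal (c powr p) * emeasure m H = (\<integral>\<^sup>+ x. ennreal (c powr p) * indicator H x \<partial>m)"
        by (simp add: nn_integral_cmult_indicator)
      also have "\<dots> \<le> (\<integral>\<^sup>+ x \<in> A. ennreal (f x powr p) \<partial>m)"
        using c p by (intro nn_integral_mono) (auto simp: H_def indicator_def intro!: ennreal_leI powr_mono2)
      finally have "2 * (ennreal (c powr p) * emeasure m H) \<le> 2 * (\<integral>\<^sup>+ x \<in> A. ennreal (f x powr p) \<partial>m)"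
        by (intro mult_left_mono) auto
      also note int
      finally have "ennreal (2 * (c powr p * measure m H)) \<le> ennreal (c powr p * measure m A)"
        unfolding A Hem by (simp add: ennreal_mult)
      then have "2 * (c powr p * measure m H) \<le> c powr p * measure m A" by simp
      then have "c powr p * (2 * measure m H) \<le> c powr p * measure m A" by (simp add: mult.left_commute)
      then show False using big \<open>0 < c\<close> by simp
    qed
  qed
  then show ?thesis using split by (simp add: G_def[symmetric])
qed

end

section \<open>Oscillation is controlled on annuli\<close>

text \<open>
  The hypotheses of the theorem for one space and one exponent \<open>p\<close>, with \<open>C_D\<close> a doubling
  constant. All constants below depend on \<open>s\<close>, \<open>\<eta>\<close>, \<open>C_P\<close>, \<open>lam\<close>,
  \<open>C_D\<close> and \<open>C_o\<close>, but not on the space and not on \<open>p\<close>.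
\<close>

locale hardy_setting = metric_measure_space X d m
  for X :: "'a set" and d m +
  fixes z :: 'a and p s \<eta> C_P lam C_D C_o :: real
  assumes z: "z \<in> X"
    and p: "1 \<le> p" and ps: "p \<le> s" and s\<eta>: "s < \<eta>"
    and C_P: "0 < C_P" and lam: "1 \<le> lam" and poincare: "poincare p C_P lam"
    and C_D: "1 \<le> C_D"
    and doubling: "\<And>x r. x \<in> X \<Longrightarrow> 0 < r \<Longrightarrow>
      measure m (mball x (2 * r)) \<le> C_D * measure m (mball x r)"
    and C_o: "0 < C_o"
    and growth: "\<And>r R. 0 < r \<Longrightarrow> r \<le> R \<Longrightarrow>
      C_o * (R / r) powr \<eta> \<le> measure m (mball z R) / measure m (mball z r)"
begin

abbreviation vol :: "real \<Rightarrow> real" where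
  "vol R \<equiv> measure m (mball z R)"

definition annulus :: "real \<Rightarrow> real \<Rightarrow> 'a set" where
  "annulus a b = {x \<in> X. a < d z x \<and> d z x < b}"

lemma dz_measurable [measurable]: "d z \<in> borel_measurable m"
  using z by (rule dist_measurable)

lemma mball_z_eq: "mball z R = {x \<in> space m. d z x < R}"
  using z by (auto simp: in_mball space_m)

lemma annulus_sets [measurable]: "annulus a b \<in> sets m"
proof -
  have "annulus a b = {x \<in> space m. a < d z x \<and> d z x < b}" by (simp add: annulus_def space_m)
  then show ?thesis by simp
qed

lemma vol_pos: "0 < R \<Longrightarrow> 0 < vol R"
  using z by (rule measure_mball_pos)

lemma vol_growth:
  assumes "0 < r" "r \<le> R"
  shows "vol r \<le> (r / R) powr \<eta> / C_o * vol R"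
proof -
  have "C_o * (R / r) powr \<eta> * vol r \<le> vol R"
    using growth[OF assms] vol_pos[OF assms(1)] by (simp add: pos_le_divide_eq)
  then have "(r / R) powr \<eta> * (C_o * (R / r) powr \<eta> * vol r) \<le> (r / R) powr \<eta> * vol R"
    by (intro mult_left_mono) auto
  moreover have "(r / R) powr \<eta> * (R / r) powr \<eta> = 1"
    using assms by (simp add: powr_mult[symmetric])
  then have "(r / R) powr \<eta> * (C_o * (R / r) powr \<eta> * vol r) = C_o * vol r"
    by (simp add: ac_simps)
  ultimately show ?thesis using C_o by (simp add: pos_le_divide_eq mult.commute)
qed

text \<open>
  If \<open>u\<close> is at least \<open>\<beta>\<close> on a fixed proportion of \<open>mball z R\<close> and at most \<open>\<alpha>\<close> on
  another one, then the energy that this costs is spent at distance comparable to \<open>R\<close> from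
  \<open>z\<close>. Indeed, rescale \<open>u\<close> and truncate it to \<open>[0, 1]\<close>, and take the minimum with a
  cut-off function vanishing on the ball of radius \<open>\<sigma> * R\<close>. The truncation makes the cost of the cut-off independent of
  \<open>u\<close>: it is at most a constant times
  \<open>(\<sigma> * R) powr - p * vol (2 * \<sigma> * R)\<close>, and so at most a constant times
  \<open>\<sigma> powr (\<eta> - p) * R powr - p * vol R\<close>. As \<open>\<eta> > p\<close>, this is
  negligible for small \<open>\<sigma>\<close>, and so is the volume on which \<open>u\<close> has been changed. The four
  conditions on \<open>\<sigma>\<close> quantify this smallness uniformly in \<open>p\<close>.
\<close>

lemma annular_gap:
  assumes R: "0 < R" and u[measurable]: "u \<in> borel_measurable m"
    and ug: "upper_gradient (\<lambda>x. ereal (u x)) h"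
    and fin: "(\<integral>\<^sup>+ x \<in> mball z (2 * (lam * R)). enn_powr (h x) p \<partial>m) < \<infinity>"
    and ab: "\<alpha> < \<beta>" and \<kappa>: "0 < \<kappa>"
    and large: "\<kappa> * vol R \<le> measure m {x \<in> mball z R. \<beta> \<le> u x}"
      "\<kappa> * vol R \<le> measure m {x \<in> mball z R. u x \<le> \<alpha>}"
    and \<sigma>: "0 < \<sigma>" "2 * \<sigma> \<le> 1" "(2 * \<sigma>) powr \<eta> / C_o \<le> \<kappa> / 2"
      "(2 * max 1 C_P) powr s * 2 powr \<eta> / C_o * \<sigma> powr (\<eta> - s) \<le> \<kappa> * 2 powr - s / 4"
  shows "ennreal ((\<beta> - \<alpha>) powr p * vol R)
    \<le> ennreal (4 / \<kappa> * (4 * max 1 C_P) powr s * R powr p)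
      * (\<integral>\<^sup>+ x \<in> annulus (\<sigma> * R) (lam * R). enn_powr (h x) p \<partial>m)"
proof -
  define l where "l = 1 / (\<sigma> * R)"
  define b where "b = 1 / (\<beta> - \<alpha>)"
  have l: "0 < l" and b: "0 < b" using \<sigma> R ab by (auto simp: l_def b_def)
  define \<phi> where "\<phi> = (\<lambda>x. min 1 (max 0 (l * (d z x - \<sigma> * R))))"
  define w where "w = (\<lambda>x. max 0 (min 1 (b * (u x - \<alpha>))))"
  define v where "v = (\<lambda>x. min (\<phi> x) (w x))"
  have lR: "l * (\<sigma> * R) = 1" using \<sigma> R by (simp add: l_def)
  have \<phi>_in: "\<phi> x = 0" if "d z x \<le> \<sigma> * R" for x
    using that l by (simp add: \<phi>_def mult_nonneg_nonpos)
  have \<phi>_out: "\<phi> x = 1" if "2 * (\<sigma> * R) \<le> d z x" for x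
  proof -
    have "1 = l * (\<sigma> * R)" using lR by simp
    also have "\<dots> \<le> l * (d z x - \<sigma> * R)" using that l by (intro mult_left_mono) linarith+
    finally show ?thesis by (simp add: \<phi>_def)
  qed
  have \<phi>0: "0 \<le> \<phi> x" for x by (simp add: \<phi>_def)
  have v01: "0 \<le> v x \<and> v x \<le> 1" for x by (auto simp: v_def \<phi>_def w_def)
  have h[measurable]: "h \<in> borel_measurable m"
    using upper_gradient_measurable[OF ug] measurable_borel_X_imp by auto
  have vm[measurable]: "v \<in> borel_measurable m" unfolding v_def \<phi>_def w_def by measurable
  let ?in = "mcball z (\<sigma> * R)" and ?ring = "mball z (2 * (\<sigma> * R))"
  have "upper_gradient (\<lambda>x. ereal (\<phi> x)) (\<lambda>_. ennreal l)"
    unfolding \<phi>_def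
  proof (rule upper_gradient_dist_comp[OF z])
    fix s t
    have "\<bar>min 1 (max 0 (l * (s - \<sigma> * R))) - min 1 (max 0 (l * (t - \<sigma> * R)))\<bar> \<le> \<bar>l * (s - t)\<bar>"
      by (auto simp: min_def max_def algebra_simps abs_le_iff)
    then show "\<bar>min 1 (max 0 (l * (s - \<sigma> * R))) - min 1 (max 0 (l * (t - \<sigma> * R)))\<bar> \<le> l * \<bar>s - t\<bar>"
      using l by (simp add: abs_mult)
  qed (use l in auto)
  moreover have "closedin mtopology (X - ?ring)"
    using closedin_diff[OF closedin_topspace[of mtopology] openin_mball[of z "2 * (\<sigma> * R)"]] by simp
  ultimately have "upper_gradient (\<lambda>x. ereal (\<phi> x)) (\<lambda>x. ennreal l * indicator (X - (X - ?ring)) x)"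
    by (rule upper_gradient_localize[where c = 1]) (use z in \<open>auto simp: in_mball \<phi>_out\<close>)
  moreover have "upper_gradient (\<lambda>x. ereal (w x)) (\<lambda>x. ennreal b * h x)"
  proof (rule upper_gradient_comp_lipschitz[OF ug])
    fix x y
    have "\<bar>w x - w y\<bar> \<le> \<bar>b * (u x - u y)\<bar>"
      unfolding w_def by (auto simp: min_def max_def algebra_simps abs_le_iff)
    then show "\<bar>w x - w y\<bar> \<le> b * \<bar>u x - u y\<bar>" using b by (simp add: abs_mult)
  qed (use b in auto)
  ultimately have "upper_gradient (\<lambda>x. ereal (v x))
      (\<lambda>x. ennreal l * indicator (X - (X - ?ring)) x + ennreal b * h x)"
    unfolding v_def by (rule upper_gradient_min)
  moreover have "X - (X - ?ring) = ?ring" by (auto simp: in_mball)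
  ultimately have ugv: "upper_gradient (\<lambda>x. ereal (v x))
      (\<lambda>x. (ennreal l * indicator ?ring x + ennreal b * h x) * indicator (X - ?in) x)"
    by (intro upper_gradient_localize[where c = 0])
      (auto simp: in_mcball v_def w_def \<phi>_in)
  define g where "g = (\<lambda>x. (ennreal l * indicator ?ring x + ennreal b * h x) * indicator (X - ?in) x)"
  have [measurable]: "g \<in> borel_measurable m"
    using upper_gradient_measurable[OF ugv] measurable_borel_X_imp by (auto simp: g_def)
  have g_le: "enn_powr (g x) p \<le> ennreal (2 powr p) * (ennreal (l powr p) * indicator ?ring x
      + ennreal (b powr p) * (enn_powr (h x) p * indicator (X - ?in) x))" for x
  proof (cases "x \<in> X - ?in")
    case True
    then have "enn_powr (g x) p \<le> ennreal (2 powr p) * (enn_powr (ennreal l * indicator ?ring x) p + enn_powr (ennreal b * h x) p)"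
      using p unfolding g_def by (simp add: enn_powr_add_le)
    then show ?thesis using True l b by (auto simp: enn_powr_mult indicator_def)
  qed (simp add: g_def)
  have g_le_on: "enn_powr (g x) p * indicator B x \<le> ennreal (2 powr p) * (ennreal (l powr p) * indicator ?ring x
      + ennreal (b powr p) * (enn_powr (h x) p * indicator S x))"
    if "x \<in> B \<Longrightarrow> x \<in> X - ?in \<Longrightarrow> x \<in> S" for x B S
  proof (cases "x \<in> B")
    case True
    have "ennreal (2 powr p) * (ennreal (l powr p) * indicator ?ring x
        + ennreal (b powr p) * (enn_powr (h x) p * indicator (X - ?in) x))
      \<le> ennreal (2 powr p) * (ennreal (l powr p) * indicator ?ring x
        + ennreal (b powr p) * (enn_powr (h x) p * indicator S x))"
      using that[OF True] by (intro mult_left_mono add_left_mono) (auto split: split_indicator)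
    with g_le[of x] True show ?thesis by simp
  qed simp
  have "(\<integral>\<^sup>+ x \<in> mball z (2 * (lam * R)). enn_powr (g x) p \<partial>m)
    \<le> (\<integral>\<^sup>+ x. ennreal (2 powr p) * (ennreal (l powr p) * indicator ?ring x
      + ennreal (b powr p) * (enn_powr (h x) p * indicator (mball z (2 * (lam * R))) x)) \<partial>m)"
    by (intro nn_integral_mono g_le_on) auto
  also have "\<dots> = ennreal (2 powr p) * (ennreal (l powr p) * emeasure m ?ring
      + ennreal (b powr p) * (\<integral>\<^sup>+ x \<in> mball z (2 * (lam * R)). enn_powr (h x) p \<partial>m))"
    by (simp add: nn_integral_cmult nn_integral_add nn_integral_cmult_indicator)
  also have "\<dots> < \<infinity>" using fin by (simp add: ennreal_mult_less_top emeasure_mball)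
  finally have gfin: "(\<integral>\<^sup>+ x \<in> mball z (2 * (lam * R)). enn_powr (g x) p \<partial>m) < \<infinity>" .
  have "\<exists>c. (\<integral>\<^sup>+ x \<in> mball z R. ennreal (\<bar>v x - c\<bar> powr p) \<partial>m)
    \<le> ennreal ((C_P * R) powr p) * (\<integral>\<^sup>+ x \<in> mball z (lam * R). enn_powr (g x) p \<partial>m)"
    by (rule poincare_local[OF poincare p C_P lam z R vm v01 ugv[folded g_def] gfin])
  then obtain c where c: "(\<integral>\<^sup>+ x \<in> mball z R. ennreal (\<bar>v x - c\<bar> powr p) \<partial>m)
    \<le> ennreal ((C_P * R) powr p) * (\<integral>\<^sup>+ x \<in> mball z (lam * R). enn_powr (g x) p \<partial>m)" ..
  define E where "E = (\<integral>\<^sup>+ x \<in> annulus (\<sigma> * R) (lam * R). enn_powr (h x) p \<partial>m)"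
  have "(\<integral>\<^sup>+ x \<in> mball z (lam * R). enn_powr (g x) p \<partial>m)
    \<le> (\<integral>\<^sup>+ x. ennreal (2 powr p) * (ennreal (l powr p) * indicator ?ring x
      + ennreal (b powr p) * (enn_powr (h x) p * indicator (annulus (\<sigma> * R) (lam * R)) x)) \<partial>m)"
    by (intro nn_integral_mono g_le_on) (use z in \<open>simp add: annulus_def in_mball in_mcball\<close>)
  also have "\<dots> = ennreal (2 powr p) * (ennreal (l powr p) * ennreal (vol (2 * (\<sigma> * R))) + ennreal (b powr p) * E)"
    unfolding E_def emeasure_mball[symmetric]
    by (simp add: nn_integral_cmult nn_integral_add nn_integral_cmult_indicator)
  finally have up: "(\<integral>\<^sup>+ x \<in> mball z R. ennreal (\<bar>v x - c\<bar> powr p) \<partial>m)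
     \<le> ennreal ((C_P * R) powr p) * (ennreal (2 powr p) * (ennreal (l powr p) * ennreal (vol (2 * (\<sigma> * R))) + ennreal (b powr p) * E))"
    by (intro order_trans[OF c] mult_left_mono) auto
  have ring_vol: "vol (2 * (\<sigma> * R)) \<le> (2 * \<sigma>) powr \<eta> / C_o * vol R"
    using vol_growth[of "2 * (\<sigma> * R)" R] \<sigma> R by simp
  \<comment> \<open>Whatever \<open>c\<close> is, one of the two plateaus of \<open>v\<close> has distance at least \<open>1 / 2\<close> from it.\<close>
  have low: "ennreal (2 powr - p * (\<kappa> / 2 * vol R)) \<le> (\<integral>\<^sup>+ x \<in> mball z R. ennreal (\<bar>v x - c\<bar> powr p) \<partial>m)"
  proof -
    have *: "ennreal (2 powr - p * (\<kappa> / 2 * vol R)) \<le> (\<integral>\<^sup>+ x \<in> mball z R. ennreal (\<bar>v x - c\<bar> powr p) \<partial>m)"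
      if U: "U \<in> sets m" "U \<subseteq> mball z R" "\<kappa> / 2 * vol R \<le> measure m U" and vU: "\<And>x. x \<in> U \<Longrightarrow> 1 / 2 \<le> \<bar>v x - c\<bar>" for U
    proof -
      have "ennreal (2 powr - p * (\<kappa> / 2 * vol R)) \<le> ennreal (2 powr - p) * ennreal (measure m U)"
        unfolding ennreal_mult''[OF measure_nonneg, symmetric] using U by (intro ennreal_leI mult_left_mono) auto
      also have "ennreal (measure m U) = emeasure m U"
        using fmeasurable_subset_mball[OF U(1,2)] by (simp add: emeasure_eq_measure2)
      also have "ennreal (2 powr - p) * emeasure m U = (\<integral>\<^sup>+ x. ennreal (2 powr - p) * indicator U x \<partial>m)"
        using U by (simp add: nn_integral_cmult_indicator)
      also have "\<dots> \<le> (\<integral>\<^sup>+ x \<in> mball z R. ennreal (\<bar>v x - c\<bar> powr p) \<partial>m)"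
      proof (rule nn_integral_mono)
        fix x
        show "ennreal (2 powr - p) * indicator U x \<le> ennreal (\<bar>v x - c\<bar> powr p) * indicator (mball z R) x"
        proof (cases "x \<in> U")
          case True
          have "2 powr - p = (1 / 2 :: real) powr p" by (simp add: powr_minus powr_divide inverse_eq_divide)
          also have "\<dots> \<le> \<bar>v x - c\<bar> powr p" using vU[OF True] p by (intro powr_mono2) auto
          finally show ?thesis using True U by (auto simp: indicator_def ennreal_leI)
        qed simp
      qed
      finally show ?thesis .
    qed
    have sets: "{x \<in> mball z R. \<beta> \<le> u x} \<in> sets m" "{x \<in> mball z R. u x \<le> \<alpha>} \<in> sets m"
      by (simp_all add: mball_z_eq)
    show ?thesis
    proof (cases "1 / 2 \<le> \<bar>c\<bar>")
      case True
      show ?thesis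
      proof (rule *[OF sets(2)])
        have "\<kappa> / 2 * vol R \<le> \<kappa> * vol R" using \<kappa> by (intro mult_right_mono) auto
        then show "\<kappa> / 2 * vol R \<le> measure m {x \<in> mball z R. u x \<le> \<alpha>}" using large(2) by linarith
        fix x assume "x \<in> {x \<in> mball z R. u x \<le> \<alpha>}"
        then have "b * (u x - \<alpha>) \<le> 0" using b by (simp add: mult_nonneg_nonpos)
        then have "v x = 0" using \<phi>0[of x] by (simp add: v_def w_def)
        then show "1 / 2 \<le> \<bar>v x - c\<bar>" using True by simp
      qed auto
    next
      case False
      let ?U = "{x \<in> mball z R. \<beta> \<le> u x} - ?ring"
      show ?thesis
      proof (rule *[of ?U])
        show "?U \<in> sets m" using sets by auto
        have "measure m {x \<in> mball z R. \<beta> \<le> u x} \<le> measure m (?U \<union> ?ring)"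
        proof (rule measure_mono_fmeasurable)
          have "?U \<in> fmeasurable m" using sets by (intro fmeasurable_subset_mball[of _ z R]) auto
          then show "?U \<union> ?ring \<in> fmeasurable m"
            by (intro fmeasurable.Un fmeasurable_subset_mball[of ?ring z "2 * (\<sigma> * R)"]) auto
        qed (use sets in auto)
        also have "\<dots> \<le> measure m ?U + vol (2 * (\<sigma> * R))"
          using sets by (intro measure_Un_le) auto
        also have "vol (2 * (\<sigma> * R)) \<le> \<kappa> / 2 * vol R"
          by (rule order_trans[OF ring_vol mult_right_mono[OF \<sigma>(3)]]) simp
        finally show "\<kappa> / 2 * vol R \<le> measure m ?U" using large(1) by (simp add: field_simps)
        fix x assume x: "x \<in> ?U"
        then have "1 \<le> b * (u x - \<alpha>)" using ab by (auto simp: b_def field_simps)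
        moreover have "\<phi> x = 1" using x z by (intro \<phi>_out) (auto simp: in_mball)
        ultimately have "v x = 1" by (simp add: v_def w_def)
        then show "1 / 2 \<le> \<bar>v x - c\<bar>" using False by (auto simp: abs_if split: if_splits)
      qed auto
    qed
  qed
  define P where "P = max 1 C_P"
  have P: "1 \<le> P" "C_P \<le> P" by (auto simp: P_def)
  let ?K = "4 / \<kappa> * (4 * P) powr s * R powr p"
  have K: "0 < ?K" using \<kappa> P R by auto
  show ?thesis
  proof (cases "E = top")
    case True
    moreover have "ennreal ?K \<noteq> 0" using K unfolding ennreal_eq_0_iff by linarith
    ultimately have "ennreal ?K * E = top" by (simp only: ennreal_mult_top if_False)
    then show ?thesis by (simp only: E_def P_def top_greatest)
  next
    case False
    then obtain e where e: "E = ennreal e" "0 \<le> e" by (cases E) auto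
    have "ennreal (2 powr - p * (\<kappa> / 2 * vol R)) \<le>
      ennreal ((C_P * R) powr p * (2 powr p * (l powr p * vol (2 * (\<sigma> * R)) + b powr p * e)))"
      using order_trans[OF low up] e by (simp add: ennreal_mult)
    then have main: "2 powr - p * (\<kappa> / 2 * vol R) \<le> (C_P * R) powr p * (2 powr p * (l powr p * vol (2 * (\<sigma> * R)) + b powr p * e))"
      using e by (subst (asm) ennreal_le_iff) auto
    have "(2 * C_P) powr p \<le> (2 * P) powr p" using P C_P p by (intro powr_mono2) auto
    also have "\<dots> \<le> (2 * P) powr s" using P ps by (intro powr_mono) auto
    finally have CPs: "(2 * C_P) powr p \<le> (2 * P) powr s" .
    have "(C_P * R) powr p * (2 powr p * (l powr p * vol (2 * (\<sigma> * R))))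
       = (2 * C_P) powr p * (\<sigma> powr - p * vol (2 * (\<sigma> * R)))"
    proof -
      have "(C_P * R) powr p * 2 powr p * l powr p = ((C_P * R) * 2 * l) powr p"
        using C_P R l by (simp add: powr_mult)
      also have "(C_P * R) * 2 * l = (2 * C_P) * inverse \<sigma>" using R \<sigma> by (simp add: l_def field_simps)
      also have "((2 * C_P) * inverse \<sigma>) powr p = (2 * C_P) powr p * \<sigma> powr - p"
        using C_P \<sigma> by (simp add: powr_mult powr_minus powr_divide inverse_eq_divide)
      finally show ?thesis by (simp add: mult.assoc[symmetric])
    qed
    also have "\<dots> \<le> (2 * P) powr s * (\<sigma> powr - p * ((2 * \<sigma>) powr \<eta> / C_o * vol R))"
      using CPs ring_vol by (intro mult_mono) auto
    also have "\<dots> = (2 * P) powr s * 2 powr \<eta> / C_o * \<sigma> powr (\<eta> - p) * vol R"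
      using \<sigma> by (simp add: powr_mult powr_diff powr_minus field_simps)
    also have "\<dots> \<le> (2 * P) powr s * 2 powr \<eta> / C_o * \<sigma> powr (\<eta> - s) * vol R"
      using \<sigma> ps C_o by (intro mult_right_mono mult_left_mono powr_mono') auto
    also have "\<dots> \<le> \<kappa> * 2 powr - s / 4 * vol R"
      using \<sigma>(4) by (intro mult_right_mono) (auto simp: P_def)
    finally have t1: "(C_P * R) powr p * (2 powr p * (l powr p * vol (2 * (\<sigma> * R)))) \<le> \<kappa> * 2 powr - s / 4 * vol R" .
    have "(C_P * R) powr p * (2 powr p * (b powr p * e)) = (2 * C_P) powr p * (R powr p * (b powr p * e))"
      using C_P R by (simp add: powr_mult)
    also have "\<dots> \<le> (2 * P) powr s * (R powr p * (b powr p * e))"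
      using CPs e by (intro mult_right_mono) auto
    finally have t2: "(C_P * R) powr p * (2 powr p * (b powr p * e)) \<le> (2 * P) powr s * (R powr p * (b powr p * e))" .
    have "2 powr - s * (\<kappa> / 2 * vol R) \<le> 2 powr - p * (\<kappa> / 2 * vol R)"
      using ps \<kappa> by (intro mult_right_mono) auto
    also note main
    finally have "2 powr - s * (\<kappa> / 2 * vol R) \<le> \<kappa> * 2 powr - s / 4 * vol R + (2 * P) powr s * (R powr p * (b powr p * e))"
      using t1 t2 by (simp add: distrib_left)
    then have "2 powr - s * (\<kappa> / 4 * vol R) \<le> (2 * P) powr s * (R powr p * (b powr p * e))"
      by (simp add: field_simps)
    then have "(4 / \<kappa> * 2 powr s * (\<beta> - \<alpha>) powr p) * (2 powr - s * (\<kappa> / 4 * vol R))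
       \<le> (4 / \<kappa> * 2 powr s * (\<beta> - \<alpha>) powr p) * ((2 * P) powr s * (R powr p * (b powr p * e)))"
      using \<kappa> by (intro mult_left_mono) auto
    moreover have "(4 / \<kappa> * 2 powr s * (\<beta> - \<alpha>) powr p) * (2 powr - s * (\<kappa> / 4 * vol R)) = (\<beta> - \<alpha>) powr p * vol R"
      using \<kappa> by (simp add: powr_minus field_simps)
    moreover have "(4 / \<kappa> * 2 powr s * (\<beta> - \<alpha>) powr p) * ((2 * P) powr s * (R powr p * (b powr p * e)))
       = ?K * e"
    proof -
      have "(\<beta> - \<alpha>) powr p * b powr p = 1" using ab by (simp add: b_def powr_mult[symmetric])
      moreover have "(4 * P) powr s = 2 powr s * (2 * P) powr s" using P by (simp add: powr_mult[symmetric])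
      ultimately show ?thesis by (simp add: algebra_simps)
    qed
    ultimately have "(\<beta> - \<alpha>) powr p * vol R \<le> ?K * e" by (simp only:)
    then have "ennreal ((\<beta> - \<alpha>) powr p * vol R) \<le> ennreal ?K * E"
      unfolding e(1) using e(2) K by (subst ennreal_mult[symmetric]) (auto intro: ennreal_leI)
    then show ?thesis by (simp add: E_def P_def)
  qed
qed

end

section \<open>The estimate at a single scale\<close>

context hardy_setting
begin

lemma doubling_iterate:
  assumes "x \<in> X" "0 < r"
  shows "measure m (mball x (2 ^ n * r)) \<le> C_D ^ n * measure m (mball x r)"
proof (induction n)
  case (Suc n)
  have "measure m (mball x (2 ^ Suc n * r)) \<le> C_D * measure m (mball x (2 ^ n * r))"
    using doubling[OF assms(1), of "2 ^ n * r"] assms by (simp add: mult.assoc)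
  also have "\<dots> \<le> C_D * (C_D ^ n * measure m (mball x r))"
    using C_D Suc by (intro mult_left_mono) auto
  finally show ?case by (simp add: mult.assoc)
qed simp

lemma mball_subset_mball:
  assumes "x \<in> X" "y \<in> X" "d x y + r \<le> R" shows "mball x r \<subseteq> mball y R"
proof
  fix w assume "w \<in> mball x r"
  then show "w \<in> mball y R"
    using triangle[of y x w] commute[of x y] assms by (auto simp: in_mball)
qed

definition shell :: "real \<Rightarrow> 'a set" where
  "shell r = {x \<in> X. r \<le> d z x \<and> d z x < 2 * r}"

lemma shell_sets [measurable]: "shell r \<in> sets m"
proof -
  have "shell r = {x \<in> space m. r \<le> d z x \<and> d z x < 2 * r}" by (simp add: shell_def space_m)
  then show ?thesis by simp
qed

text \<open>
  The balls of half the radius around separated points are disjoint, lie in a common ball around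
  \<open>z\<close>, and by doubling each has a fixed share of its volume.
\<close>

lemma separated_card_le:
  assumes r: "0 < r" "0 < \<rho>" "\<rho> \<le> 2 * r" and n: "8 * r \<le> 2 ^ n * (\<rho> / 2)"
    and F: "finite F" "F \<subseteq> shell r" and sep: "\<And>x y. x \<in> F \<Longrightarrow> y \<in> F \<Longrightarrow> x \<noteq> y \<Longrightarrow> \<rho> \<le> d x y"
  shows "real (card F) \<le> C_D ^ n"
proof -
  have FX: "x \<in> X" "d z x < 2 * r" if "x \<in> F" for x using that F by (auto simp: shell_def)
  have disj: "disjoint_family_on (\<lambda>x. mball x (\<rho> / 2)) F"
  proof (unfold disjoint_family_on_def, intro ballI impI)
    fix x y assume xy: "x \<in> F" "y \<in> F" "x \<noteq> y"
    show "mball x (\<rho> / 2) \<inter> mball y (\<rho> / 2) = {}"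
    proof (rule ccontr)
      assume "\<not> ?thesis"
      then obtain w where "w \<in> X" "d x w < \<rho> / 2" "d y w < \<rho> / 2" by (auto simp: in_mball)
      then show False using sep[OF xy] triangle[of x w y] commute[of w y] FX xy by auto
    qed
  qed
  have big: "vol (4 * r) \<le> C_D ^ n * measure m (mball x (\<rho> / 2))" if "x \<in> F" for x
  proof -
    have "mball z (4 * r) \<subseteq> mball x (2 ^ n * (\<rho> / 2))"
      using FX[OF that] z n r by (intro mball_subset_mball) auto
    then have "vol (4 * r) \<le> measure m (mball x (2 ^ n * (\<rho> / 2)))"
      by (intro measure_mono_mball) auto
    also have "\<dots> \<le> C_D ^ n * measure m (mball x (\<rho> / 2))"
      using FX[OF that] r by (intro doubling_iterate) auto
    finally show ?thesis .
  qed
  have "real (card F) * vol (4 * r) = (\<Sum>x\<in>F. vol (4 * r))" by simp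
  also have "\<dots> \<le> (\<Sum>x\<in>F. C_D ^ n * measure m (mball x (\<rho> / 2)))" by (intro sum_mono big)
  also have "\<dots> = C_D ^ n * (\<Sum>x\<in>F. measure m (mball x (\<rho> / 2)))" by (simp add: sum_distrib_left)
  also have "(\<Sum>x\<in>F. measure m (mball x (\<rho> / 2))) = measure m (\<Union>x\<in>F. mball x (\<rho> / 2))"
    using F disj by (intro measure_finite_Union[symmetric]) (auto simp: emeasure_mball)
  also have "\<dots> \<le> vol (4 * r)"
  proof (rule measure_mono_mball)
    have "mball x (\<rho> / 2) \<subseteq> mball z (4 * r)" if "x \<in> F" for x
      using FX[OF that] z r commute[of x z] by (intro mball_subset_mball) auto
    then show "(\<Union>x\<in>F. mball x (\<rho> / 2)) \<subseteq> mball z (4 * r)" by blast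
  qed (use F in auto)
  finally have "real (card F) * vol (4 * r) \<le> C_D ^ n * vol (4 * r)"
    using C_D by (simp add: mult_left_mono)
  then show ?thesis using vol_pos[of "4 * r"] r by simp
qed

lemma shell_cover:
  assumes r: "0 < r" "0 < \<rho>" "\<rho> \<le> 2 * r" and n: "8 * r \<le> 2 ^ n * (\<rho> / 2)"
  obtains F where "finite F" "F \<subseteq> shell r" "real (card F) \<le> C_D ^ n" "shell r \<subseteq> (\<Union>x\<in>F. mball x \<rho>)"
proof -
  define S where "S = (\<lambda>F. finite F \<and> F \<subseteq> shell r \<and> (\<forall>x\<in>F. \<forall>y\<in>F. x \<noteq> y \<longrightarrow> \<rho> \<le> d x y))"
  have card: "real (card F) \<le> C_D ^ n" if "S F" for F
    using separated_card_le[OF r n] that by (auto simp: S_def)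
  have "\<exists>F. S F \<and> (\<forall>G. S G \<longrightarrow> card G \<le> card F)"
  proof (rule ex_has_greatest_nat)
    show "S {}" by (simp add: S_def)
    show "\<forall>G. S G \<longrightarrow> card G < Suc (nat \<lfloor>C_D ^ n\<rfloor>)"
      by (intro allI impI le_imp_less_Suc le_nat_floor card)
  qed
  then obtain F where F: "S F" and max: "\<And>G. S G \<Longrightarrow> card G \<le> card F" by blast
  have "shell r \<subseteq> (\<Union>x\<in>F. mball x \<rho>)"
  proof (rule ccontr)
    assume "\<not> ?thesis"
    then obtain y where y: "y \<in> shell r" "\<And>x. x \<in> F \<Longrightarrow> y \<notin> mball x \<rho>" by blast
    have yX: "y \<in> X" using y by (simp add: shell_def)
    have FX: "x \<in> X" if "x \<in> F" for x using F that unfolding S_def shell_def by blast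
    have far: "\<rho> \<le> d x y" if "x \<in> F" for x
      using y(2)[OF that] FX[OF that] yX by (simp add: in_mball)
    have "y \<notin> F" using y(2)[of y] yX r by auto
    moreover have "S (insert y F)"
      unfolding S_def
    proof (intro conjI ballI impI)
      fix v w assume "v \<in> insert y F" "w \<in> insert y F" "v \<noteq> w"
      then show "\<rho> \<le> d v w"
        using F far[of v] far[of w] commute[of v w] unfolding S_def by (metis insert_iff)
    qed (use F y(1) in \<open>simp_all add: S_def\<close>)
    moreover have "finite F" using F by (simp add: S_def)
    ultimately show False using max[of "insert y F"] by simp
  qed
  then show ?thesis using that[of F] F card by (auto simp: S_def)
qed

lemma nn_integral_powr_finite:
  fixes u :: "'a \<Rightarrow> real"
  assumes "\<And>y. y \<in> X \<Longrightarrow> \<bar>u y\<bar> \<le> N"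
  shows "(\<integral>\<^sup>+ y \<in> mball x r. ennreal (\<bar>u y\<bar> powr p) \<partial>m) < \<infinity>"
proof -
  have "(\<integral>\<^sup>+ y \<in> mball x r. ennreal (\<bar>u y\<bar> powr p) \<partial>m)
     \<le> (\<integral>\<^sup>+ y. ennreal (N powr p) * indicator (mball x r) y \<partial>m)"
    using p assms by (intro nn_integral_mono)
      (auto simp: space_m indicator_def intro!: ennreal_leI powr_mono2)
  also have "\<dots> < \<infinity>" by (simp add: nn_integral_cmult_indicator emeasure_mball ennreal_mult_less_top)
  finally show ?thesis .
qed

lemma powr_sum4_le:
  fixes b a t q :: real
  assumes "0 \<le> b" "0 \<le> a" "0 \<le> t" "0 \<le> q"
  shows "(b + (a + t + q)) powr p \<le> 6 powr p * (b powr p + (a powr p + t powr p + q powr p))"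
proof -
  let ?M = "max (max b a) (max t q)"
  have "(b + (a + t + q)) powr p \<le> (4 * ?M) powr p" using assms p by (intro powr_mono2) auto
  also have "\<dots> = 4 powr p * ?M powr p" using assms by (simp add: powr_mult)
  also have "\<dots> \<le> 6 powr p * (b powr p + (a powr p + t powr p + q powr p))"
    using p by (intro mult_mono powr_mono2) (auto simp: max_def)
  finally show ?thesis .
qed

end

text \<open>
  The scales of the argument. A shell of radius \<open>r\<close> is compared with the ball of radius
  \<open>T * r\<close>; \<open>T\<close> is so large that the comparison can be absorbed. Doubling \<open>n\<close> times
  bounds the number of balls of radius \<open>r / (2 * lam)\<close> that cover the shell; doubling \<open>n'\<close>
  times shows that \<open>2 * \<kappa>\<close> is a lower bound for the share of the large ball that each of them
  occupies. Finally \<open>\<sigma>\<close> is the inner radius of the annulus for this \<open>\<kappa>\<close>, relative to the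
  large ball, and \<open>L\<close> bounds how many dyadic annuli overlap. It is important that \<open>n\<close> does
  not depend on \<open>T\<close>, since \<open>absorb\<close> is a condition on \<open>T\<close> for given \<open>n\<close>.
\<close>

locale hardy_scales = hardy_setting +
  fixes T \<sigma> :: real and n n' L :: nat and \<kappa> P K :: real
  assumes T: "4 \<le> T"
    and n: "32 * lam \<le> 2 ^ n"
    and n': "4 * lam * T \<le> 2 ^ n'"
    and \<kappa>: "\<kappa> = 1 / (2 * C_D ^ n')"
    and P_def: "P = max 1 C_P"
    and K_def: "K = 4 / \<kappa> * (4 * P) powr s"
    and \<sigma>: "0 < \<sigma>" "\<sigma> * T \<le> 1 / 2" "(2 * \<sigma>) powr \<eta> / C_o \<le> \<kappa> / 2"
      "(2 * P) powr s * 2 powr \<eta> / C_o * \<sigma> powr (\<eta> - s) \<le> \<kappa> * 2 powr - s / 4"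
    and L: "lam / \<sigma> \<le> 2 ^ L"
    and absorb: "C_D ^ n * (6 powr s * 2 * 4 powr \<eta> / C_o) * T powr - \<eta> * (2 * T powr s) \<le> 1 / 2"
begin

text \<open>
  On a small ball in the shell, the Poincare inequality bounds the oscillation of \<open>u\<close> around a
  constant \<open>c\<close>, so that on half of the small ball \<open>u\<close> is at least \<open>c - a\<close>, where
  \<open>a\<close> measures this oscillation. On half of the ball of radius \<open>T * r\<close>, \<open>u\<close> is at most
  \<open>t\<close>, where \<open>t powr p\<close> is twice the mean of \<open>u powr p\<close>. By \<open>annular_gap\<close> the difference of
  the two levels is at most \<open>q\<close>, which only involves the energy on an annulus.
  The resulting bound \<open>c \<le> a + t + q\<close> is integrated over the small ball; the factor
  \<open>T powr - \<eta>\<close> is the volume of the small ball relative to the large one.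
\<close>

lemma small_ball_estimate:
  assumes r: "0 < r"
    and u[measurable]: "u \<in> borel_measurable m" and uN: "\<And>x. x \<in> X \<Longrightarrow> 0 \<le> u x \<and> u x \<le> N"
    and ug: "upper_gradient (\<lambda>x. ereal (u x)) h"
    and fin: "\<And>R. (\<integral>\<^sup>+ x \<in> mball z R. enn_powr (h x) p \<partial>m) < \<infinity>"
    and x: "x \<in> shell r"
  shows "(\<integral>\<^sup>+ y \<in> mball x (r / (2 * lam)). ennreal (u y powr p) \<partial>m)
    \<le> ennreal (6 powr s * (3 * P powr s + K * T powr s) * r powr p)
        * (\<integral>\<^sup>+ y \<in> annulus (\<sigma> * (T * r)) (lam * (T * r)). enn_powr (h y) p \<partial>m)
      + ennreal (6 powr s * 2 * 4 powr \<eta> / C_o * T powr - \<eta>)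
        * (\<integral>\<^sup>+ y \<in> mball z (T * r). ennreal (u y powr p) \<partial>m)"
proof -
  define \<rho> where "\<rho> = r / (2 * lam)"
  define R where "R = T * r"
  have \<rho>: "0 < \<rho>" "\<rho> \<le> r / 2" "lam * \<rho> = r / 2" using r lam by (auto simp: \<rho>_def field_simps)
  have R: "0 < R" "4 * r \<le> R" using r T by (auto simp: R_def)
  have xX: "x \<in> X" "r \<le> d z x" "d z x < 2 * r" using x by (auto simp: shell_def)
  have P: "1 \<le> P" "C_P \<le> P" by (auto simp: P_def)
  have CDn: "1 \<le> C_D ^ n'" using C_D by simp
  have \<kappa>': "0 < \<kappa>" "\<kappa> \<le> 1 / 2" using CDn by (auto simp: \<kappa> field_simps)
  have [measurable]: "h \<in> borel_measurable m"
    using upper_gradient_measurable[OF ug] measurable_borel_X_imp by auto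
  let ?A = "annulus (\<sigma> * R) (lam * R)"
  let ?B = "mball x \<rho>"
  have "?A \<subseteq> mball z (lam * R)" using z by (auto simp: annulus_def in_mball)
  then have "(\<integral>\<^sup>+ y \<in> ?A. enn_powr (h y) p \<partial>m) \<le> (\<integral>\<^sup>+ y \<in> mball z (lam * R). enn_powr (h y) p \<partial>m)"
    by (intro nn_integral_mono) (auto simp: indicator_def)
  then obtain e where e: "(\<integral>\<^sup>+ y \<in> ?A. enn_powr (h y) p \<partial>m) = ennreal e" "0 \<le> e"
    using fin[of "lam * R"] by (cases "\<integral>\<^sup>+ y \<in> ?A. enn_powr (h y) p \<partial>m") (auto simp: top_unique)
  have uabs: "\<bar>u y\<bar> \<le> N" "\<bar>u y\<bar> = u y" if "y \<in> X" for y using uN[OF that] by auto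
  have "(\<integral>\<^sup>+ y \<in> mball z R. ennreal (u y powr p) \<partial>m) = (\<integral>\<^sup>+ y \<in> mball z R. ennreal (\<bar>u y\<bar> powr p) \<partial>m)"
    using uabs by (intro nn_integral_cong) (auto simp: space_m)
  also have "\<dots> < \<infinity>" using nn_integral_powr_finite[OF uabs(1)] .
  finally obtain U where U: "(\<integral>\<^sup>+ y \<in> mball z R. ennreal (u y powr p) \<partial>m) = ennreal U" "0 \<le> U"
    by (cases "\<integral>\<^sup>+ y \<in> mball z R. ennreal (u y powr p) \<partial>m") auto
  have xball: "mball x (2 * (lam * \<rho>)) \<subseteq> mball z (4 * r)"
    using xX z \<rho> commute[of x z] by (intro mball_subset_mball) auto
  then have "(\<integral>\<^sup>+ y \<in> mball x (2 * (lam * \<rho>)). enn_powr (h y) p \<partial>m) \<le> (\<integral>\<^sup>+ y \<in> mball z (4 * r). enn_powr (h y) p \<partial>m)"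
    by (intro nn_integral_mono) (auto simp: indicator_def)
  then have xfin: "(\<integral>\<^sup>+ y \<in> mball x (2 * (lam * \<rho>)). enn_powr (h y) p \<partial>m) < \<infinity>"
    using fin by (rule le_less_trans)
  obtain c where c: "(\<integral>\<^sup>+ y \<in> ?B. ennreal (\<bar>u y - c\<bar> powr p) \<partial>m)
    \<le> ennreal ((C_P * \<rho>) powr p) * (\<integral>\<^sup>+ y \<in> mball x (lam * \<rho>). enn_powr (h y) p \<partial>m)"
    using poincare_local[OF poincare p C_P lam xX(1) \<rho>(1) u uN ug xfin] by blast
  have "mball x (lam * \<rho>) \<subseteq> ?A"
  proof
    fix y assume y: "y \<in> mball x (lam * \<rho>)"
    then have yX: "y \<in> X" "d x y < r / 2" using \<rho> by (auto simp: in_mball)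
    have "\<sigma> * R \<le> r / 2" using \<sigma> r mult_right_mono[OF \<sigma>(2), of r] by (simp add: R_def)
    moreover have "R \<le> lam * R" using lam R by simp
    moreover have "d z x \<le> d z y + d x y" "d z y \<le> d z x + d x y"
      using triangle[of z y x] triangle[of z x y] commute[of x y] yX xX z by auto
    ultimately have "\<sigma> * R < d z y" "d z y < lam * R" using yX xX R r by linarith+
    then show "y \<in> ?A" using yX by (simp add: annulus_def)
  qed
  then have "(\<integral>\<^sup>+ y \<in> mball x (lam * \<rho>). enn_powr (h y) p \<partial>m) \<le> ennreal e"
    unfolding e(1)[symmetric] by (intro nn_integral_mono) (auto simp: indicator_def)
  then have "(\<integral>\<^sup>+ y \<in> ?B. ennreal (\<bar>u y - c\<bar> powr p) \<partial>m) \<le> ennreal ((C_P * \<rho>) powr p) * ennreal e"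
    by (intro order_trans[OF c] mult_left_mono) auto
  also have "\<dots> = ennreal ((C_P * \<rho>) powr p * e)" using e by (simp add: ennreal_mult)
  finally have c': "(\<integral>\<^sup>+ y \<in> ?B. ennreal (\<bar>u y - c\<bar> powr p) \<partial>m) \<le> ennreal ((C_P * \<rho>) powr p * e)" .
  then obtain I where I: "(\<integral>\<^sup>+ y \<in> ?B. ennreal (\<bar>u y - c\<bar> powr p) \<partial>m) = ennreal I" "0 \<le> I"
    by (cases "\<integral>\<^sup>+ y \<in> ?B. ennreal (\<bar>u y - c\<bar> powr p) \<partial>m") (auto simp: top_unique)
  have "I \<le> (C_P * \<rho>) powr p * e" using c' I e by simp
  also have "\<dots> \<le> (P * r) powr p * e"
    using C_P P \<rho> r e p by (intro mult_right_mono powr_mono2 mult_mono) auto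
  also have "\<dots> = P powr p * r powr p * e" using P r by (simp add: powr_mult)
  also have "\<dots> \<le> P powr s * r powr p * e"
    using P ps e by (intro mult_right_mono powr_mono) auto
  finally have I_le: "I \<le> P powr s * r powr p * e" .
  define M where "M = measure m ?B"
  have Mpos: "0 < M" using measure_mball_pos[OF xX(1) \<rho>(1)] by (simp add: M_def)
  have VR: "0 < vol R" using R vol_pos by auto
  have "?B \<subseteq> mball z (4 * r)" using xX z \<rho> r commute[of x z] by (intro mball_subset_mball) auto
  then have M4: "M \<le> vol (4 * r)" unfolding M_def by (intro measure_mono_mball) auto
  have V4: "vol (4 * r) \<le> (4 / T) powr \<eta> / C_o * vol R"
    using vol_growth[of "4 * r" R] R r by (simp add: R_def)
  have BR: "?B \<subseteq> mball z R" using xX z \<rho> r R commute[of x z] by (intro mball_subset_mball) auto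
  then have MR: "M \<le> vol R" unfolding M_def by (intro measure_mono_mball) auto
  have \<kappa>M: "\<kappa> * vol R \<le> M / 2"
  proof -
    have "(4 * lam * T) * \<rho> \<le> 2 ^ n' * \<rho>" using n' \<rho> by (intro mult_right_mono) auto
    moreover have "(4 * lam * T) * \<rho> = 2 * R" using lam by (simp add: \<rho>_def R_def)
    ultimately have "mball z R \<subseteq> mball x (2 ^ n' * \<rho>)" using xX z R by (intro mball_subset_mball) auto
    then have "vol R \<le> measure m (mball x (2 ^ n' * \<rho>))" by (intro measure_mono_mball) auto
    also have "\<dots> \<le> C_D ^ n' * M" unfolding M_def using xX \<rho> by (intro doubling_iterate) auto
    finally show ?thesis using CDn by (simp add: \<kappa> field_simps)
  qed
  define a where "a = (2 * I / M) powr (1 / p)"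
  define t where "t = (2 * U / vol R) powr (1 / p)"
  define q where "q = (K * R powr p * e / vol R) powr (1 / p)"
  have K: "0 \<le> K" using \<kappa>' by (simp add: K_def)
  have atq: "0 \<le> a" "0 \<le> t" "0 \<le> q" by (auto simp: a_def t_def q_def)
  have ap: "a powr p = 2 * I / M" and tp: "t powr p = 2 * U / vol R" and qp: "q powr p = K * R powr p * e / vol R"
    using p I(2) U(2) e(2) K Mpos VR by (auto simp: a_def t_def q_def powr_powr)
  have m1: "M / 2 \<le> measure m {y \<in> ?B. \<bar>u y - c\<bar> \<le> a}"
    unfolding M_def
  proof (rule markov_half[where p = p])
    show "2 * (\<integral>\<^sup>+ y \<in> ?B. ennreal (\<bar>u y - c\<bar> powr p) \<partial>m) \<le> ennreal (a powr p) * emeasure m ?B"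
      unfolding I(1) ap emeasure_mball M_def[symmetric] using I(2) Mpos
      by (simp flip: ennreal_mult ennreal_numeral)
  qed (use p atq in \<open>auto simp: emeasure_mball\<close>)
  have m2: "vol R / 2 \<le> measure m {y \<in> mball z R. u y \<le> t}"
  proof (rule markov_half[where p = p])
    show "2 * (\<integral>\<^sup>+ y \<in> mball z R. ennreal (u y powr p) \<partial>m) \<le> ennreal (t powr p) * emeasure m (mball z R)"
      unfolding U(1) tp emeasure_mball using U(2) VR
      by (simp flip: ennreal_mult ennreal_numeral)
  qed (use p atq uN in \<open>auto simp: emeasure_mball\<close>)
  have c_le: "c \<le> a + t + q"
  proof (cases "c - a \<le> t")
    case True
    then show ?thesis using atq by linarith
  next
    case False
    have "measure m {y \<in> ?B. \<bar>u y - c\<bar> \<le> a} \<le> measure m {y \<in> mball z R. c - a \<le> u y}"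
    proof (rule measure_mono_fmeasurable)
      show "{y \<in> ?B. \<bar>u y - c\<bar> \<le> a} \<subseteq> {y \<in> mball z R. c - a \<le> u y}" using BR by auto
      have "{y \<in> ?B. \<bar>u y - c\<bar> \<le> a} = ?B \<inter> {y \<in> space m. \<bar>u y - c\<bar> \<le> a}"
        by (auto simp: in_mball space_m)
      then show "{y \<in> ?B. \<bar>u y - c\<bar> \<le> a} \<in> sets m" by simp
      have "{y \<in> mball z R. c - a \<le> u y} \<in> sets m" by (simp add: mball_z_eq)
      then show "{y \<in> mball z R. c - a \<le> u y} \<in> fmeasurable m"
        by (intro fmeasurable_subset_mball[of _ z R]) auto
    qed
    then have l1: "\<kappa> * vol R \<le> measure m {y \<in> mball z R. c - a \<le> u y}" using m1 \<kappa>M by linarith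
    have "\<kappa> * vol R \<le> 1 / 2 * vol R" using \<kappa>' VR by (intro mult_right_mono) auto
    then have l2: "\<kappa> * vol R \<le> measure m {y \<in> mball z R. u y \<le> t}" using m2 by simp
    have "2 * \<sigma> \<le> 1"
    proof -
      have "\<sigma> * 4 \<le> \<sigma> * T" using T \<sigma> by (intro mult_left_mono) auto
      then show ?thesis using \<sigma>(2) by simp
    qed
    then have "ennreal ((c - a - t) powr p * vol R) \<le> ennreal (4 / \<kappa> * (4 * P) powr s * R powr p) * ennreal e"
      using annular_gap[OF R(1) u ug fin _ \<kappa>'(1) l1 l2, of \<sigma>] False \<sigma> e(1) unfolding P_def by simp
    then have "(c - a - t) powr p * vol R \<le> K * R powr p * e"
      using e(2) \<kappa>' by (simp add: K_def flip: ennreal_mult)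
    then have "(c - a - t) powr p \<le> q powr p" using VR by (simp add: qp pos_le_divide_eq)
    then have "c - a - t \<le> q"
      using p atq powr_less_mono2[of p q "c - a - t"] by linarith
    then show ?thesis by linarith
  qed
  let ?S = "a powr p + t powr p + q powr p"
  have "(\<integral>\<^sup>+ y \<in> ?B. ennreal (u y powr p) \<partial>m)
     \<le> (\<integral>\<^sup>+ y. ennreal (6 powr p) * (ennreal (\<bar>u y - c\<bar> powr p) * indicator ?B y + ennreal ?S * indicator ?B y) \<partial>m)"
  proof (rule nn_integral_mono)
    fix y assume "y \<in> space m"
    then have y: "0 \<le> u y" using uN by (simp add: space_m)
    have "u y powr p \<le> (\<bar>u y - c\<bar> + (a + t + q)) powr p" using y c_le p by (intro powr_mono2) auto
    also have "\<dots> \<le> 6 powr p * (\<bar>u y - c\<bar> powr p + ?S)"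
      using atq by (intro powr_sum4_le) auto
    finally show "ennreal (u y powr p) * indicator ?B y \<le>
       ennreal (6 powr p) * (ennreal (\<bar>u y - c\<bar> powr p) * indicator ?B y + ennreal ?S * indicator ?B y)"
      by (auto simp: indicator_def ennreal_leI simp flip: ennreal_mult ennreal_plus)
  qed
  also have "\<dots> = ennreal (6 powr p) * (ennreal I + ennreal ?S * ennreal M)"
    unfolding I(1)[symmetric] M_def emeasure_mball[symmetric]
    by (simp add: nn_integral_cmult nn_integral_add nn_integral_cmult_indicator)
  also have "\<dots> = ennreal (6 powr p * (I + ?S * M))"
    using I(2) Mpos by (simp add: ennreal_mult)
  also have "\<dots> \<le> ennreal (6 powr s * (3 * P powr s + K * T powr s) * r powr p * e
      + 6 powr s * 2 * 4 powr \<eta> / C_o * T powr - \<eta> * U)"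
  proof (rule ennreal_leI)
    have "?S * M = 2 * I + 2 * U * (M / vol R) + K * R powr p * e * (M / vol R)"
      unfolding ap tp qp using Mpos by (simp add: field_simps)
    also have "\<dots> \<le> 2 * I + 2 * U * ((4 / T) powr \<eta> / C_o) + K * R powr p * e * 1"
    proof (intro add_mono order_refl mult_left_mono)
      show "M / vol R \<le> (4 / T) powr \<eta> / C_o"
        using order_trans[OF M4 V4] VR by (simp add: pos_divide_le_eq)
      show "M / vol R \<le> 1" using MR VR by simp
    qed (use U e K in auto)
    finally have "I + ?S * M \<le> 3 * I + 2 * U * ((4 / T) powr \<eta> / C_o) + K * R powr p * e" by simp
    also have "\<dots> \<le> 3 * (P powr s * r powr p * e) + 2 * U * ((4 / T) powr \<eta> / C_o) + K * (T powr s * r powr p) * e"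
    proof -
      have "R powr p = T powr p * r powr p" using T r by (simp add: R_def powr_mult)
      also have "\<dots> \<le> T powr s * r powr p" using T ps by (intro mult_right_mono powr_mono) auto
      finally show ?thesis using I_le K e(2) U(2) by (intro add_mono mult_left_mono mult_right_mono) auto
    qed
    finally have "6 powr p * (I + ?S * M) \<le> 6 powr s * (3 * (P powr s * r powr p * e)
        + 2 * U * ((4 / T) powr \<eta> / C_o) + K * (T powr s * r powr p) * e)"
      using ps I Mpos by (intro mult_mono) auto
    also have "\<dots> = 6 powr s * (3 * P powr s + K * T powr s) * r powr p * e
      + 6 powr s * 2 * 4 powr \<eta> / C_o * T powr - \<eta> * U"
      using T by (simp add: powr_divide powr_minus field_simps)
    finally show "6 powr p * (I + ?S * M) \<le> 6 powr s * (3 * P powr s + K * T powr s) * r powr p * e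
      + 6 powr s * 2 * 4 powr \<eta> / C_o * T powr - \<eta> * U" .
  qed
  also have "\<dots> = ennreal (6 powr s * (3 * P powr s + K * T powr s) * r powr p) * ennreal e
      + ennreal (6 powr s * 2 * 4 powr \<eta> / C_o * T powr - \<eta>) * ennreal U"
    using e(2) U(2) K C_o by (simp flip: ennreal_mult ennreal_plus)
  finally show ?thesis unfolding e(1)[symmetric] U(1)[symmetric] R_def \<rho>_def .
qed

lemma single_scale:
  assumes r: "0 < r"
    and u[measurable]: "u \<in> borel_measurable m" and uN: "\<And>x. x \<in> X \<Longrightarrow> 0 \<le> u x \<and> u x \<le> N"
    and ug: "upper_gradient (\<lambda>x. ereal (u x)) h"
    and fin: "\<And>R. (\<integral>\<^sup>+ x \<in> mball z R. enn_powr (h x) p \<partial>m) < \<infinity>"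
  shows "(\<integral>\<^sup>+ y \<in> shell r. ennreal (u y powr p) \<partial>m)
    \<le> ennreal (C_D ^ n * (6 powr s * (3 * P powr s + K * T powr s)) * r powr p)
        * (\<integral>\<^sup>+ y \<in> annulus (\<sigma> * (T * r)) (lam * (T * r)). enn_powr (h y) p \<partial>m)
      + ennreal (C_D ^ n * (6 powr s * 2 * 4 powr \<eta> / C_o) * T powr - \<eta>)
        * (\<integral>\<^sup>+ y \<in> mball z (T * r). ennreal (u y powr p) \<partial>m)"
proof -
  define \<rho> where "\<rho> = r / (2 * lam)"
  have \<rho>: "0 < \<rho>" "\<rho> \<le> 2 * r" using r lam by (auto simp: \<rho>_def field_simps)
  have "8 * r \<le> 2 ^ n * (\<rho> / 2)"
  proof -
    have "32 * lam * (\<rho> / 2) \<le> 2 ^ n * (\<rho> / 2)" using n \<rho> by (intro mult_right_mono) auto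
    then show ?thesis using lam by (simp add: \<rho>_def)
  qed
  then obtain F where F: "finite F" "F \<subseteq> shell r" "real (card F) \<le> C_D ^ n"
    "shell r \<subseteq> (\<Union>x\<in>F. mball x \<rho>)"
    using shell_cover[OF r \<rho>] by blast
  define A where "A = (\<integral>\<^sup>+ y \<in> annulus (\<sigma> * (T * r)) (lam * (T * r)). enn_powr (h y) p \<partial>m)"
  define B where "B = (\<integral>\<^sup>+ y \<in> mball z (T * r). ennreal (u y powr p) \<partial>m)"
  define c1 where "c1 = 6 powr s * (3 * P powr s + K * T powr s) * r powr p"
  define c2 where "c2 = 6 powr s * 2 * 4 powr \<eta> / C_o * T powr - \<eta>"
  have \<kappa>': "0 < \<kappa>" using C_D by (simp add: \<kappa>)
  have c: "0 \<le> c1" "0 \<le> c2" using C_o \<kappa>' by (auto simp: c1_def c2_def K_def)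
  have "(\<integral>\<^sup>+ y \<in> shell r. ennreal (u y powr p) \<partial>m)
     \<le> (\<integral>\<^sup>+ y. (\<Sum>x\<in>F. ennreal (u y powr p) * indicator (mball x \<rho>) y) \<partial>m)"
  proof (rule nn_integral_mono)
    fix y
    show "ennreal (u y powr p) * indicator (shell r) y \<le> (\<Sum>x\<in>F. ennreal (u y powr p) * indicator (mball x \<rho>) y)"
    proof (cases "y \<in> shell r")
      case True
      then obtain x where x: "x \<in> F" "y \<in> mball x \<rho>" using F(4) by blast
      have "ennreal (u y powr p) * indicator (shell r) y = ennreal (u y powr p) * indicator (mball x \<rho>) y"
        using True x by simp
      also have "\<dots> \<le> (\<Sum>x\<in>F. ennreal (u y powr p) * indicator (mball x \<rho>) y)"
        using F(1) x(1) by (intro member_le_sum) auto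
      finally show ?thesis .
    qed simp
  qed
  also have "\<dots> = (\<Sum>x\<in>F. \<integral>\<^sup>+ y \<in> mball x \<rho>. ennreal (u y powr p) \<partial>m)"
    by (intro nn_integral_sum) auto
  also have "\<dots> \<le> (\<Sum>x\<in>F. ennreal c1 * A + ennreal c2 * B)"
  proof (rule sum_mono)
    fix x assume "x \<in> F"
    then show "(\<integral>\<^sup>+ y \<in> mball x \<rho>. ennreal (u y powr p) \<partial>m) \<le> ennreal c1 * A + ennreal c2 * B"
      unfolding A_def B_def c1_def c2_def \<rho>_def
      using F(2) by (intro small_ball_estimate[OF r u uN ug fin]) auto
  qed
  also have "\<dots> = ennreal (real (card F)) * (ennreal c1 * A + ennreal c2 * B)"
    by (simp add: ennreal_of_nat_eq_real_of_nat)
  also have "\<dots> \<le> ennreal (C_D ^ n) * (ennreal c1 * A + ennreal c2 * B)"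
    using F(3) by (intro mult_right_mono ennreal_leI) auto
  also have "\<dots> = ennreal (C_D ^ n * c1) * A + ennreal (C_D ^ n * c2) * B"
    using C_D c by (simp add: ennreal_mult distrib_left mult.assoc)
  finally show ?thesis unfolding A_def B_def c1_def c2_def by (simp add: mult.assoc)
qed

end

section \<open>Summation over the dyadic scales\<close>

abbreviation dyad :: "int \<Rightarrow> real" where
  "dyad i \<equiv> 2 powr real_of_int i"

lemma dyad_bracket:
  assumes "0 < (t::real)"
  obtains i where "dyad i \<le> t" "t < 2 * dyad i"
proof
  let ?i = "\<lfloor>log 2 t\<rfloor>"
  have "dyad ?i \<le> 2 powr log 2 t" by (intro powr_mono) auto
  then show "dyad ?i \<le> t" using assms by simp
  have "2 powr log 2 t < 2 powr (1 + real_of_int ?i)" by (intro powr_less_mono) linarith+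
  then show "t < 2 * dyad ?i" using assms by (simp add: powr_add)
qed

lemma dyad_less_iff: "0 < t \<Longrightarrow> t < dyad i \<longleftrightarrow> log 2 t < i"
  by (simp add: log_less_iff)

lemma dyad_greater_iff: "0 < t \<Longrightarrow> dyad i < t \<longleftrightarrow> i < log 2 t"
  by (simp add: less_log_iff)

text \<open>
  Only boundedly many of the annuli \<open>b * dyad i < t < a * dyad i\<close> contain a given distance
  \<open>t\<close>, and for those \<open>dyad i\<close> is comparable to \<open>t\<close>.
\<close>

lemma dyadic_window_sum:
  fixes a b t e s :: real
  assumes b: "0 < b" and a: "1 \<le> a" and ab: "a / b \<le> 2 ^ L" and e: "0 \<le> e" "e \<le> s" and t: "0 \<le> t"
  shows "(\<integral>\<^sup>+ i. ennreal (dyad i powr - e) * indicator {i. b * dyad i < t \<and> t < a * dyad i} i \<partial>count_space UNIV)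
    \<le> ennreal (real (Suc L) * a powr s * t powr - e)"
proof (cases "t = 0")
  case True
  then have "{i. b * dyad i < t \<and> t < a * dyad i} = {}" using b by (auto simp: not_less)
  then show ?thesis by simp
next
  case False
  with t have t: "0 < t" by simp
  define l where "l = \<lfloor>log 2 (t / a)\<rfloor>"
  have win: "l \<le> i" "i \<le> l + int L" "dyad i powr - e \<le> a powr s * t powr - e"
    if i: "b * dyad i < t" "t < a * dyad i" for i
  proof -
    have lo: "t / a < dyad i" and hi: "dyad i < t / b" using i a b by (auto simp: field_simps)
    then have l1: "log 2 (t / a) < i" and "i < log 2 (t / b)"
      using dyad_less_iff[of "t / a" i] dyad_greater_iff[of "t / b" i] t a b by auto
    moreover have "log 2 (t / b) \<le> log 2 (2 ^ L * (t / a))"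
      using t a b ab by (subst log_le_cancel_iff) (auto simp: field_simps)
    moreover have "log 2 (2 ^ L * (t / a)) = L + log 2 (t / a)"
      using t a by (subst log_mult) (auto simp: log_nat_power)
    ultimately have "i < L + log 2 (t / a)" by linarith
    then show "i \<le> l + int L" unfolding l_def by linarith
    show "l \<le> i" using l1 unfolding l_def by linarith
    have "dyad i powr - e \<le> (t / a) powr - e"
      using lo t a e by (intro powr_mono2') auto
    also have "\<dots> = a powr e * t powr - e" using t a by (simp add: powr_divide powr_minus field_simps)
    also have "\<dots> \<le> a powr s * t powr - e" using a e by (intro mult_right_mono powr_mono) auto
    finally show "dyad i powr - e \<le> a powr s * t powr - e" .
  qed
  have "(\<integral>\<^sup>+ i. ennreal (dyad i powr - e) * indicator {i. b * dyad i < t \<and> t < a * dyad i} i \<partial>count_space UNIV)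
    \<le> (\<integral>\<^sup>+ i. ennreal (a powr s * t powr - e) * indicator {l..l + int L} i \<partial>count_space UNIV)"
    using win by (intro nn_integral_mono) (auto split: split_indicator intro!: ennreal_leI)
  also have "\<dots> = ennreal (a powr s * t powr - e) * ennreal (real (Suc L))"
  proof -
    have "card {l..l + int L} = Suc L" by simp
    then have "emeasure (count_space UNIV) {l..l + int L} = ennreal (real (Suc L))"
      by (subst emeasure_count_space_finite) (simp_all only: ennreal_of_nat_eq_real_of_nat finite_atLeastAtMost_int subset_UNIV)
    then show ?thesis by (simp add: nn_integral_cmult_indicator del: of_nat_Suc)
  qed
  also have "\<dots> = ennreal (real (Suc L) * a powr s * t powr - e)"
    by (simp add: ennreal_mult''[symmetric] mult_ac del: of_nat_Suc)
  finally show ?thesis .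
qed

text \<open>
  A geometric series dominated by its first term, which belongs to the smallest scale with
  \<open>t < T * dyad i\<close>.
\<close>

lemma dyadic_tail_sum:
  fixes T t s :: real
  assumes T: "0 < T" and t: "0 < t" and s: "1 \<le> s"
  shows "(\<integral>\<^sup>+ i. ennreal (dyad i powr - s) * indicator {i. t < T * dyad i} i \<partial>count_space UNIV)
    \<le> ennreal (2 * T powr s * t powr - s)"
proof -
  define l where "l = \<lfloor>log 2 (t / T)\<rfloor> + 1"
  have l: "t / T < dyad l" using t T dyad_less_iff[of "t / T" l] unfolding l_def by simp
  have sub: "l \<le> i" if "t < T * dyad i" for i
  proof -
    have "t / T < dyad i" using that T by (simp add: field_simps)
    then have "log 2 (t / T) < i" using dyad_less_iff[of "t / T" i] t T by simp
    then show ?thesis unfolding l_def by linarith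
  qed
  define q where "q = (2::real) powr - s"
  have q: "0 < q" "q \<le> 1 / 2"
  proof -
    have "(2::real) powr - s \<le> 2 powr - 1" using s by (intro powr_mono) auto
    then show "q \<le> 1 / 2" by (simp add: q_def powr_minus)
  qed (simp add: q_def)
  have bij: "bij_betw (\<lambda>n. l + int n) UNIV {l..}"
    by (rule bij_betwI[where g = "\<lambda>i. nat (i - l)"]) auto
  have "(\<integral>\<^sup>+ i. ennreal (dyad i powr - s) * indicator {i. t < T * dyad i} i \<partial>count_space UNIV)
    \<le> (\<integral>\<^sup>+ i. ennreal (dyad i powr - s) * indicator {l..} i \<partial>count_space UNIV)"
    using sub by (intro nn_integral_mono) (auto split: split_indicator)
  also have "\<dots> = (\<integral>\<^sup>+ i. ennreal (dyad i powr - s) \<partial>count_space {l..})"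
    by (simp add: nn_integral_count_space_indicator)
  also have "\<dots> = (\<integral>\<^sup>+ n. ennreal (dyad (l + int n) powr - s) \<partial>count_space UNIV)"
    using nn_integral_bij_count_space[OF bij, of "\<lambda>i. ennreal (dyad i powr - s)"] by simp
  also have "\<dots> = (\<Sum>n. ennreal (dyad l powr - s * q ^ n))"
    by (subst nn_integral_count_space_nat, intro arg_cong[where f = suminf] ext arg_cong[where f = ennreal])
      (simp add: q_def powr_powr powr_add powr_realpow[symmetric] powr_mult algebra_simps flip: powr_add)
  also have "\<dots> = ennreal (dyad l powr - s * (1 / (1 - q)))"
  proof (rule suminf_ennreal_eq)
    show "(\<lambda>n. dyad l powr - s * q ^ n) sums (dyad l powr - s * (1 / (1 - q)))"
      using q by (intro sums_mult geometric_sums) auto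
  qed (use q in auto)
  also have "\<dots> \<le> ennreal (2 * T powr s * t powr - s)"
  proof (rule ennreal_leI)
    have "dyad l powr - s \<le> (t / T) powr - s" using l t T s by (intro powr_mono2') auto
    also have "\<dots> = T powr s * t powr - s" using t T by (simp add: powr_divide powr_minus field_simps)
    finally have "dyad l powr - s * (1 / (1 - q)) \<le> (T powr s * t powr - s) * 2"
      using q by (intro mult_mono) (auto simp: field_simps)
    then show "dyad l powr - s * (1 / (1 - q)) \<le> 2 * T powr s * t powr - s" by simp
  qed
  finally show ?thesis .
qed

lemma ennreal_absorb_half:
  assumes "H \<le> x + y" "y \<le> ennreal (1 / 2) * H" "H < (\<infinity>::ennreal)"
  shows "H \<le> 2 * x"
proof (cases "x = top")
  case False
  then obtain a where a: "x = ennreal a" "0 \<le> a" by (cases x) auto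
  obtain h where h: "H = ennreal h" "0 \<le> h" using assms(3) by (cases H) auto
  have "H \<le> x + ennreal (1 / 2) * H" using assms(1,2) by (meson add_left_mono order_trans)
  moreover have "ennreal a + ennreal (1 / 2) * ennreal h = ennreal (a + 1 / 2 * h)"
    using a(2) h(2) by (subst ennreal_mult[symmetric]) auto
  ultimately have "ennreal h \<le> ennreal (a + 1 / 2 * h)" unfolding a(1) h(1) by simp
  then have "h \<le> a + 1 / 2 * h" using a(2) h(2) by (subst (asm) ennreal_le_iff) auto
  then have "h \<le> 2 * a" by simp
  then have "ennreal h \<le> ennreal (2 * a)" by (rule ennreal_leI)
  then show ?thesis using a by (simp add: h(1) ennreal_mult)
qed simp

context hardy_setting
begin

lemma vol_small: "0 < r \<Longrightarrow> r \<le> 1 \<Longrightarrow> vol r \<le> r powr \<eta> / C_o * vol 1"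
  using vol_growth[of r 1] by simp

lemma center_sets: "{z} \<in> sets m"
proof -
  have "x = z" if "x \<in> X" "d z x \<le> 0" for x
  proof -
    have "d z x = 0" using nonneg[of z x] that(2) by linarith
    then show ?thesis using zero[of z x] z that(1) by blast
  qed
  then have "mcball z 0 = {z}" using z by (auto simp: in_mcball)
  then show ?thesis using closedin_sets_borel_X[OF closedin_mcball, of z 0] sets_borel_X_subset by auto
qed

text \<open>
  Reverse volume growth with a positive exponent rules out an atom at \<open>z\<close>, so the singularity of
  the Hardy weight at \<open>z\<close> is never seen by the integrals. In the weight
  \<open>d z x powr - s\<close> the value at \<open>z\<close> is \<open>0\<close>.
\<close>

lemma null_center: "emeasure m {z} = 0"
proof -
  have "measure m {z} \<le> 0"
  proof (rule LIMSEQ_le_const[of "\<lambda>n. vol 1 / C_o * (1 / real (Suc n)) powr \<eta>"])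
    have "(\<lambda>n. (1 / real (Suc n)) powr \<eta>) \<longlonglongrightarrow> 0"
      using p ps s\<eta> LIMSEQ_inverse_real_of_nat
      by (intro tendsto_zero_powrI[where b = \<eta>]) (auto simp: inverse_eq_divide)
    then show "(\<lambda>n. vol 1 / C_o * (1 / real (Suc n)) powr \<eta>) \<longlonglongrightarrow> 0"
      using tendsto_mult_right_zero by blast
    show "\<exists>N. \<forall>n\<ge>N. measure m {z} \<le> vol 1 / C_o * (1 / real (Suc n)) powr \<eta>"
    proof (intro exI allI impI)
      fix n :: nat
      have "measure m {z} \<le> vol (1 / real (Suc n))"
        using z center_sets by (intro measure_mono_mball) (auto simp: in_mball)
      also have "\<dots> \<le> (1 / real (Suc n)) powr \<eta> / C_o * vol 1" by (intro vol_small) auto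
      finally show "measure m {z} \<le> vol 1 / C_o * (1 / real (Suc n)) powr \<eta>" by (simp add: mult.commute)
    qed
  qed
  then have "measure m {z} = 0" using measure_nonneg[of m "{z}"] by linarith
  moreover have "{z} \<in> fmeasurable m" using center_sets z by (intro fmeasurable_subset_mball[of _ z 1]) (auto simp: in_mball)
  ultimately show ?thesis by (simp add: emeasure_eq_measure2)
qed

lemma AE_off_center: "AE x in m. 0 < d z x"
proof -
  have "AE x in m. x \<noteq> z" using null_center z
    by (intro AE_I[of _ _ "{z}"] center_sets) auto
  then show ?thesis using AE_space by eventually_elim (use z in \<open>auto simp: space_m\<close>)
qed

end

context hardy_scales
begin

lemma shell_decomposition:
  assumes [measurable]: "k \<in> borel_measurable m"
  shows "(\<integral>\<^sup>+ x. k x * ennreal (d z x powr - s) \<partial>m)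
    \<le> (\<integral>\<^sup>+ i. ennreal (dyad i powr - s) * (\<integral>\<^sup>+ x \<in> shell (dyad i). k x \<partial>m) \<partial>count_space UNIV)"
proof -
  have "(\<integral>\<^sup>+ x. k x * ennreal (d z x powr - s) \<partial>m)
    \<le> (\<integral>\<^sup>+ x. (\<integral>\<^sup>+ i. ennreal (dyad i powr - s) * (k x * indicator (shell (dyad i)) x) \<partial>count_space UNIV) \<partial>m)"
  proof (rule nn_integral_mono)
    fix x assume "x \<in> space m"
    then have x: "x \<in> X" by (simp add: space_m)
    show "k x * ennreal (d z x powr - s) \<le> (\<integral>\<^sup>+ i. ennreal (dyad i powr - s) * (k x * indicator (shell (dyad i)) x) \<partial>count_space UNIV)"
    proof (cases "d z x = 0")
      case False
      then have "0 < d z x" using nonneg[of z x] by linarith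
      then obtain i where i: "dyad i \<le> d z x" "d z x < 2 * dyad i" by (rule dyad_bracket)
      have "d z x powr - s \<le> dyad i powr - s" using i p ps by (intro powr_mono2') auto
      then have "k x * ennreal (d z x powr - s) \<le> ennreal (dyad i powr - s) * (k x * indicator (shell (dyad i)) x)"
        using x i by (simp add: shell_def mult.commute mult_left_mono ennreal_leI)
      also have "\<dots> \<le> (\<integral>\<^sup>+ i. ennreal (dyad i powr - s) * (k x * indicator (shell (dyad i)) x) \<partial>count_space UNIV)"
        using nn_integral_ge_point[of i UNIV "\<lambda>i. ennreal (dyad i powr - s) * (k x * indicator (shell (dyad i)) x)"] by simp
      finally show ?thesis .
    qed simp
  qed
  also have "\<dots> = (\<integral>\<^sup>+ i. ennreal (dyad i powr - s) * (\<integral>\<^sup>+ x \<in> shell (dyad i). k x \<partial>m) \<partial>count_space UNIV)"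
    by (subst nn_integral_count_space_nn_integral) (auto simp: nn_integral_cmult)
  finally show ?thesis .
qed

lemma dyadic_fubini:
  fixes c :: "int \<Rightarrow> ennreal"
  assumes [measurable]: "k \<in> borel_measurable m" "\<And>i. A i \<in> sets m"
  shows "(\<integral>\<^sup>+ i. c i * (\<integral>\<^sup>+ x \<in> A i. k x \<partial>m) \<partial>count_space UNIV)
    = (\<integral>\<^sup>+ x. k x * (\<integral>\<^sup>+ i. c i * indicator {i. x \<in> A i} i \<partial>count_space UNIV) \<partial>m)"
proof -
  have "(\<integral>\<^sup>+ i. c i * (\<integral>\<^sup>+ x \<in> A i. k x \<partial>m) \<partial>count_space UNIV)
    = (\<integral>\<^sup>+ i. (\<integral>\<^sup>+ x. c i * (k x * indicator (A i) x) \<partial>m) \<partial>count_space UNIV)"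
    by (simp add: nn_integral_cmult)
  also have "\<dots> = (\<integral>\<^sup>+ x. (\<integral>\<^sup>+ i. c i * (k x * indicator (A i) x) \<partial>count_space UNIV) \<partial>m)"
    by (subst nn_integral_count_space_nn_integral) auto
  also have "\<dots> = (\<integral>\<^sup>+ x. k x * (\<integral>\<^sup>+ i. c i * indicator {i. x \<in> A i} i \<partial>count_space UNIV) \<partial>m)"
    by (simp add: nn_integral_cmult[symmetric] indicator_def mult_ac)
  finally show ?thesis .
qed

definition hardy_const :: real where
  "hardy_const =
     2 * (C_D ^ n * (6 powr s * (3 * P powr s + K * T powr s)) * (real (Suc L) * (lam * T) powr s))"

lemma hardy_const_pos: "0 < hardy_const"
proof -
  have "0 \<le> K" using C_D by (simp add: K_def \<kappa>)
  moreover have "1 \<le> P" by (simp add: P_def)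
  ultimately have "0 < 3 * P powr s + K * T powr s" by (intro add_pos_nonneg) auto
  then show ?thesis using C_D lam T by (auto simp: hardy_const_def intro!: mult_pos_pos)
qed

text \<open>
  The estimate at the scales \<open>r = dyad i\<close>, multiplied by \<open>r powr - s\<close> and summed over all
  integers \<open>i\<close>. The annuli overlap boundedly, which produces the weight of the right-hand side.
  The large balls do not, but their sum is geometric and bounded by \<open>2 * T powr s\<close> times the
  left-hand side. Together with the factor \<open>T powr - \<eta>\<close> this is at most half of the left-hand
  side, which is finite, and can be absorbed.
\<close>

lemma weighted_hardy:
  assumes u[measurable]: "u \<in> borel_measurable m" and uN: "\<And>x. x \<in> X \<Longrightarrow> 0 \<le> u x \<and> u x \<le> N"
    and ug: "upper_gradient (\<lambda>x. ereal (u x)) h"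
    and finH: "(\<integral>\<^sup>+ x. ennreal (u x powr p) * ennreal (d z x powr - s) \<partial>m) < \<infinity>"
  shows "(\<integral>\<^sup>+ x. ennreal (u x powr p) * ennreal (d z x powr - s) \<partial>m)
    \<le> ennreal hardy_const * (\<integral>\<^sup>+ x. enn_powr (h x) p * ennreal (d z x powr (p - s)) \<partial>m)"
    (is "?H \<le> _ * ?J")
proof (cases "?J < \<infinity>")
  case False
  have "ennreal hardy_const \<noteq> 0" unfolding ennreal_eq_0_iff using hardy_const_pos by linarith
  moreover have "?J = top" using False by (simp add: not_less top_unique)
  ultimately have "ennreal hardy_const * ?J = top" by (simp only: ennreal_mult_top if_False)
  then show ?thesis by (simp only: top_greatest)
next
  case J: True
  let ?K1 = "C_D ^ n * (6 powr s * (3 * P powr s + K * T powr s))"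
  let ?W = "real (Suc L) * (lam * T) powr s"
  have [measurable]: "h \<in> borel_measurable m"
    using upper_gradient_measurable[OF ug] measurable_borel_X_imp by auto
  have fin: "(\<integral>\<^sup>+ x \<in> mball z R. enn_powr (h x) p \<partial>m) < \<infinity>" for R
  proof -
    define c where "c = (max 1 R) powr (s - p)"
    have "(\<integral>\<^sup>+ x \<in> mball z R. enn_powr (h x) p \<partial>m)
      \<le> (\<integral>\<^sup>+ x. ennreal c * (enn_powr (h x) p * ennreal (d z x powr (p - s))) \<partial>m)"
    proof (rule nn_integral_mono_AE)
      show "AE x in m. enn_powr (h x) p * indicator (mball z R) x
          \<le> ennreal c * (enn_powr (h x) p * ennreal (d z x powr (p - s)))"
        using AE_off_center
      proof eventually_elim
        case (elim x)
        show ?case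
        proof (cases "x \<in> mball z R")
          case True
          have "d z x powr (s - p) \<le> c" unfolding c_def
            using True ps by (intro powr_mono2) (auto simp: in_mball)
          then have "d z x powr (s - p) * d z x powr (p - s) \<le> c * d z x powr (p - s)"
            by (intro mult_right_mono) auto
          moreover have "d z x powr (s - p) * d z x powr (p - s) = 1"
            using elim by (simp flip: powr_add)
          ultimately have "ennreal 1 \<le> ennreal (c * d z x powr (p - s))" by (intro ennreal_leI) simp
          then have "enn_powr (h x) p * 1 \<le> enn_powr (h x) p * (ennreal c * ennreal (d z x powr (p - s)))"
            by (intro mult_left_mono) (auto simp: ennreal_mult c_def)
          then show ?thesis using True by (simp add: mult_ac)
        qed simp
      qed
    qed
    also have "\<dots> = ennreal c * ?J" by (simp add: nn_integral_cmult)
    also have "\<dots> < \<infinity>" using J by (simp add: ennreal_mult_less_top)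
    finally show ?thesis .
  qed
  let ?K2 = "C_D ^ n * (6 powr s * 2 * 4 powr \<eta> / C_o) * T powr - \<eta>"
  have K0: "0 \<le> K" using C_D by (simp add: K_def \<kappa>)
  then have K1: "0 \<le> ?K1" using C_D by simp
  have K2: "0 \<le> ?K2" using C_D C_o by simp
  let ?A = "\<lambda>i. annulus (\<sigma> * (T * dyad i)) (lam * (T * dyad i))"
  let ?B = "\<lambda>i. mball z (T * dyad i)"
  have "?H \<le> (\<integral>\<^sup>+ i. ennreal (dyad i powr - s) * (\<integral>\<^sup>+ x \<in> shell (dyad i). ennreal (u x powr p) \<partial>m) \<partial>count_space UNIV)"
    by (rule shell_decomposition) auto
  also have "\<dots> \<le> (\<integral>\<^sup>+ i. ennreal ?K1 * (ennreal (dyad i powr - (s - p)) * (\<integral>\<^sup>+ y \<in> ?A i. enn_powr (h y) p \<partial>m))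
      + ennreal ?K2 * (ennreal (dyad i powr - s) * (\<integral>\<^sup>+ y \<in> ?B i. ennreal (u y powr p) \<partial>m)) \<partial>count_space UNIV)"
  proof (rule nn_integral_mono)
    fix i :: int
    have "ennreal (dyad i powr - s) * (\<integral>\<^sup>+ x \<in> shell (dyad i). ennreal (u x powr p) \<partial>m)
      \<le> ennreal (dyad i powr - s) * (ennreal (?K1 * dyad i powr p) * (\<integral>\<^sup>+ y \<in> ?A i. enn_powr (h y) p \<partial>m)
        + ennreal ?K2 * (\<integral>\<^sup>+ y \<in> ?B i. ennreal (u y powr p) \<partial>m))"
      by (intro mult_left_mono single_scale[OF _ u uN ug fin]) auto
    also have "\<dots> = (ennreal (dyad i powr - s) * ennreal (?K1 * dyad i powr p)) * (\<integral>\<^sup>+ y \<in> ?A i. enn_powr (h y) p \<partial>m)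
        + ennreal ?K2 * (ennreal (dyad i powr - s) * (\<integral>\<^sup>+ y \<in> ?B i. ennreal (u y powr p) \<partial>m))"
      by (simp only: distrib_left mult_ac)
    also have "ennreal (dyad i powr - s) * ennreal (?K1 * dyad i powr p) = ennreal ?K1 * ennreal (dyad i powr - (s - p))"
    proof -
      have "dyad i powr - s * dyad i powr p = dyad i powr - (s - p)" by (simp flip: powr_add)
      then have "dyad i powr - s * (?K1 * dyad i powr p) = ?K1 * dyad i powr - (s - p)"
        by (metis mult.left_commute)
      then show ?thesis using K1 by (metis ennreal_mult' ennreal_mult'' powr_ge_zero)
    qed
    finally show "ennreal (dyad i powr - s) * (\<integral>\<^sup>+ x \<in> shell (dyad i). ennreal (u x powr p) \<partial>m)
      \<le> ennreal ?K1 * (ennreal (dyad i powr - (s - p)) * (\<integral>\<^sup>+ y \<in> ?A i. enn_powr (h y) p \<partial>m))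
        + ennreal ?K2 * (ennreal (dyad i powr - s) * (\<integral>\<^sup>+ y \<in> ?B i. ennreal (u y powr p) \<partial>m))"
      by (simp only: mult.assoc)
  qed
  also have "\<dots> = ennreal ?K1 * (\<integral>\<^sup>+ i. ennreal (dyad i powr - (s - p)) * (\<integral>\<^sup>+ y \<in> ?A i. enn_powr (h y) p \<partial>m) \<partial>count_space UNIV)
      + ennreal ?K2 * (\<integral>\<^sup>+ i. ennreal (dyad i powr - s) * (\<integral>\<^sup>+ y \<in> ?B i. ennreal (u y powr p) \<partial>m) \<partial>count_space UNIV)"
    by (subst nn_integral_add) (simp_all only: nn_integral_cmult borel_measurable_count_space)
  also have "\<dots> \<le> ennreal ?K1 * (ennreal ?W * ?J) + ennreal ?K2 * (ennreal (2 * T powr s) * ?H)"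
  proof (intro add_mono mult_left_mono)
    have "(\<integral>\<^sup>+ i. ennreal (dyad i powr - (s - p)) * (\<integral>\<^sup>+ y \<in> ?A i. enn_powr (h y) p \<partial>m) \<partial>count_space UNIV)
      = (\<integral>\<^sup>+ x. enn_powr (h x) p * (\<integral>\<^sup>+ i. ennreal (dyad i powr - (s - p)) * indicator {i. x \<in> ?A i} i \<partial>count_space UNIV) \<partial>m)"
      by (rule dyadic_fubini) auto
    also have "\<dots> \<le> (\<integral>\<^sup>+ x. ennreal ?W * (enn_powr (h x) p * ennreal (d z x powr (p - s))) \<partial>m)"
    proof (rule nn_integral_mono)
      fix x assume "x \<in> space m"
      then have x: "x \<in> X" by (simp add: space_m)
      have "(\<integral>\<^sup>+ i. ennreal (dyad i powr - (s - p)) * indicator {i. x \<in> ?A i} i \<partial>count_space UNIV)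
        = (\<integral>\<^sup>+ i. ennreal (dyad i powr - (s - p)) * indicator {i. (\<sigma> * T) * dyad i < d z x \<and> d z x < (lam * T) * dyad i} i \<partial>count_space UNIV)"
        using x by (simp add: annulus_def mult.assoc)
      also have "\<dots> \<le> ennreal (real (Suc L) * (lam * T) powr s * d z x powr - (s - p))"
      proof (rule dyadic_window_sum)
        show "0 < \<sigma> * T" using \<sigma> T by simp
        have "1 * 1 \<le> lam * T" using lam T by (intro mult_mono) auto
        then show "1 \<le> lam * T" by simp
        show "lam * T / (\<sigma> * T) \<le> 2 ^ L" using L T by simp
      qed (use p ps in auto)
      also have "\<dots> = ennreal ?W * ennreal (d z x powr (p - s))" by (simp add: ennreal_mult'' del: of_nat_Suc)
      finally show "enn_powr (h x) p * (\<integral>\<^sup>+ i. ennreal (dyad i powr - (s - p)) * indicator {i. x \<in> ?A i} i \<partial>count_space UNIV)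
        \<le> ennreal ?W * (enn_powr (h x) p * ennreal (d z x powr (p - s)))"
        by (subst mult.left_commute) (rule mult_left_mono, auto)
    qed
    also have "\<dots> = ennreal ?W * ?J" by (simp add: nn_integral_cmult)
    finally show "(\<integral>\<^sup>+ i. ennreal (dyad i powr - (s - p)) * (\<integral>\<^sup>+ y \<in> ?A i. enn_powr (h y) p \<partial>m) \<partial>count_space UNIV) \<le> ennreal ?W * ?J" .
    have "(\<integral>\<^sup>+ i. ennreal (dyad i powr - s) * (\<integral>\<^sup>+ y \<in> ?B i. ennreal (u y powr p) \<partial>m) \<partial>count_space UNIV)
      = (\<integral>\<^sup>+ x. ennreal (u x powr p) * (\<integral>\<^sup>+ i. ennreal (dyad i powr - s) * indicator {i. x \<in> ?B i} i \<partial>count_space UNIV) \<partial>m)"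
      by (rule dyadic_fubini) auto
    also have "\<dots> \<le> (\<integral>\<^sup>+ x. ennreal (2 * T powr s) * (ennreal (u x powr p) * ennreal (d z x powr - s)) \<partial>m)"
    proof (rule nn_integral_mono_AE)
      show "AE x in m. ennreal (u x powr p) * (\<integral>\<^sup>+ i. ennreal (dyad i powr - s) * indicator {i. x \<in> ?B i} i \<partial>count_space UNIV)
          \<le> ennreal (2 * T powr s) * (ennreal (u x powr p) * ennreal (d z x powr - s))"
        using AE_off_center AE_space
      proof eventually_elim
        case (elim x)
        then have x: "x \<in> X" by (simp add: space_m)
        have "(\<integral>\<^sup>+ i. ennreal (dyad i powr - s) * indicator {i. x \<in> ?B i} i \<partial>count_space UNIV)
          = (\<integral>\<^sup>+ i. ennreal (dyad i powr - s) * indicator {i. d z x < T * dyad i} i \<partial>count_space UNIV)"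
          using x z by (simp add: in_mball)
        also have "\<dots> \<le> ennreal (2 * T powr s * d z x powr - s)"
          using T elim p ps by (intro dyadic_tail_sum) auto
        also have "\<dots> = ennreal (2 * T powr s) * ennreal (d z x powr - s)" by (simp add: ennreal_mult'')
        finally show ?case by (subst mult.left_commute) (rule mult_left_mono, auto)
      qed
    qed
    also have "\<dots> = ennreal (2 * T powr s) * ?H" by (simp add: nn_integral_cmult)
    finally show "(\<integral>\<^sup>+ i. ennreal (dyad i powr - s) * (\<integral>\<^sup>+ y \<in> ?B i. ennreal (u y powr p) \<partial>m) \<partial>count_space UNIV) \<le> ennreal (2 * T powr s) * ?H" .
  qed auto
  finally have main: "?H \<le> ennreal ?K1 * (ennreal ?W * ?J) + ennreal ?K2 * (ennreal (2 * T powr s) * ?H)" .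
  have "?H \<le> 2 * (ennreal ?K1 * (ennreal ?W * ?J))"
  proof (rule ennreal_absorb_half[OF main _ finH])
    have "ennreal ?K2 * (ennreal (2 * T powr s) * ?H) = ennreal (?K2 * (2 * T powr s)) * ?H"
      by (subst ennreal_mult'[OF K2]) (simp only: mult.assoc)
    also have "\<dots> \<le> ennreal (1 / 2) * ?H" by (intro mult_right_mono ennreal_leI absorb) auto
    finally show "ennreal ?K2 * (ennreal (2 * T powr s) * ?H) \<le> ennreal (1 / 2) * ?H" .
  qed
  also have "\<dots> = ennreal hardy_const * ?J"
  proof -
    have "ennreal (2 * (?K1 * ?W)) = ennreal 2 * (ennreal ?K1 * ennreal ?W)"
      by (subst ennreal_mult'[OF zero_le_numeral], subst ennreal_mult'[OF K1]) (rule refl)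
    then show ?thesis unfolding hardy_const_def by (simp only: mult.assoc ennreal_numeral)
  qed
  finally show ?thesis .
qed

end

section \<open>Auxiliary weights and Borel majorants\<close>

text \<open>
  Young's inequality with a constant that does not depend on \<open>p\<close>; one of the two terms on the
  right dominates according to whether \<open>y powr p\<close> is at most \<open>\<tau> * x powr p\<close>.
\<close>

lemma young_split:
  fixes x :: real and y :: ennreal
  assumes \<tau>: "0 < \<tau>" "\<tau> \<le> 1" and x: "0 \<le> x" and p: "1 \<le> p" "p \<le> s"
  shows "ennreal (x powr (s - p)) * enn_powr y p \<le> ennreal (\<tau> * x powr s) + ennreal (\<tau> powr - s) * enn_powr y s"
proof (cases y)
  case top
  then show ?thesis using \<tau> by (simp add: ennreal_mult_top)
next
  case (real r)
  have "x powr (s - p) * r powr p \<le> \<tau> * x powr s + \<tau> powr - s * r powr s"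
  proof (cases "r powr p \<le> \<tau> * x powr p")
    case True
    then have "x powr (s - p) * r powr p \<le> x powr (s - p) * (\<tau> * x powr p)" by (intro mult_left_mono) auto
    also have "\<dots> = \<tau> * (x powr (s - p) * x powr p)" by simp
    also have "x powr (s - p) * x powr p = x powr s" by (simp flip: powr_add)
    finally show ?thesis by (simp add: add_increasing2)
  next
    case False
    then have *: "\<tau> * x powr p < r powr p" by simp
    have "x \<le> r / \<tau>"
    proof (rule ccontr)
      assume "\<not> ?thesis"
      then have "r < \<tau> * x" using \<tau> by (simp add: field_simps)
      then have "r powr p \<le> (\<tau> * x) powr p" using real p by (intro powr_mono2) auto
      also have "\<dots> = \<tau> powr p * x powr p" using \<tau> x by (simp add: powr_mult)
      also have "\<dots> \<le> \<tau> * x powr p"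
        using powr_mono'[of 1 p \<tau>] \<tau> p by (intro mult_right_mono) auto
      finally show False using * by simp
    qed
    then have "x powr (s - p) \<le> (r / \<tau>) powr (s - p)" using x p by (intro powr_mono2) auto
    also have "\<dots> = r powr (s - p) / \<tau> powr (s - p)" using \<tau> real by (simp add: powr_divide)
    also have "\<dots> = \<tau> powr - (s - p) * r powr (s - p)" by (subst powr_minus) (simp add: divide_inverse)
    also have "\<dots> \<le> \<tau> powr - s * r powr (s - p)"
      using \<tau> p by (intro mult_right_mono powr_mono') auto
    finally have "x powr (s - p) * r powr p \<le> \<tau> powr - s * r powr (s - p) * r powr p"
      by (intro mult_right_mono) auto
    also have "\<dots> = \<tau> powr - s * r powr s" by (simp add: mult.assoc flip: powr_add)
    finally show ?thesis using \<tau> by (simp add: add_increasing)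
  qed
  then show ?thesis using real x \<tau> by (simp flip: ennreal_mult ennreal_plus)
qed

lemma ennreal_le_suminf: "(f n :: ennreal) \<le> (\<Sum>n. f n)"
  using sum_le_suminf[of f "{n}"] by simp

lemma enn_powr_tendsto_0:
  assumes X: "X \<longlonglongrightarrow> 0" and s: "0 < s"
  shows "(\<lambda>i. enn_powr (X i) s) \<longlonglongrightarrow> 0"
proof (rule order_tendstoI)
  fix a :: ennreal assume "0 < a"
  then obtain b where b: "0 < b" "b < a" using dense by blast
  then obtain e where e: "b = ennreal e" "0 < e" by (cases b) (auto simp: top_unique)
  have "eventually (\<lambda>i. X i < ennreal (e powr (1 / s))) sequentially"
    using X e by (intro order_tendstoD) auto
  then show "eventually (\<lambda>i. enn_powr (X i) s < a) sequentially"
  proof eventually_elim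
    case (elim i)
    have "enn_powr (X i) s \<le> enn_powr (ennreal (e powr (1 / s))) s"
      using elim s by (intro enn_powr_mono) auto
    also have "\<dots> = b" using e s by (simp add: powr_powr)
    finally show ?case using b by order
  qed
qed simp

context metric_measure_space
begin

lemma in_some_ball:
  assumes "z \<in> X" "x \<in> X" obtains k :: nat where "x \<in> mball z (real k)"
proof -
  obtain k :: nat where "d z x < real k" using reals_Archimedean2 by blast
  then show ?thesis using that[of k] assms by (simp add: in_mball)
qed

text \<open>
  Borel regularity gives hulls of equal measure; passing to balls makes the measures finite, so that
  the difference is a null set.
\<close>

lemma borel_hull:
  assumes z: "z \<in> X" and A: "A \<in> sets m"
  obtains B where "B \<in> sets borel_X" "A \<subseteq> B" "B - A \<in> null_sets m"
proof -
  let ?A = "\<lambda>k::nat. A \<inter> mball z (real k)"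
  have "\<exists>B. B \<in> sets borel_X \<and> ?A k \<subseteq> B \<and> emeasure m B = emeasure m (?A k)" for k
    using borel_regular[of "?A k"] A by (auto simp: sets_borel_X)
  then obtain C where C: "\<And>k. C k \<in> sets borel_X" "\<And>k. ?A k \<subseteq> C k"
    "\<And>k. emeasure m (C k) = emeasure m (?A k)" by metis
  have Cm: "C k \<in> sets m" for k using C(1) sets_borel_X_subset by blast
  have null: "C k - ?A k \<in> null_sets m" for k
  proof -
    have fin: "emeasure m (?A k) \<noteq> \<infinity>"
      using A emeasure_mono[of "?A k" "mball z (real k)" m] by (auto simp: emeasure_mball top_unique)
    have "emeasure m (C k - ?A k) = emeasure m (C k) - emeasure m (?A k)"
      using Cm A C(2) fin by (intro emeasure_Diff) auto
    also have "\<dots> = 0" using C(3) fin by simp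
    finally show ?thesis using Cm A by (auto simp: null_sets_def)
  qed
  show ?thesis
  proof (rule that[of "\<Union>k. C k"])
    show "(\<Union>k. C k) \<in> sets borel_X" using C(1) by auto
    have "A \<subseteq> X" using sets.sets_into_space[OF A] by (simp add: space_m)
    show "A \<subseteq> (\<Union>k. C k)"
    proof
      fix x assume x: "x \<in> A"
      then obtain k :: nat where "x \<in> mball z (real k)" using in_some_ball[OF z, of x] \<open>A \<subseteq> X\<close> by blast
      then show "x \<in> (\<Union>k. C k)" using x C(2)[of k] by blast
    qed
    show "(\<Union>k. C k) - A \<in> null_sets m"
    proof (rule null_sets_subset[of "\<Union>k. C k - ?A k"])
      show "(\<Union>k. C k - ?A k) \<in> null_sets m" by (intro null_sets_UN null)
      show "(\<Union>k. C k) - A \<in> sets m" using Cm A by auto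
    qed auto
  qed
qed

text \<open>
  The functions of the theorem are measurable only for the \<open>\<sigma>\<close>-algebra of \<open>m\<close>, whereas
  upper gradients have to be Borel. The majorant takes the place of \<open>F\<close> in the chain rule, where
  only an upper bound is needed everywhere. It is built from Borel hulls of the superlevel sets at
  rational heights.
\<close>

lemma borel_majorant:
  fixes F :: "'a \<Rightarrow> real"
  assumes z: "z \<in> X" and F[measurable]: "F \<in> borel_measurable m" and FN: "\<And>x. x \<in> X \<Longrightarrow> 0 \<le> F x \<and> F x \<le> N"
  obtains G where "G \<in> borel_measurable borel_X" "\<And>x. x \<in> X \<Longrightarrow> F x \<le> G x" "AE x in m. G x = F x"
    "\<And>x. 0 \<le> G x"
proof -
  let ?A = "\<lambda>q::rat. {x \<in> space m. of_rat q < F x}"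
  have "\<exists>B. B \<in> sets borel_X \<and> ?A q \<subseteq> B \<and> B - ?A q \<in> null_sets m" for q
  proof -
    have "?A q \<in> sets m" by measurable
    then show ?thesis by (rule borel_hull[OF z]) blast
  qed
  then have "\<exists>B. \<forall>q. B q \<in> sets borel_X \<and> ?A q \<subseteq> B q \<and> B q - ?A q \<in> null_sets m" by (intro choice allI)
  then obtain B where "\<forall>q. B q \<in> sets borel_X \<and> ?A q \<subseteq> B q \<and> B q - ?A q \<in> null_sets m" ..
  then have B: "B q \<in> sets borel_X" "?A q \<subseteq> B q" "B q - ?A q \<in> null_sets m" for q by auto
  define G where "G = (\<lambda>x. SUP q. ennreal (of_rat q) * indicator (B q) x)"
  have [measurable]: "B q \<in> sets borel_X" for q by (rule B)
  have Gm[measurable]: "G \<in> borel_measurable borel_X" unfolding G_def by measurable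
  have F_le: "ennreal (F x) \<le> G x" if x: "x \<in> X" for x
  proof (rule dense_le)
    fix y assume y: "y < ennreal (F x)"
    then obtain r where r: "y = ennreal r" "0 \<le> r" by (cases y) auto
    then have "r < F x" using y FN[OF x] by (simp add: ennreal_less_iff)
    then obtain q where q: "r < of_rat q" "of_rat q < F x" using of_rat_dense by blast
    then have "x \<in> B q" using B(2)[of q] x by (auto simp: space_m)
    have "y \<le> ennreal (of_rat q) * indicator (B q) x" using r q \<open>x \<in> B q\<close> by (simp add: ennreal_leI)
    also have "\<dots> \<le> G x" unfolding G_def by (intro SUP_upper) auto
    finally show "y \<le> G x" .
  qed
  have "AE x in m. \<forall>q. x \<notin> B q - ?A q"
    unfolding AE_all_countable by (intro allI AE_not_in B(3))
  then have AE_G: "AE x in m. G x \<le> ennreal (F x)"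
    using AE_space
  proof eventually_elim
    case (elim x)
    show "G x \<le> ennreal (F x)" unfolding G_def
    proof (rule SUP_least)
      fix q
      show "ennreal (of_rat q) * indicator (B q) x \<le> ennreal (F x)"
      proof (cases "x \<in> B q")
        case True
        then have "of_rat q < F x" using elim(1) by blast
        then show ?thesis using True by (simp add: ennreal_leI)
      qed simp
    qed
  qed
  define G' where "G' = (\<lambda>x. enn2real (min (G x) (ennreal N)))"
  have eq: "ennreal (G' x) = min (G x) (ennreal N)" for x
    unfolding G'_def by (intro ennreal_enn2real) (auto simp: min_less_iff_disj)
  show ?thesis
  proof (rule that[of G'])
    show "G' \<in> borel_measurable borel_X" unfolding G'_def by measurable
    show "0 \<le> G' x" for x by (simp add: G'_def)
    show le: "F x \<le> G' x" if "x \<in> X" for x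
    proof -
      have "ennreal (F x) \<le> ennreal (G' x)" unfolding eq using F_le[OF that] FN[OF that] by (simp add: ennreal_leI)
      then show ?thesis by (simp add: G'_def)
    qed
    show "AE x in m. G' x = F x"
      using AE_G AE_space
    proof eventually_elim
      case (elim x)
      then have x: "x \<in> X" by (simp add: space_m)
      have "ennreal (G' x) \<le> ennreal (F x)" unfolding eq using elim(1) by (simp add: min.coboundedI1)
      then have "G' x \<le> F x" using FN[OF x] by simp
      then show ?case using le[OF x] by simp
    qed
  qed
qed

lemma curve_bounded:
  assumes "arc_length_curve \<gamma> L" "z \<in> X" "t \<in> {0..L}"
  shows "d z (\<gamma> t) \<le> d z (\<gamma> 0) + L"
proof -
  have "d (\<gamma> 0) (\<gamma> t) \<le> t" using arc_length_curve_lipschitz[OF assms(1), of 0 t] assms(3) by auto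
  moreover have "d z (\<gamma> t) \<le> d z (\<gamma> 0) + d (\<gamma> 0) (\<gamma> t)"
    using assms arc_length_curve_in[OF assms(1)] curve_endpoints[OF assms(1)] by (intro triangle) auto
  ultimately show ?thesis using assms(3) by simp
qed

end

context hardy_setting
begin

text \<open>
  Volume decay of order \<open>\<eta>\<close> at \<open>z\<close> beats the singularity of order \<open>s < \<eta>\<close>.
\<close>

lemma near_center_integrable: "(\<integral>\<^sup>+ x \<in> mball z 1. ennreal (d z x powr - s) \<partial>m) < \<infinity>"
proof -
  define \<theta> where "\<theta> = \<eta> - s"
  define q where "q = (2::real) powr - \<theta>"
  have q: "0 < q" "q < 1" using s\<eta> powr_less_mono[of "- \<theta>" 0 2] by (auto simp: q_def \<theta>_def)
  let ?b = "\<lambda>n::nat. 2 powr - real n"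
  have "(\<integral>\<^sup>+ x \<in> mball z 1. ennreal (d z x powr - s) \<partial>m)
    \<le> (\<integral>\<^sup>+ x. (\<Sum>n. ennreal (2 powr ((real n + 1) * s)) * indicator (mball z (?b n)) x) \<partial>m)"
  proof (rule nn_integral_mono)
    fix x assume "x \<in> space m"
    then have x: "x \<in> X" by (simp add: space_m)
    show "ennreal (d z x powr - s) * indicator (mball z 1) x
       \<le> (\<Sum>n. ennreal (2 powr ((real n + 1) * s)) * indicator (mball z (?b n)) x)"
    proof (cases "0 < d z x \<and> d z x < 1")
      case True
      then obtain i where i: "dyad i \<le> d z x" "d z x < 2 * dyad i" using dyad_bracket[of "d z x"] by auto
      have "dyad i < 2 powr 0" using i True by simp
      then have "i < 0" using powr_less_cancel_iff[of 2 "real_of_int i" 0] by simp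
      define n where "n = nat (- i - 1)"
      have n: "real_of_int i = - (real n + 1)" using \<open>i < 0\<close> by (simp add: n_def)
      have "2 * dyad i = 2 powr (1 + real_of_int i)" by (simp only: powr_add powr_one_gt_zero_iff) simp
      also have "1 + real_of_int i = - real n" unfolding n by simp
      finally have "2 * dyad i = ?b n" .
      then have xb: "x \<in> mball z (?b n)" using i x z by (simp add: in_mball)
      have "d z x powr - s \<le> dyad i powr - s" using i p ps by (intro powr_mono2') auto
      also have "\<dots> = 2 powr ((real n + 1) * s)" 
      proof -
        have "real_of_int i * - s = (real n + 1) * s" unfolding n by (simp add: algebra_simps)
        then show ?thesis by (simp only: powr_powr)
      qed
      finally have "ennreal (d z x powr - s) * indicator (mball z 1) x
          \<le> ennreal (2 powr ((real n + 1) * s)) * indicator (mball z (?b n)) x"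
        using xb x z True by (simp add: in_mball ennreal_leI)
      also have "\<dots> \<le> (\<Sum>n. ennreal (2 powr ((real n + 1) * s)) * indicator (mball z (?b n)) x)"
        by (rule ennreal_le_suminf[of "\<lambda>n. ennreal (2 powr ((real n + 1) * s)) * indicator (mball z (?b n)) x"])
      finally show ?thesis .
    next
      case False
      then have "d z x = 0 \<or> x \<notin> mball z 1" using nonneg[of z x] by (auto simp: in_mball)
      moreover have "ennreal (t powr - s) = 0" if "t = 0" for t :: real using that by simp
      ultimately have "ennreal (d z x powr - s) * indicator (mball z 1) x = 0" by fastforce
      then show ?thesis by (simp only: zero_le)
    qed
  qed
  also have "\<dots> = (\<Sum>n. ennreal (2 powr ((real n + 1) * s)) * ennreal (vol (?b n)))"
    by (subst nn_integral_suminf) (simp_all add: nn_integral_cmult_indicator emeasure_mball)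
  also have "\<dots> \<le> (\<Sum>n. ennreal (2 powr s * (vol 1 / C_o) * q ^ n))"
  proof (rule suminf_le)
    fix n
    have "vol (?b n) \<le> ?b n powr \<eta> / C_o * vol 1"
      by (intro vol_small) (auto simp: powr_minus_divide ge_one_powr_ge_zero)
    then have "2 powr ((real n + 1) * s) * vol (?b n) \<le> 2 powr ((real n + 1) * s) * (?b n powr \<eta> / C_o * vol 1)"
      by (intro mult_left_mono) auto
    also have "\<dots> = 2 powr s * (vol 1 / C_o) * (2 powr (real n * s) * 2 powr (- real n * \<eta>))"
      by (simp add: powr_powr distrib_right powr_add)
    also have "2 powr (real n * s) * 2 powr (- real n * \<eta>) = q ^ n"
    proof -
      have "q ^ n = q powr real n" using q by (simp add: powr_realpow)
      also have "\<dots> = 2 powr (- \<theta> * real n)" by (simp only: q_def powr_powr)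
      also have "- \<theta> * real n = real n * s + - real n * \<eta>" by (simp add: \<theta>_def algebra_simps)
      finally show ?thesis by (simp only: powr_add)
    qed
    finally have "ennreal (2 powr ((real n + 1) * s) * vol (?b n)) \<le> ennreal (2 powr s * (vol 1 / C_o) * q ^ n)"
      by (rule ennreal_leI)
    then show "ennreal (2 powr ((real n + 1) * s)) * ennreal (vol (?b n)) \<le> ennreal (2 powr s * (vol 1 / C_o) * q ^ n)"
      by (simp only: ennreal_mult' powr_ge_zero)
  qed auto
  also have "\<dots> < \<infinity>"
  proof -
    have "summable (\<lambda>n. 2 powr s * (vol 1 / C_o) * q ^ n)"
      using q by (intro summable_mult summable_geometric) auto
    moreover have "0 \<le> 2 powr s * (vol 1 / C_o) * q ^ n" for n using q C_o by simp
    ultimately have "(\<Sum>n. ennreal (2 powr s * (vol 1 / C_o) * q ^ n))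
        = ennreal (\<Sum>n. 2 powr s * (vol 1 / C_o) * q ^ n)"
      by (intro suminf_ennreal2)
    then show ?thesis by simp
  qed
  finally show ?thesis .
qed

lemma hardy_integral_finite:
  assumes [measurable]: "k \<in> borel_measurable m" and kM: "\<And>x. x \<in> X \<Longrightarrow> k x \<le> ennreal M"
    and k: "(\<integral>\<^sup>+ x. k x \<partial>m) < \<infinity>"
  shows "(\<integral>\<^sup>+ x. k x * ennreal (d z x powr - s) \<partial>m) < \<infinity>"
proof -
  have "(\<integral>\<^sup>+ x. k x * ennreal (d z x powr - s) \<partial>m)
    \<le> (\<integral>\<^sup>+ x. ennreal M * (ennreal (d z x powr - s) * indicator (mball z 1) x) + k x \<partial>m)"
  proof (rule nn_integral_mono)
    fix x assume "x \<in> space m"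
    then have x: "x \<in> X" by (simp add: space_m)
    show "k x * ennreal (d z x powr - s) \<le> ennreal M * (ennreal (d z x powr - s) * indicator (mball z 1) x) + k x"
    proof (cases "d z x < 1")
      case True
      then have "k x * ennreal (d z x powr - s) \<le> ennreal M * (ennreal (d z x powr - s) * indicator (mball z 1) x)"
        using x z kM[OF x] by (auto simp: in_mball intro!: mult_right_mono)
      then show ?thesis by (simp add: add_increasing2)
    next
      case False
      then have "d z x powr - s \<le> 1" using p ps powr_mono2'[of "- s" 1 "d z x"] by simp
      then have "k x * ennreal (d z x powr - s) \<le> k x * 1" by (intro mult_left_mono) (auto simp: ennreal_le_1)
      then show ?thesis by (simp add: add_increasing)
    qed
  qed
  also have "\<dots> = ennreal M * (\<integral>\<^sup>+ x \<in> mball z 1. ennreal (d z x powr - s) \<partial>m) + (\<integral>\<^sup>+ x. k x \<partial>m)"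
    by (simp add: nn_integral_add nn_integral_cmult)
  also have "\<dots> < \<infinity>" using k near_center_integrable by (simp add: ennreal_mult_less_top)
  finally show ?thesis .
qed

text \<open>
  A function with finite Hardy integral that is bounded away from \<open>0\<close> on bounded sets. Small
  multiples of it supply the excess required by \<open>upper_gradient_powr\<close>. Its power of order
  \<open>s\<close> is a superposition of indicators of balls around \<open>z\<close> with weights that make it both
  bounded and integrable.
\<close>

lemma positive_weight:
  obtains w where "w \<in> borel_measurable borel_X" "\<And>x. 0 \<le> w x"
    "\<And>R. \<exists>c>0. \<forall>x\<in>X. d z x \<le> R \<longrightarrow> c \<le> w x"
    "(\<integral>\<^sup>+ x. ennreal (w x powr s) * ennreal (d z x powr - s) \<partial>m) < \<infinity>"
proof -
  define a where "a = (\<lambda>n::nat. (1 / 2) ^ n / (1 + vol (real n)))"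
  have a: "0 < a n" "a n \<le> (1 / 2) ^ n" "a n * vol (real n) \<le> (1 / 2) ^ n" for n
  proof -
    have v: "0 < 1 + vol (real n)" "0 \<le> vol (real n)"
      by (rule add_pos_nonneg[OF zero_less_one measure_nonneg]) (rule measure_nonneg)
    show "0 < a n" unfolding a_def by (rule divide_pos_pos[OF _ v(1)]) simp
    have "(1 / 2) ^ n * 1 \<le> (1 / 2) ^ n * (1 + vol (real n))" using v by (intro mult_left_mono) auto
    then show "a n \<le> (1 / 2) ^ n" unfolding a_def using v(1) by (simp add: pos_divide_le_eq)
    have "(1 / 2) ^ n * vol (real n) \<le> (1 / 2) ^ n * (1 + vol (real n))" using v by (intro mult_left_mono) auto
    then show "a n * vol (real n) \<le> (1 / 2) ^ n" unfolding a_def using v(1) by (simp add: pos_divide_le_eq)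
  qed
  define W where "W = (\<lambda>x. \<Sum>n. ennreal (a n) * indicator (mball z (real n)) x)"
  have geo: "(\<Sum>n. ennreal ((1 / 2) ^ n)) = ennreal 2"
    by (rule suminf_ennreal_eq) (use geometric_sums[of "1 / 2 :: real"] in auto)
  have [measurable]: "mball z r \<in> sets borel_X" for r by (intro openin_sets_borel_X) auto
  have Wb[measurable]: "W \<in> borel_measurable borel_X" unfolding W_def by measurable
  then have [measurable]: "W \<in> borel_measurable m" by (rule measurable_borel_X_imp)
  have W2: "W x \<le> ennreal 2" for x
  proof -
    have "W x \<le> (\<Sum>n. ennreal ((1 / 2) ^ n))" unfolding W_def
      using a by (intro suminf_le) (auto intro!: ennreal_leI split: split_indicator)
    then show ?thesis using geo by simp
  qed
  have intW: "(\<integral>\<^sup>+ x. W x \<partial>m) \<le> ennreal 2"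
  proof -
    have "(\<integral>\<^sup>+ x. W x \<partial>m) = (\<Sum>n. ennreal (a n) * ennreal (vol (real n)))"
      unfolding W_def by (subst nn_integral_suminf) (simp_all add: nn_integral_cmult_indicator emeasure_mball)
    also have "\<dots> \<le> (\<Sum>n. ennreal ((1 / 2) ^ n))"
      using a less_imp_le[OF a(1)] by (intro suminf_le) (auto simp flip: ennreal_mult intro!: ennreal_leI)
    finally show ?thesis using geo by simp
  qed
  define w where "w = (\<lambda>x. enn2real (W x) powr (1 / s))"
  have s: "0 < s" using p ps by simp
  have ws: "ennreal (w x powr s) = W x" for x
  proof -
    have "W x < top" using W2[of x] by (rule le_less_trans) simp
    then show ?thesis using s by (simp add: w_def powr_powr)
  qed
  show ?thesis
  proof (rule that[of w])
    show "w \<in> borel_measurable borel_X" unfolding w_def by measurable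
    show "0 \<le> w x" for x by (simp add: w_def)
    show "\<exists>c>0. \<forall>x\<in>X. d z x \<le> R \<longrightarrow> c \<le> w x" for R
    proof -
      obtain n :: nat where n: "R < real n" using reals_Archimedean2 by blast
      have "a n powr (1 / s) \<le> w x" if x: "x \<in> X" "d z x \<le> R" for x
      proof -
        have "ennreal (a n) = ennreal (a n) * indicator (mball z (real n)) x" using x n z by (simp add: in_mball)
        also have "\<dots> \<le> W x" unfolding W_def
          by (rule ennreal_le_suminf[of "\<lambda>n. ennreal (a n) * indicator (mball z (real n)) x"])
        finally have "enn2real (ennreal (a n)) \<le> enn2real (W x)"
          using W2[of x] by (intro enn2real_mono) (auto intro: le_less_trans)
        then have "a n \<le> enn2real (W x)" using a(1)[of n] by simp
        then show ?thesis unfolding w_def using s less_imp_le[OF a(1)] by (intro powr_mono2) auto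
      qed
      moreover have "0 < a n powr (1 / s)" using a(1)[of n] by simp
      ultimately show ?thesis by blast
    qed
    show "(\<integral>\<^sup>+ x. ennreal (w x powr s) * ennreal (d z x powr - s) \<partial>m) < \<infinity>"
      unfolding ws
    proof (rule hardy_integral_finite[where M = 2])
      show "(\<integral>\<^sup>+ x. W x \<partial>m) < \<infinity>" using intW by (rule le_less_trans) simp
    qed (use W2 in auto)
  qed
qed

end

section \<open>From exponent p to exponent s, and to the Cheeger energy\<close>

context hardy_scales
begin

text \<open>
  Small enough for the Young term that contains the Hardy integral to be at most half of it.
\<close>

definition young_param :: real where
  "young_param = 1 / (2 * hardy_const * s powr s * 2 powr s + 1)"

definition strong_const :: real where
  "strong_const = 2 * (hardy_const * s powr s * young_param powr - s)"

lemma s_ge_1: "1 \<le> s" using p ps by simp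

lemma young_param: "0 < young_param" "young_param \<le> 1"
  "hardy_const * s powr s * young_param * 2 powr s \<le> 1 / 2"
proof -
  let ?A = "hardy_const * s powr s * 2 powr s"
  have A: "0 < ?A" using hardy_const_pos s_ge_1 by simp
  have y: "young_param = 1 / (2 * ?A + 1)" by (simp add: young_param_def mult_ac)
  show "0 < young_param" "young_param \<le> 1" unfolding y using A by auto
  have "?A * young_param \<le> 1 / 2" unfolding y using A by (simp add: field_simps)
  then show "hardy_const * s powr s * young_param * 2 powr s \<le> 1 / 2" by (simp add: mult_ac)
qed

lemma strong_const_pos: "0 < strong_const"
  using hardy_const_pos s_ge_1 young_param by (simp add: strong_const_def)

text \<open>
  Apply \<open>weighted_hardy\<close> to \<open>F powr (s / p)\<close>. By the chain rule its energy density is at most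
  a constant times \<open>F powr (s - p) * g powr p\<close>, and Young's inequality splits this, with its
  weight, into a small multiple of the Hardy integrand of \<open>F\<close> and a multiple of
  \<open>g powr s\<close>. The Hardy integral is finite because \<open>F\<close> is bounded, so the first part can be
  absorbed. The excess \<open>\<epsilon> * w\<close> over \<open>F\<close> that the chain rule requires contributes
  \<open>\<epsilon> powr s\<close> times a fixed finite number, which disappears in the limit.
\<close>

lemma hardy_bounded:
  assumes F[measurable]: "F \<in> borel_measurable m" and FN: "\<And>x. x \<in> X \<Longrightarrow> 0 \<le> F x \<and> F x \<le> N"
    and Fint: "(\<integral>\<^sup>+ x. ennreal (F x powr s) \<partial>m) < \<infinity>"
    and ug: "upper_gradient (\<lambda>x. ereal (F x)) g"
  shows "(\<integral>\<^sup>+ x. ennreal (F x powr s) * ennreal (d z x powr - s) \<partial>m)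
    \<le> ennreal strong_const * (\<integral>\<^sup>+ x. enn_powr (g x) s \<partial>m)"
    (is "?H \<le> _ * ?E")
proof -
  define a where "a = s / p"
  have a: "1 \<le> a" "a * p = s" using p ps by (simp_all add: a_def)
  have a_le: "a \<le> s" using p divide_left_mono[of 1 p s] s_ge_1 by (simp add: a_def)
  have s0: "0 \<le> s" using s_ge_1 by simp
  have [measurable]: "g \<in> borel_measurable m"
    using upper_gradient_measurable[OF ug] measurable_borel_X_imp by auto
  obtain G where Gb: "G \<in> borel_measurable borel_X" and G: "\<And>x. x \<in> X \<Longrightarrow> F x \<le> G x"
    "AE x in m. G x = F x" "\<And>x. 0 \<le> G x"
    using borel_majorant[OF z F FN] by blast
  obtain w where wb: "w \<in> borel_measurable borel_X" and w0: "\<And>x. 0 \<le> w x"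
    and w_low: "\<And>R. \<exists>c>0. \<forall>x\<in>X. d z x \<le> R \<longrightarrow> c \<le> w x"
    and w_int: "(\<integral>\<^sup>+ x. ennreal (w x powr s) * ennreal (d z x powr - s) \<partial>m) < \<infinity>"
    using positive_weight by blast
  have [measurable]: "G \<in> borel_measurable borel_X" "w \<in> borel_measurable borel_X"
    "G \<in> borel_measurable m" "w \<in> borel_measurable m"
    using Gb wb measurable_borel_X_imp by auto
  let ?W = "\<integral>\<^sup>+ x. ennreal (w x powr s) * ennreal (d z x powr - s) \<partial>m"
  let ?\<tau> = young_param
  have H_fin: "?H < \<infinity>"
  proof (rule hardy_integral_finite[where M = "N powr s"])
    fix x assume "x \<in> X"
    then show "ennreal (F x powr s) \<le> ennreal (N powr s)"
      using FN s0 by (intro ennreal_leI powr_mono2) auto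
  qed (use Fint in auto)
  have step: "?H \<le> ennreal strong_const * ?E + ennreal (\<epsilon> powr s) * ?W" if \<epsilon>: "0 < \<epsilon>" for \<epsilon>
  proof -
    define K' where "K' = (\<lambda>x. G x + \<epsilon> * w x)"
    have K0: "0 \<le> K' x" for x using G(3) w0 \<epsilon> by (simp add: K'_def)
    have [measurable]: "K' \<in> borel_measurable m" "K' \<in> borel_measurable borel_X" unfolding K'_def by measurable
    define h where "h = (\<lambda>x. ennreal (a * K' x powr (a - 1)) * g x)"
    have ugF: "upper_gradient (\<lambda>x. ereal (F x powr a)) h"
      unfolding h_def
    proof (rule upper_gradient_powr[OF ug _ a(1)])
      fix \<gamma> l assume \<gamma>: "arc_length_curve \<gamma> l"
      obtain c where c: "0 < c" "\<And>x. x \<in> X \<Longrightarrow> d z x \<le> d z (\<gamma> 0) + l \<Longrightarrow> c \<le> w x"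
        using w_low[of "d z (\<gamma> 0) + l"] by auto
      show "\<exists>c>0. \<forall>t\<in>{0..l}. F (\<gamma> t) + c \<le> K' (\<gamma> t)"
      proof (intro exI[of _ "\<epsilon> * c"] conjI ballI)
        fix t assume t: "t \<in> {0..l}"
        have X: "\<gamma> t \<in> X" using arc_length_curve_in[OF \<gamma> t] .
        have "\<epsilon> * c \<le> \<epsilon> * w (\<gamma> t)" using c(2)[OF X curve_bounded[OF \<gamma> z t]] \<epsilon> by simp
        then show "F (\<gamma> t) + \<epsilon> * c \<le> K' (\<gamma> t)" using G(1)[OF X] by (simp add: K'_def)
      qed (use c \<epsilon> in simp)
    qed (use FN in \<open>auto simp: K'_def\<close>)
    have [measurable]: "h \<in> borel_measurable m" unfolding h_def by measurable
    have Fp: "(F x powr a) powr p = F x powr s" for x by (simp add: powr_powr a)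
    have fin: "(\<integral>\<^sup>+ x. ennreal ((F x powr a) powr p) * ennreal (d z x powr - s) \<partial>m) < \<infinity>"
      using H_fin by (simp only: Fp)
    have FNa: "0 \<le> F x powr a \<and> F x powr a \<le> N powr a" if "x \<in> X" for x
      using FN[OF that] a by (auto intro!: powr_mono2)
    have "?H \<le> ennreal hardy_const * (\<integral>\<^sup>+ x. enn_powr (h x) p * ennreal (d z x powr (p - s)) \<partial>m)"
      using weighted_hardy[OF _ FNa ugF fin] by (simp add: Fp)
    also have "\<dots> \<le> ennreal hardy_const * (\<integral>\<^sup>+ x. ennreal (s powr s) *
        (ennreal (?\<tau> * 2 powr s) * (ennreal (F x powr s) * ennreal (d z x powr - s))
        + ennreal (?\<tau> * 2 powr s * \<epsilon> powr s) * (ennreal (w x powr s) * ennreal (d z x powr - s))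
        + ennreal (?\<tau> powr - s) * enn_powr (g x) s) \<partial>m)"
    proof (intro mult_left_mono nn_integral_mono_AE)
      show "AE x in m. enn_powr (h x) p * ennreal (d z x powr (p - s)) \<le> ennreal (s powr s) *
        (ennreal (?\<tau> * 2 powr s) * (ennreal (F x powr s) * ennreal (d z x powr - s))
        + ennreal (?\<tau> * 2 powr s * \<epsilon> powr s) * (ennreal (w x powr s) * ennreal (d z x powr - s))
        + ennreal (?\<tau> powr - s) * enn_powr (g x) s)"
        using AE_off_center G(2) AE_space
      proof eventually_elim
        case (elim x)
        then have x: "0 < d z x" "G x = F x" "x \<in> X" by (auto simp: space_m)
        let ?x = "K' x / d z x"
        have "enn_powr (h x) p = ennreal ((a * K' x powr (a - 1)) powr p) * enn_powr (g x) p"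
          using a unfolding h_def by (intro enn_powr_mult) simp
        also have "(a * K' x powr (a - 1)) powr p = a powr p * K' x powr (s - p)"
          using a K0 by (simp add: powr_mult powr_powr algebra_simps)
        finally have "enn_powr (h x) p * ennreal (d z x powr (p - s))
          = ennreal (a powr p) * (ennreal (K' x powr (s - p) * d z x powr (p - s)) * enn_powr (g x) p)"
          by (simp add: ennreal_mult mult_ac)
        also have "K' x powr (s - p) * d z x powr (p - s) = ?x powr (s - p)"
          using x K0 powr_minus_divide[of "d z x" "s - p"] by (simp add: powr_divide)
        also have "ennreal (a powr p) * (ennreal (?x powr (s - p)) * enn_powr (g x) p)
           \<le> ennreal (s powr s) * (ennreal (?\<tau> * ?x powr s) + ennreal (?\<tau> powr - s) * enn_powr (g x) s)"
        proof (intro mult_mono young_split ennreal_leI)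
          have "a powr p \<le> a powr s" using a ps by (intro powr_mono) auto
          also have "\<dots> \<le> s powr s" using a a_le s0 by (intro powr_mono2) auto
          finally show "a powr p \<le> s powr s" .
        qed (use young_param K0 x p ps in auto)
        also have "\<dots> \<le> ennreal (s powr s) *
          (ennreal (?\<tau> * 2 powr s) * (ennreal (F x powr s) * ennreal (d z x powr - s))
          + ennreal (?\<tau> * 2 powr s * \<epsilon> powr s) * (ennreal (w x powr s) * ennreal (d z x powr - s))
          + ennreal (?\<tau> powr - s) * enn_powr (g x) s)"
        proof (intro mult_left_mono add_right_mono)
          have "K' x powr s \<le> 2 powr s * (F x powr s + (\<epsilon> * w x) powr s)"
            unfolding K'_def x(2) using FN[OF x(3)] w0 \<epsilon> s0 by (intro powr_add_le_real) auto
          then have "?\<tau> * (K' x powr s * d z x powr - s)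
            \<le> ?\<tau> * ((2 powr s * (F x powr s + (\<epsilon> * w x) powr s)) * d z x powr - s)"
            using young_param by (intro mult_left_mono mult_right_mono) auto
          also have "\<dots> = ?\<tau> * 2 powr s * (F x powr s * d z x powr - s)
             + ?\<tau> * 2 powr s * \<epsilon> powr s * (w x powr s * d z x powr - s)"
            using \<epsilon> w0 by (simp add: powr_mult algebra_simps)
          also have "K' x powr s * d z x powr - s = ?x powr s"
            using x K0 by (simp add: powr_divide powr_minus_divide)
          finally have "ennreal (?\<tau> * ?x powr s) \<le> ennreal (?\<tau> * 2 powr s * (F x powr s * d z x powr - s)
             + ?\<tau> * 2 powr s * \<epsilon> powr s * (w x powr s * d z x powr - s))"
            by (rule ennreal_leI)
          also have "\<dots> = ennreal (?\<tau> * 2 powr s) * (ennreal (F x powr s) * ennreal (d z x powr - s))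
            + ennreal (?\<tau> * 2 powr s * \<epsilon> powr s) * (ennreal (w x powr s) * ennreal (d z x powr - s))"
            using young_param by (simp add: ennreal_mult)
          finally show "ennreal (?\<tau> * ?x powr s) \<le> ennreal (?\<tau> * 2 powr s) * (ennreal (F x powr s) * ennreal (d z x powr - s))
            + ennreal (?\<tau> * 2 powr s * \<epsilon> powr s) * (ennreal (w x powr s) * ennreal (d z x powr - s))" .
        qed auto
        finally show ?case .
      qed
    qed auto
    also have "\<dots> = ennreal hardy_const * (ennreal (s powr s) * (ennreal (?\<tau> * 2 powr s) * ?H
        + ennreal (?\<tau> * 2 powr s * \<epsilon> powr s) * ?W + ennreal (?\<tau> powr - s) * ?E))"
      by (simp add: nn_integral_cmult nn_integral_add)
    also have "\<dots> = (ennreal (hardy_const * s powr s * (?\<tau> * 2 powr s * \<epsilon> powr s)) * ?W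
          + ennreal (hardy_const * s powr s * ?\<tau> powr - s) * ?E)
        + ennreal (hardy_const * s powr s * (?\<tau> * 2 powr s)) * ?H"
      using hardy_const_pos young_param by (simp add: ennreal_mult distrib_left mult.assoc add_ac)
    finally have "?H \<le> \<dots>" .
    then have "?H \<le> 2 * (ennreal (hardy_const * s powr s * (?\<tau> * 2 powr s * \<epsilon> powr s)) * ?W
          + ennreal (hardy_const * s powr s * ?\<tau> powr - s) * ?E)"
    proof (rule ennreal_absorb_half[OF _ _ H_fin])
      show "ennreal (hardy_const * s powr s * (?\<tau> * 2 powr s)) * ?H \<le> ennreal (1 / 2) * ?H"
        using young_param(3) by (intro mult_right_mono ennreal_leI) (simp_all add: mult.assoc)
    qed
    also have "\<dots> = ennreal (2 * (hardy_const * s powr s * (?\<tau> * 2 powr s * \<epsilon> powr s))) * ?W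
        + ennreal strong_const * ?E"
      unfolding strong_const_def by (subst (1 2) ennreal_mult'[of 2]) (simp_all only: zero_le_numeral ennreal_numeral distrib_left mult.assoc)
    also have "\<dots> \<le> ennreal (\<epsilon> powr s) * ?W + ennreal strong_const * ?E"
    proof (intro add_right_mono mult_right_mono ennreal_leI)
      have "(hardy_const * s powr s * ?\<tau> * 2 powr s) * (2 * \<epsilon> powr s) \<le> (1 / 2) * (2 * \<epsilon> powr s)"
        using young_param(3) by (intro mult_right_mono) auto
      then show "2 * (hardy_const * s powr s * (?\<tau> * 2 powr s * \<epsilon> powr s)) \<le> \<epsilon> powr s"
        by (simp add: mult_ac)
    qed auto
    finally show ?thesis by (simp add: add.commute)
  qed
  show ?thesis
  proof (rule ennreal_le_epsilon)
    fix e :: real assume e: "0 < e"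
    obtain W where W: "?W = ennreal W" "0 \<le> W" using w_int by (cases ?W) auto
    define \<epsilon> where "\<epsilon> = (e / (W + 1)) powr (1 / s)"
    have \<epsilon>: "0 < \<epsilon>" "\<epsilon> powr s = e / (W + 1)" using e W s_ge_1 by (auto simp: \<epsilon>_def powr_powr)
    have "\<epsilon> powr s * W \<le> e" unfolding \<epsilon>(2) using e W(2) by (simp add: field_simps)
    then have "ennreal (\<epsilon> powr s) * ?W \<le> ennreal e"
      unfolding W(1) using W(2) by (simp add: ennreal_leI flip: ennreal_mult)
    then show "?H \<le> ennreal strong_const * ?E + ennreal e"
      using step[OF \<epsilon>(1)] by (meson add_left_mono order_trans)
  qed
qed

text \<open>
  Truncating \<open>\<bar>f\<bar>\<close> at height \<open>n\<close> does not increase the energy; let \<open>n\<close> tend to infinity.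
\<close>

lemma hardy_strong:
  assumes f[measurable]: "f \<in> borel_measurable m"
    and fint: "(\<integral>\<^sup>+ x. ennreal (\<bar>f x\<bar> powr s) \<partial>m) < \<infinity>"
    and ug: "upper_gradient (\<lambda>x. ereal (f x)) g"
  shows "(\<integral>\<^sup>+ x. ennreal (\<bar>f x\<bar> powr s) * ennreal (d z x powr - s) \<partial>m)
    \<le> ennreal strong_const * (\<integral>\<^sup>+ x. enn_powr (g x) s \<partial>m)"
proof -
  have s0: "0 \<le> s" using s_ge_1 by simp
  let ?F = "\<lambda>n x. min \<bar>f x\<bar> (real n)"
  have sup: "(SUP n. ennreal (?F n x powr s) * ennreal (d z x powr - s)) = ennreal (\<bar>f x\<bar> powr s) * ennreal (d z x powr - s)" for x
  proof (rule antisym)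
    show "(SUP n. ennreal (?F n x powr s) * ennreal (d z x powr - s)) \<le> ennreal (\<bar>f x\<bar> powr s) * ennreal (d z x powr - s)"
      using s0 by (intro SUP_least mult_right_mono ennreal_leI powr_mono2) auto
    obtain n :: nat where "\<bar>f x\<bar> < real n" using reals_Archimedean2 by blast
    then have "?F n x = \<bar>f x\<bar>" by simp
    then show "ennreal (\<bar>f x\<bar> powr s) * ennreal (d z x powr - s) \<le> (SUP n. ennreal (?F n x powr s) * ennreal (d z x powr - s))"
      by (intro SUP_upper2[of n]) auto
  qed
  have "(\<integral>\<^sup>+ x. ennreal (\<bar>f x\<bar> powr s) * ennreal (d z x powr - s) \<partial>m)
    = (SUP n. \<integral>\<^sup>+ x. ennreal (?F n x powr s) * ennreal (d z x powr - s) \<partial>m)"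
    unfolding sup[symmetric]
  proof (rule nn_integral_monotone_convergence_SUP)
    show "incseq (\<lambda>n x. ennreal (?F n x powr s) * ennreal (d z x powr - s))"
      using s0 by (intro incseq_SucI le_funI mult_right_mono ennreal_leI powr_mono2) auto
  qed auto
  also have "\<dots> \<le> ennreal strong_const * (\<integral>\<^sup>+ x. enn_powr (g x) s \<partial>m)"
  proof (rule SUP_least)
    fix n :: nat
    have "upper_gradient (\<lambda>x. ereal (?F n x)) (\<lambda>x. ennreal 1 * g x)"
      by (rule upper_gradient_comp_lipschitz[OF ug]) (auto simp: min_def)
    then have ugn: "upper_gradient (\<lambda>x. ereal (?F n x)) g" by simp
    have "(\<integral>\<^sup>+ x. ennreal (?F n x powr s) \<partial>m) \<le> (\<integral>\<^sup>+ x. ennreal (\<bar>f x\<bar> powr s) \<partial>m)"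
      using s0 by (intro nn_integral_mono ennreal_leI powr_mono2) auto
    then have "(\<integral>\<^sup>+ x. ennreal (?F n x powr s) \<partial>m) < \<infinity>" using fint by (rule le_less_trans)
    then show "(\<integral>\<^sup>+ x. ennreal (?F n x powr s) * ennreal (d z x powr - s) \<partial>m)
        \<le> ennreal strong_const * (\<integral>\<^sup>+ x. enn_powr (g x) s \<partial>m)"
      by (intro hardy_bounded[where N = "real n"] ugn) auto
  qed
  finally show ?thesis .
qed

lemma Lspace_iff:
  "f \<in> Lspace s \<longleftrightarrow> f \<in> borel_measurable m \<and> (\<integral>\<^sup>+ x. ennreal (\<bar>f x\<bar> powr s) \<partial>m) < \<infinity>"
proof -
  have "enn_powr y (1 / s) < \<infinity> \<longleftrightarrow> y < \<infinity>" for y by (cases y) auto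
  then show ?thesis by (simp add: Lspace_def Lnorm_def)
qed

lemma Lnorm_powr: "enn_powr (Lnorm s h) s = (\<integral>\<^sup>+ x. enn_powr (h x) s \<partial>m)"
  using s_ge_1 by (simp add: Lnorm_def enn_powr_inverse)

text \<open>
  The Hardy integral with the bounded weight \<open>min (d z x powr - s) k\<close> is controlled under
  convergence in the Lebesgue space, up to the factor \<open>2 powr s\<close> from the triangle inequality;
  the weight is then increased to the full one.
\<close>

lemma hardy_relaxed:
  assumes f[measurable]: "f \<in> borel_measurable m"
    and fs: "\<And>i. fs i \<in> Lspace s" "\<And>i. upper_gradient (\<lambda>x. ereal (fs i x)) (gs i)"
    and lim: "(\<lambda>i. Lnorm s (\<lambda>x. ennreal \<bar>fs i x - f x\<bar>)) \<longlonglongrightarrow> 0"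
  shows "(\<integral>\<^sup>+ x. ennreal (\<bar>f x\<bar> powr s) * ennreal (d z x powr - s) \<partial>m)
    \<le> ennreal (2 powr s * strong_const) * liminf (\<lambda>i. enn_powr (Lnorm s (gs i)) s)"
proof -
  have s0: "0 \<le> s" "0 < s" using s_ge_1 by auto
  have fsm[measurable]: "fs i \<in> borel_measurable m" for i using fs by (simp add: Lspace_iff)
  define D where "D = (\<lambda>i. \<integral>\<^sup>+ x. ennreal (\<bar>fs i x - f x\<bar> powr s) \<partial>m)"
  define E where "E = (\<lambda>i. \<integral>\<^sup>+ x. enn_powr (gs i x) s \<partial>m)"
  have D0: "D \<longlonglongrightarrow> 0"
    using enn_powr_tendsto_0[OF lim s0(2)] by (simp add: Lnorm_powr D_def)
  let ?C = "2 powr s * strong_const"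
  have C: "0 < ?C" using strong_const_pos by simp
  let ?k = "\<lambda>k x. ennreal (\<bar>f x\<bar> powr s) * ennreal (min (d z x powr - s) (real k))"
  have trunc: "(\<integral>\<^sup>+ x. ?k k x \<partial>m) \<le> ennreal ?C * E i + ennreal (2 powr s * real k) * D i" for k i
  proof -
    let ?v = "\<lambda>x. min (d z x powr - s) (real k)"
    have "(\<integral>\<^sup>+ x. ?k k x \<partial>m) \<le> (\<integral>\<^sup>+ x. ennreal (2 powr s) * (ennreal (\<bar>fs i x\<bar> powr s) * ennreal (d z x powr - s))
       + ennreal (2 powr s * real k) * ennreal (\<bar>fs i x - f x\<bar> powr s) \<partial>m)"
    proof (rule nn_integral_mono)
      fix x
      have "\<bar>f x\<bar> powr s \<le> (\<bar>fs i x\<bar> + \<bar>fs i x - f x\<bar>) powr s" using s0 by (intro powr_mono2) auto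
      also have "\<dots> \<le> 2 powr s * (\<bar>fs i x\<bar> powr s + \<bar>fs i x - f x\<bar> powr s)"
        using s0 by (intro powr_add_le_real) auto
      finally have "\<bar>f x\<bar> powr s * ?v x \<le> 2 powr s * (\<bar>fs i x\<bar> powr s + \<bar>fs i x - f x\<bar> powr s) * ?v x"
        by (intro mult_right_mono) auto
      also have "\<dots> = 2 powr s * (\<bar>fs i x\<bar> powr s * ?v x + \<bar>fs i x - f x\<bar> powr s * ?v x)"
        by (simp only: distrib_left distrib_right mult.assoc)
      also have "\<dots> \<le> 2 powr s * (\<bar>fs i x\<bar> powr s * d z x powr - s + \<bar>fs i x - f x\<bar> powr s * real k)"
        by (intro mult_left_mono add_mono) auto
      also have "\<dots> = 2 powr s * (\<bar>fs i x\<bar> powr s * d z x powr - s) + (2 powr s * real k) * \<bar>fs i x - f x\<bar> powr s"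
        by (simp add: algebra_simps)
      finally show "?k k x \<le> ennreal (2 powr s) * (ennreal (\<bar>fs i x\<bar> powr s) * ennreal (d z x powr - s))
         + ennreal (2 powr s * real k) * ennreal (\<bar>fs i x - f x\<bar> powr s)"
        by (simp add: ennreal_leI flip: ennreal_mult ennreal_plus)
    qed
    also have "\<dots> = ennreal (2 powr s) * (\<integral>\<^sup>+ x. ennreal (\<bar>fs i x\<bar> powr s) * ennreal (d z x powr - s) \<partial>m)
       + ennreal (2 powr s * real k) * D i"
      by (simp add: nn_integral_add nn_integral_cmult D_def)
    also have "\<dots> \<le> ennreal (2 powr s) * (ennreal strong_const * E i) + ennreal (2 powr s * real k) * D i"
      unfolding E_def using fs by (intro add_right_mono mult_left_mono hardy_strong) (auto simp: Lspace_iff)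
    also have "ennreal (2 powr s) * (ennreal strong_const * E i) = ennreal ?C * E i"
      by (simp add: ennreal_mult' mult.assoc)
    finally show ?thesis .
  qed
  have lower: "(\<integral>\<^sup>+ x. ?k k x \<partial>m) \<le> ennreal ?C * liminf E" for k
  proof (rule ennreal_le_epsilon)
    fix e :: real assume fin: "ennreal ?C * liminf E < top" and e: "0 < e"
    have Lfin: "liminf E < top"
    proof (rule ccontr)
      assume "\<not> liminf E < top"
      then have "liminf E = top" by (simp add: not_less top_unique)
      moreover have "ennreal ?C \<noteq> 0" using C unfolding ennreal_eq_0_iff by linarith
      ultimately have "ennreal ?C * liminf E = top" by (simp only: ennreal_mult_top if_False)
      then show False using fin by simp
    qed
    define \<delta> where "\<delta> = e / (?C + 2 powr s * real k + 1)"
    have den: "0 < ?C + 2 powr s * real k + 1" using C by (intro add_pos_pos add_pos_nonneg) auto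
    have \<delta>: "0 < \<delta>" using den e by (simp add: \<delta>_def)
    have \<delta>e: "(?C + 2 powr s * real k) * \<delta> \<le> e"
    proof -
      have "(?C + 2 powr s * real k) * \<delta> \<le> (?C + 2 powr s * real k + 1) * \<delta>" using \<delta> by (intro mult_right_mono) auto
      also have "\<dots> = e" using den by (simp add: \<delta>_def)
      finally show ?thesis .
    qed
    have "\<not> eventually (\<lambda>i. liminf E + ennreal \<delta> \<le> E i) sequentially"
    proof
      assume "eventually (\<lambda>i. liminf E + ennreal \<delta> \<le> E i) sequentially"
      then have "liminf E + ennreal \<delta> \<le> liminf E" by (rule Liminf_bounded)
      moreover obtain l where "liminf E = ennreal l" "0 \<le> l" using Lfin by (cases "liminf E") auto
      ultimately have "ennreal (l + \<delta>) \<le> ennreal l" using \<delta> by simp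
      then show False using \<delta> \<open>0 \<le> l\<close> by (subst (asm) ennreal_le_iff) auto
    qed
    then have "frequently (\<lambda>i. E i < liminf E + ennreal \<delta>) sequentially" by (simp add: frequently_def not_less)
    moreover have "eventually (\<lambda>i. D i < ennreal \<delta>) sequentially" using D0 \<delta> by (intro order_tendstoD) auto
    ultimately have "frequently (\<lambda>i. E i < liminf E + ennreal \<delta> \<and> D i < ennreal \<delta>) sequentially"
      by (rule frequently_eventually_frequently)
    then obtain i where i: "E i < liminf E + ennreal \<delta>" "D i < ennreal \<delta>" by (auto dest: frequently_ex)
    have "(\<integral>\<^sup>+ x. ?k k x \<partial>m) \<le> ennreal ?C * (liminf E + ennreal \<delta>) + ennreal (2 powr s * real k) * ennreal \<delta>"
      using i by (intro order_trans[OF trunc[of k i]] add_mono mult_left_mono) auto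
    also have "\<dots> = ennreal ?C * liminf E + (ennreal ?C * ennreal \<delta> + ennreal (2 powr s * real k) * ennreal \<delta>)"
      by (simp only: distrib_left add.assoc)
    also have "\<dots> \<le> ennreal ?C * liminf E + ennreal e"
    proof (rule add_left_mono)
      have "ennreal b * ennreal \<delta> + ennreal c * ennreal \<delta> = ennreal ((b + c) * \<delta>)" if "0 \<le> b" "0 \<le> c" for b c
        using that \<delta> by (simp add: distrib_right ennreal_mult)
      then have "ennreal ?C * ennreal \<delta> + ennreal (2 powr s * real k) * ennreal \<delta> = ennreal ((?C + 2 powr s * real k) * \<delta>)"
        using C by simp
      also have "\<dots> \<le> ennreal e" using \<delta>e by (rule ennreal_leI)
      finally show "ennreal ?C * ennreal \<delta> + ennreal (2 powr s * real k) * ennreal \<delta> \<le> ennreal e" .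
    qed
    finally show "(\<integral>\<^sup>+ x. ?k k x \<partial>m) \<le> ennreal ?C * liminf E + ennreal e" .
  qed
  have sup: "(SUP k. ?k k x) = ennreal (\<bar>f x\<bar> powr s) * ennreal (d z x powr - s)" for x
  proof (rule antisym)
    show "(SUP k. ?k k x) \<le> ennreal (\<bar>f x\<bar> powr s) * ennreal (d z x powr - s)"
      by (intro SUP_least mult_left_mono ennreal_leI) auto
    obtain k :: nat where "d z x powr - s < real k" using reals_Archimedean2 by blast
    then have "min (d z x powr - s) (real k) = d z x powr - s" by simp
    then show "ennreal (\<bar>f x\<bar> powr s) * ennreal (d z x powr - s) \<le> (SUP k. ?k k x)"
      by (intro SUP_upper2[of k]) auto
  qed
  have "(\<integral>\<^sup>+ x. ennreal (\<bar>f x\<bar> powr s) * ennreal (d z x powr - s) \<partial>m) = (SUP k. \<integral>\<^sup>+ x. ?k k x \<partial>m)"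
    unfolding sup[symmetric]
  proof (rule nn_integral_monotone_convergence_SUP)
    show "incseq (\<lambda>k x. ?k k x)"
      by (intro incseq_SucI le_funI mult_left_mono ennreal_leI) auto
  qed auto
  also have "\<dots> \<le> ennreal ?C * liminf E" by (intro SUP_least lower)
  also have "E = (\<lambda>i. enn_powr (Lnorm s (gs i)) s)" by (simp add: E_def Lnorm_powr)
  finally show ?thesis .
qed

lemma hardy_cheeger:
  assumes "f \<in> H1 s"
  shows "(\<integral>\<^sup>+ x. ennreal (\<bar>f x\<bar> powr s) / ennreal (d z x powr s) \<partial>m)
    \<le> ennreal (2 powr s * strong_const) * cheeger s f"
proof -
  have f[measurable]: "f \<in> borel_measurable m" using assms by (simp add: H1_def Lspace_iff)
  let ?c = "ennreal (2 powr s * strong_const)"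
  let ?H = "\<integral>\<^sup>+ x. ennreal (\<bar>f x\<bar> powr s) * ennreal (d z x powr - s) \<partial>m"
  have c: "0 < ?c" "?c \<noteq> 0" "?c \<noteq> top" using strong_const_pos by auto
  have "(\<integral>\<^sup>+ x. ennreal (\<bar>f x\<bar> powr s) / ennreal (d z x powr s) \<partial>m) = ?H"
  proof (rule nn_integral_cong_AE)
    show "AE x in m. ennreal (\<bar>f x\<bar> powr s) / ennreal (d z x powr s) = ennreal (\<bar>f x\<bar> powr s) * ennreal (d z x powr - s)"
      using AE_off_center by eventually_elim
        (simp add: divide_ennreal powr_minus divide_inverse flip: ennreal_mult)
  qed
  also have "?H / ?c \<le> cheeger s f"
    unfolding cheeger_def
  proof (rule Inf_greatest, clarify)
    fix fs gs
    assume "\<forall>i. fs i \<in> Lspace s \<and> upper_gradient (\<lambda>x. ereal (fs i x)) (gs i)"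
      "(\<lambda>i. Lnorm s (\<lambda>x. ennreal \<bar>fs i x - f x\<bar>)) \<longlonglongrightarrow> 0"
    then have "?H \<le> ?c * liminf (\<lambda>i. enn_powr (Lnorm s (gs i)) s)" by (intro hardy_relaxed) auto
    then show "?H / ?c \<le> liminf (\<lambda>i. enn_powr (Lnorm s (gs i)) s)"
      using c by (intro divide_le_posI_ennreal) (auto simp: mult.commute)
  qed
  then have "?c * (?H / ?c) \<le> ?c * cheeger s f" by (rule mult_left_mono) simp
  then have "?H \<le> ?c * cheeger s f" using c by (simp add: ennreal_times_divide ennreal_mult_divide_eq mult.commute[of ?c])
  finally show ?thesis .
qed

end

lemma exists_small_powr:
  fixes c a :: real
  assumes "0 < c" "0 < a"
  obtains \<delta> where "0 < \<delta>" "\<And>t. 0 < t \<Longrightarrow> t \<le> \<delta> \<Longrightarrow> t powr a \<le> c"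
proof (rule that[of "c powr (1 / a)"])
  fix t assume "0 < t" "t \<le> c powr (1 / a)"
  then have "t powr a \<le> (c powr (1 / a)) powr a" using assms by (intro powr_mono2) auto
  then show "t powr a \<le> c" using assms by (simp add: powr_powr)
qed (use assms in simp)

text \<open>
  The doubling inequality is closed in the constant, so it holds for the infimum of all admissible
  ones.
\<close>

lemma (in metric_measure_space) doubling_dim_attained:
  assumes "doubling_with C" "doubling_dim = Q" "x \<in> X" "0 < r"
  shows "measure m (mball x (2 * r)) \<le> 2 powr Q * measure m (mball x r)"
proof -
  let ?S = "{C. doubling_with C}"
  have "1 \<le> Inf ?S" using assms(1) by (intro cInf_greatest) (auto simp: doubling_with_def)
  then have Q: "2 powr Q = Inf ?S" using assms(2) by (auto simp: doubling_dim_def)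
  have pos: "0 < measure m (mball x r)" using assms by (intro measure_mball_pos)
  have "measure m (mball x (2 * r)) / measure m (mball x r) \<le> Inf ?S"
    using assms(1,3,4) pos by (intro cInf_greatest) (auto simp: doubling_with_def pos_divide_le_eq)
  then show ?thesis using pos by (simp add: Q pos_divide_le_eq)
qed

theorem theorem1p3:
  fixes Q C_o \<eta> s C_P lam :: real
  assumes "1 < Q" and "0 < C_o" and "\<eta> \<le> Q" and "s < \<eta>" and "0 < C_P" and "1 \<le> lam"
  shows "\<exists>C>0. \<forall>(X :: 'a set) d m p z f.
    metric_measure_space X d m \<and> Metric_space.mcomplete X d \<and>
    metric_measure_space.PI_space X d m p C_P lam \<and>
    metric_measure_space.doubling_dim X d m = Q \<and>
    1 \<le> p \<and> p < Q \<and> p < \<eta> \<and> p \<le> s \<and>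
    z \<in> X \<and>
    (\<forall>r R. 0 < r \<and> r \<le> R \<longrightarrow>
       measure m (Metric_space.mball X d z R) / measure m (Metric_space.mball X d z r)
         \<ge> C_o * (R / r) powr \<eta>) \<and>
    f \<in> metric_measure_space.H1 X d m s
    \<longrightarrow> (\<integral>\<^sup>+ x. ennreal (\<bar>f x\<bar> powr s) / ennreal (d z x powr s) \<partial>m)
          \<le> ennreal C * metric_measure_space.cheeger X d m s f"
proof (cases "1 \<le> s")
  \<comment> \<open>No exponent \<open>p\<close> satisfies \<open>1 \<le> p \<le> s\<close>.\<close>
  case False
  then show ?thesis by (intro exI[of _ 1]) auto
next
  case s1: True
  define C_D where "C_D = (2::real) powr Q"
  have C_D: "1 \<le> C_D" using assms(1) by (simp add: C_D_def ge_one_powr_ge_zero)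
  have gap: "0 < \<eta> - s" using assms by simp
  obtain n where n: "32 * lam \<le> 2 ^ n" using real_arch_pow[of 2 "32 * lam"] by (auto intro: less_imp_le)
  \<comment> \<open>The order of choices matters: first \<open>n\<close>, then \<open>T\<close> from \<open>n\<close>, then \<open>n'\<close> and \<open>\<kappa>\<close>
    from \<open>T\<close>, and finally \<open>\<sigma>\<close> and \<open>L\<close>.\<close>
  define A where "A = C_D ^ n * (6 powr s * 2 * 4 powr \<eta> / C_o) * 2"
  have A: "0 < A" using C_D assms by (simp add: A_def)
  obtain \<delta> where \<delta>: "0 < \<delta>" "\<And>t. 0 < t \<Longrightarrow> t \<le> \<delta> \<Longrightarrow> t powr (\<eta> - s) \<le> 1 / (2 * A)"
    using exists_small_powr[of "1 / (2 * A)" "\<eta> - s"] A gap by auto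
  define T where "T = max 4 (1 / \<delta>)"
  have T: "4 \<le> T" by (simp add: T_def)
  have "inverse T \<le> \<delta>" using \<delta>(1) T le_imp_inverse_le[of "1 / \<delta>" T] by (simp add: T_def)
  then have "inverse T powr (\<eta> - s) \<le> 1 / (2 * A)" using T by (intro \<delta>) auto
  then have "A * inverse T powr (\<eta> - s) \<le> 1 / 2" using A by (simp add: field_simps)
  moreover have "inverse T powr (\<eta> - s) = T powr - \<eta> * T powr s"
    using T by (simp add: inverse_powr powr_minus[symmetric] flip: powr_add)
  ultimately have absorb: "C_D ^ n * (6 powr s * 2 * 4 powr \<eta> / C_o) * T powr - \<eta> * (2 * T powr s) \<le> 1 / 2"
    by (simp add: A_def mult_ac)
  obtain n' where n': "4 * lam * T \<le> 2 ^ n'" using real_arch_pow[of 2 "4 * lam * T"] by (auto intro: less_imp_le)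
  define \<kappa> where "\<kappa> = 1 / (2 * C_D ^ n')"
  define P where "P = max 1 C_P"
  define K where "K = 4 / \<kappa> * (4 * P) powr s"
  have \<kappa>: "0 < \<kappa>" using C_D by (simp add: \<kappa>_def)
  have P: "1 \<le> P" by (simp add: P_def)
  obtain \<delta>1 where \<delta>1: "0 < \<delta>1" "\<And>t. 0 < t \<Longrightarrow> t \<le> \<delta>1 \<Longrightarrow> t powr \<eta> \<le> \<kappa> / 2 * C_o"
    using exists_small_powr[of "\<kappa> / 2 * C_o" \<eta>] \<kappa> assms s1 by auto
  define B where "B = (2 * P) powr s * 2 powr \<eta> / C_o"
  have B: "0 < B" using P assms by (simp add: B_def)
  obtain \<delta>2 where \<delta>2: "0 < \<delta>2" "\<And>t. 0 < t \<Longrightarrow> t \<le> \<delta>2 \<Longrightarrow> t powr (\<eta> - s) \<le> \<kappa> * 2 powr - s / 4 / B"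
    using exists_small_powr[of "\<kappa> * 2 powr - s / 4 / B" "\<eta> - s"] \<kappa> B gap by auto
  define \<sigma> where "\<sigma> = min (1 / (2 * T)) (min (\<delta>1 / 2) \<delta>2)"
  have \<sigma>: "0 < \<sigma>" using T \<delta>1 \<delta>2 by (auto simp: \<sigma>_def)
  have \<sigma>1: "\<sigma> * T \<le> 1 / 2"
  proof -
    have "\<sigma> * T \<le> 1 / (2 * T) * T" using T by (intro mult_right_mono) (auto simp: \<sigma>_def)
    then show ?thesis using T by simp
  qed
  have \<sigma>2: "(2 * \<sigma>) powr \<eta> / C_o \<le> \<kappa> / 2"
    using \<delta>1(2)[of "2 * \<sigma>"] \<sigma> assms by (simp add: \<sigma>_def pos_divide_le_eq)
  have "\<sigma> powr (\<eta> - s) \<le> \<kappa> * 2 powr - s / 4 / B" using \<sigma> by (intro \<delta>2) (auto simp: \<sigma>_def)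
  then have \<sigma>3: "(2 * P) powr s * 2 powr \<eta> / C_o * \<sigma> powr (\<eta> - s) \<le> \<kappa> * 2 powr - s / 4"
    using B unfolding B_def[symmetric] by (simp add: pos_le_divide_eq mult_ac)
  obtain L where L: "lam / \<sigma> \<le> 2 ^ L" using real_arch_pow[of 2 "lam / \<sigma>"] by (auto intro: less_imp_le)
  define C where "C = max 1 (2 powr s * hardy_scales.strong_const s lam C_D T n L P K)"
  show ?thesis
  proof (intro exI[of _ C] conjI allI impI; (elim conjE)?)
    show "0 < C" by (simp add: C_def)
    fix X :: "'a set" and d m p z f
    assume mm: "metric_measure_space X d m"
    interpret metric_measure_space X d m by (rule mm)
    assume PI: "PI_space p C_P lam" and dim: "doubling_dim = Q" and p: "1 \<le> p" "p \<le> s" and z: "z \<in> X"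
      and growth: "\<forall>r R. 0 < r \<and> r \<le> R \<longrightarrow>
        C_o * (R / r) powr \<eta> \<le> measure m (mball z R) / measure m (mball z r)"
      and f: "f \<in> H1 s"
    obtain C0 where "doubling_with C0" using PI by (auto simp: PI_space_def)
    interpret hardy_scales X d m z p s \<eta> C_P lam C_D C_o T \<sigma> n n' L \<kappa> P K
    proof unfold_locales
      show "poincare p C_P lam" using PI by (simp add: PI_space_def)
      show "measure m (mball x (2 * r)) \<le> C_D * measure m (mball x r)" if "x \<in> X" "0 < r" for x r
        unfolding C_D_def by (rule doubling_dim_attained[OF \<open>doubling_with C0\<close> dim that])
      show "C_o * (R / r) powr \<eta> \<le> measure m (mball z R) / measure m (mball z r)" if "0 < r" "r \<le> R" for r R
        using growth that by blast
    qed (fact z p assms C_D T n n' \<kappa>_def P_def K_def \<sigma> \<sigma>1 \<sigma>2 \<sigma>3 L absorb)+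
    have "(\<integral>\<^sup>+ x. ennreal (\<bar>f x\<bar> powr s) / ennreal (d z x powr s) \<partial>m)
      \<le> ennreal (2 powr s * strong_const) * cheeger s f"
      by (rule hardy_cheeger[OF f])
    also have "\<dots> \<le> ennreal C * cheeger s f"
      by (intro mult_right_mono ennreal_leI) (auto simp: C_def)
    finally show "(\<integral>\<^sup>+ x. ennreal (\<bar>f x\<bar> powr s) / ennreal (d z x powr s) \<partial>m) \<le> ennreal C * cheeger s f" .
  qed
qed

end
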